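(* Let $L,m>0$, $2<p<6$ and $k>0$. Then the generalized free energy $\log\widetilde Z(\beta^{-1}k,\beta,\lambda)$ is analytic in $(\beta,\lambda)$ on a domain in $\mathbb{C}^2$ containing all $(\beta,\lambda)$ with $\Re\beta>0$ and $|\Im\beta|$, $|\Im\lambda|$ sufficiently small (depending on $\Re\beta$ and $\Re\lambda$).
   Context: $\mathbb{T}^1$ is the circle of circumference $L$, $\Delta$ its Laplacian, $\Omega=C(\mathbb{T}^1)$ the space of continuous complex-valued functions on it, and $\|\cdot\|_q$ the norm of $L^q(\mathbb{T}^1)$. For $\beta>0$ and $j\in\mathbb{Z}$ let $u_j(x)=L^{-1/2}e^{2\pi i jx/L}$ and $\theta_j=\beta((2\pi j/L)^2+m^2)$. $\mu_\beta$ is the centered Gaussian probability measure on $\Omega$ with covariance $\beta^{-1}(m^2-\Delta)^{-1}$; that is, under $\mu_\beta$ the Fourier coefficients $X_j=\langle u_j,\phi\rangle_{L^2}$ are independent, and the law of $X_j$ on $\mathbb{C}\cong\mathbb{R}^2$ has density $\frac{\theta_j}{2\pi}e^{-\theta_j|x|^2/2}$. Let $N(\phi)=\|\phi\|_2^2$. For $n>0$, $\nu_{n,\beta}$ is the law of $\phi$ under $\mu_\beta$ conditioned on $N(\phi)=n$, defined precisely as the weak limit, as $\ell\to\infty$, of the probability measures proportional to $K_\ell(n-N(\phi))\,d\mu_\beta(\phi)$, where $K_\ell(t)=\frac1\ell\frac{1-\cos(\ell t)}{1-\cos t}$ for $|t|\le\pi$ and $K_\ell(t)=0$ for $|t|>\pi$.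 The canonical partition function is, for $n,\beta>0$, $$\widetilde Z(n,\beta,\lambda)=e^{\frac{\beta}{2}m^2n}\int_\Omega\exp\left[\beta\frac{\lambda}{p}\|\phi\|_p^p\right]d\nu_{n,\beta}.$$ By the change of variables $\psi=\sqrt\beta\,\phi$, $$\widetilde Z(\beta^{-1}k,\beta,\lambda)=e^{\frac12m^2k}\int_\Omega\exp\left[\beta^{1-p/2}\frac{\lambda}{p}\|\psi\|_p^p\right]d\nu_{k,1}(\psi),$$ and this formula (principal branch) defines $\widetilde Z(\beta^{-1}k,\beta,\lambda)$ for complex $\beta$ with $\Re\beta>0$ and complex $\lambda$. It is strictly positive for $\beta>0$, $\lambda\in\mathbb{R}$, and $\log$ denotes the branch that is real there. *)

theory Defs
  imports "HOL-Probability.Probability"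
begin

(* A continuous function on the circle of circumference L is an L-periodic element of
   the type of bounded continuous functions on the real line; the metric is the sup metric. *)

definition Omega :: "real \<Rightarrow> (real \<Rightarrow>\<^sub>C complex) set" where
  "Omega L = {\<phi>. \<forall>x. apply_bcontfun \<phi> (x + L) = apply_bcontfun \<phi> x}"

definition borel_Omega :: "real \<Rightarrow> (real \<Rightarrow>\<^sub>C complex) measure" where
  "borel_Omega L = restrict_space borel (Omega L)"

definition circle_norm :: "real \<Rightarrow> real \<Rightarrow> (real \<Rightarrow>\<^sub>C complex) \<Rightarrow> real" where
  "circle_norm L q \<phi> = (LINT x:{0..L}|lborel. cmod (apply_bcontfun \<phi> x) powr q) powr (1 / q)"

definition particle_number :: "real \<Rightarrow> (real \<Rightarrow>\<^sub>C complex) \<Rightarrow> real" where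
  "particle_number L \<phi> = (circle_norm L 2 \<phi>)\<^sup>2"

definition fourier_mode :: "real \<Rightarrow> int \<Rightarrow> real \<Rightarrow> complex" where
  "fourier_mode L j x = complex_of_real (L powr (- 1 / 2)) * cis (2 * pi * real_of_int j * x / L)"

definition fourier_coeff :: "real \<Rightarrow> int \<Rightarrow> (real \<Rightarrow>\<^sub>C complex) \<Rightarrow> complex" where
  "fourier_coeff L j \<phi> = (LINT x:{0..L}|lborel. cnj (fourier_mode L j x) * apply_bcontfun \<phi> x)"

definition mode_weight :: "real \<Rightarrow> real \<Rightarrow> real \<Rightarrow> int \<Rightarrow> real" where
  "mode_weight L m \<beta> j = \<beta> * ((2 * pi * real_of_int j / L)\<^sup>2 + m\<^sup>2)"

(* The Gaussian measure with covariance (m^2 - Laplacian)^(-1) / beta, characterised by the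
   law of its Fourier coefficients. *)

definition is_gaussian_measure ::
    "real \<Rightarrow> real \<Rightarrow> real \<Rightarrow> (real \<Rightarrow>\<^sub>C complex) measure \<Rightarrow> bool" where
  "is_gaussian_measure L m \<beta> M \<longleftrightarrow>
     prob_space M \<and> sets M = sets (borel_Omega L) \<and>
     prob_space.indep_vars M (\<lambda>_. borel) (fourier_coeff L) UNIV \<and>
     (\<forall>j. distributed M lborel (fourier_coeff L j)
        (\<lambda>z. ennreal (mode_weight L m \<beta> j / (2 * pi)
                        * exp (- mode_weight L m \<beta> j * (cmod z)\<^sup>2 / 2))))"

definition gaussian_measure :: "real \<Rightarrow> real \<Rightarrow> real \<Rightarrow> (real \<Rightarrow>\<^sub>C complex) measure" where
  "gaussian_measure L m \<beta> = (THE M. is_gaussian_measure L m \<beta> M)"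

(* The value l at t = 0 is the removable singularity of the quotient. *)

definition fejer_kernel :: "nat \<Rightarrow> real \<Rightarrow> real" where
  "fejer_kernel l t =
     (if \<bar>t\<bar> \<le> pi
      then (if t = 0 then real l else 1 / real l * ((1 - cos (real l * t)) / (1 - cos t)))
      else 0)"

definition tilted_measure ::
    "real \<Rightarrow> real \<Rightarrow> real \<Rightarrow> real \<Rightarrow> nat \<Rightarrow> (real \<Rightarrow>\<^sub>C complex) measure" where
  "tilted_measure L m n \<beta> l =
     (let \<mu> = gaussian_measure L m \<beta>; K = (\<lambda>\<phi>. fejer_kernel l (n - particle_number L \<phi>))
      in density \<mu> (\<lambda>\<phi>. ennreal (K \<phi> / (\<integral>\<phi>'. K \<phi>' \<partial>\<mu>))))"

definition weakly_converges_on ::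
    "'a::metric_space set \<Rightarrow> (nat \<Rightarrow> 'a measure) \<Rightarrow> 'a measure \<Rightarrow> bool" where
  "weakly_converges_on S M N \<longleftrightarrow>
     (\<forall>f :: 'a \<Rightarrow> real. continuous_on S f \<and> bounded (f ` S)
        \<longrightarrow> (\<lambda>l. \<integral>x. f x \<partial>(M l)) \<longlonglongrightarrow> (\<integral>x. f x \<partial>N))"

definition is_conditioned_measure ::
    "real \<Rightarrow> real \<Rightarrow> real \<Rightarrow> real \<Rightarrow> (real \<Rightarrow>\<^sub>C complex) measure \<Rightarrow> bool" where
  "is_conditioned_measure L m n \<beta> N \<longleftrightarrow>
     prob_space N \<and> sets N = sets (borel_Omega L) \<and>
     weakly_converges_on (Omega L) (tilted_measure L m n \<beta>) N"

definition conditioned_measure ::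
    "real \<Rightarrow> real \<Rightarrow> real \<Rightarrow> real \<Rightarrow> (real \<Rightarrow>\<^sub>C complex) measure" where
  "conditioned_measure L m n \<beta> = (THE N. is_conditioned_measure L m n \<beta> N)"

definition boltzmann_weight ::
    "real \<Rightarrow> real \<Rightarrow> complex \<Rightarrow> complex \<Rightarrow> (real \<Rightarrow>\<^sub>C complex) \<Rightarrow> complex" where
  "boltzmann_weight L p \<beta> lam \<psi> =
     exp (\<beta> powr complex_of_real (1 - p / 2) * (lam / complex_of_real p)
          * complex_of_real (circle_norm L p \<psi> powr p))"

(* The canonical partition function at particle number k / beta, after the rescaling
   psi = sqrt beta * phi, which extends it to complex beta with positive real part and complex
   lambda; powr on complex numbers is the principal branch. *)

definition partition_function ::
    "real \<Rightarrow> real \<Rightarrow> real \<Rightarrow> real \<Rightarrow> complex \<Rightarrow> complex \<Rightarrow> complex" where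
  "partition_function L m p k \<beta> lam =
     complex_of_real (exp (m\<^sup>2 * k / 2)) *
     (\<integral>\<psi>. boltzmann_weight L p \<beta> lam \<psi> \<partial>conditioned_measure L m k 1)"

(* Analyticity in two complex variables: near each point of D the function is the sum of an
   (absolutely convergent) double power series. *)

definition analytic2_on :: "(complex \<times> complex \<Rightarrow> complex) \<Rightarrow> (complex \<times> complex) set \<Rightarrow> bool" where
  "analytic2_on f D \<longleftrightarrow>
     (\<forall>(a, b) \<in> D. \<exists>r > 0. \<exists>c :: nat \<Rightarrow> nat \<Rightarrow> complex.
        \<forall>z w. cmod (z - a) < r \<and> cmod (w - b) < r \<longrightarrow>
          ((\<lambda>(i, j). c i j * (z - a) ^ i * (w - b) ^ j) has_sum f (z, w)) UNIV)"

end

theory Submission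
  imports Defs "HOL-Complex_Analysis.Complex_Analysis" "HOL-Real_Asymp.Real_Asymp"
begin

text \<open>The field is realised as a random Fourier series with independent complex Gaussian
  coefficients; a grid argument and Chernoff bounds on dyadic blocks of modes make it converge
  uniformly, and Fejer's theorem identifies the resulting law as the only Gaussian measure.

  The modulus of the zero mode is exponentially distributed and independent of its phase and of the
  other modes. Integrating the Fejer kernel against it shows that conditioning on
  \<open>N(\<phi>) = k\<close> amounts to setting the squared modulus of the zero mode to \<open>k\<close> minus the
  remaining mass \<open>R\<close>, with the bounded weight \<open>exp (- \<theta>\<^sub>0 (k - R) / 2)\<close> on \<open>R < k\<close>.

  With the mass fixed, the modes below \<open>2 ^ n\<close> contribute at most a multiple of \<open>2 powr (n / 2)\<close> to
  the supremum norm, and the remaining ones exceed that size with probability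
  of order \<open>exp (- c * 4 ^ n)\<close>. Since the \<open>p\<close>-th power of the \<open>L^p\<close> norm is at most \<open>k\<close> times the
  \<open>(p - 2)\<close>-nd power of the supremum norm, it has exponential moments of all orders when
  \<open>p - 2 < 4\<close>. The partition function is therefore an entire function of
  \<open>\<beta> powr (1 - p / 2) * lam\<close>, positive on the real axis. Where its real part is positive the principal
  logarithm applies, and the domain is the connected component of that region.\<close>

section \<open>The standard complex Gaussian in polar coordinates\<close>

text \<open>Both measures are selected by \<open>THE\<close>, so each must be shown to exist and to
  be unique before anything can be computed; hence the explicit images of the coefficient law. The
  sup-norm space of bounded continuous functions on the line is not separable, so sums of measurable
  field-valued maps are not automatically measurable; measurability is drawn instead from continuity
  in the coefficient sequence and from pointwise limits. Isolating one mode is what makes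
  conditioning on a null event tractable: given the other modes, \<open>N(\<phi>)\<close> has an
  explicit bounded density, whose only jump meets the value \<open>k\<close> with probability zero.
  The exponent 6 comes from balancing scales: the modes of frequency about \<open>2 ^ n\<close> have
  pointwise variance of order \<open>2 powr (- n)\<close>, so exceeding the size
  \<open>2 powr (n / 2)\<close> costs \<open>exp (- c * 4 ^ n)\<close>, while the gain at that size
  is \<open>exp (M * r ^ n)\<close> with \<open>r = 2 powr ((p - 2) / 2)\<close>. The cost wins for
  every \<open>M\<close> when \<open>r < 4\<close>, that is \<open>p < 6\<close>.\<close>

lemma lborel_complex_eq: "(lborel :: complex measure) = distr (lborel \<Otimes>\<^sub>M lborel) borel (\<lambda>(x, y). Complex x y)"
proof (rule lborel_eqI)
  have meas: "(\<lambda>(x, y). Complex x y) \<in> lborel \<Otimes>\<^sub>M lborel \<rightarrow>\<^sub>M borel"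
    unfolding Complex_eq by measurable
  fix l u :: complex
  assume lu: "\<And>b. b \<in> Basis \<Longrightarrow> l \<bullet> b \<le> u \<bullet> b"
  have "Re l \<le> Re u" "Im l \<le> Im u" using lu[of 1] lu[of \<i>] by (auto simp: Basis_complex_def)
  have "emeasure (distr (lborel \<Otimes>\<^sub>M lborel) borel (\<lambda>(x, y). Complex x y)) (box l u)
      = emeasure (lborel \<Otimes>\<^sub>M lborel) ((\<lambda>(x, y). Complex x y) -` box l u \<inter> space (lborel \<Otimes>\<^sub>M lborel))"
    by (rule emeasure_distr[OF meas]) auto
  also have "(\<lambda>(x, y). Complex x y) -` box l u \<inter> space (lborel \<Otimes>\<^sub>M lborel) = {Re l<..<Re u} \<times> {Im l<..<Im u}"
    by (auto simp: box_def Basis_complex_def space_pair_measure)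
  also have "emeasure (lborel \<Otimes>\<^sub>M lborel) ({Re l<..<Re u} \<times> {Im l<..<Im u})
      = ennreal (Re u - Re l) * ennreal (Im u - Im l)"
    using \<open>Re l \<le> Re u\<close> \<open>Im l \<le> Im u\<close> by (subst lborel.emeasure_pair_measure_Times) auto
  also have "\<dots> = ennreal (\<Prod>b\<in>Basis. (u - l) \<bullet> b)"
    using \<open>Re l \<le> Re u\<close> \<open>Im l \<le> Im u\<close> by (simp add: Basis_complex_def ennreal_mult)
  finally show "emeasure (distr (lborel \<Otimes>\<^sub>M lborel) borel (\<lambda>(x, y). Complex x y)) (box l u) = \<dots>" .
qed auto

lemma nn_integral_lborel_complex:
  fixes f :: "complex \<Rightarrow> ennreal"
  assumes [measurable]: "f \<in> borel_measurable borel"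
  shows "(\<integral>\<^sup>+z. f z \<partial>lborel) = (\<integral>\<^sup>+x. \<integral>\<^sup>+y. f (Complex x y) \<partial>lborel \<partial>lborel)"
    and "(\<integral>\<^sup>+z. f z \<partial>lborel) = (\<integral>\<^sup>+y. \<integral>\<^sup>+x. f (Complex x y) \<partial>lborel \<partial>lborel)"
proof -
  have meas [measurable]: "(\<lambda>(x, y). Complex x y) \<in> lborel \<Otimes>\<^sub>M lborel \<rightarrow>\<^sub>M borel"
    unfolding Complex_eq by measurable
  have eq: "(\<integral>\<^sup>+z. f z \<partial>lborel) = (\<integral>\<^sup>+p. f (case p of (x, y) \<Rightarrow> Complex x y) \<partial>(lborel \<Otimes>\<^sub>M lborel))"
    by (subst lborel_complex_eq, subst nn_integral_distr) auto
  show "(\<integral>\<^sup>+z. f z \<partial>lborel) = (\<integral>\<^sup>+x. \<integral>\<^sup>+y. f (Complex x y) \<partial>lborel \<partial>lborel)"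
    unfolding eq by (subst lborel.nn_integral_fst[symmetric]) auto
  show "(\<integral>\<^sup>+z. f z \<partial>lborel) = (\<integral>\<^sup>+y. \<integral>\<^sup>+x. f (Complex x y) \<partial>lborel \<partial>lborel)"
    unfolding eq by (subst lborel_pair.nn_integral_snd[symmetric]) (auto simp: case_prod_unfold)
qed

lemma nn_integral_lborel_shift:
  fixes f :: "'a::euclidean_space \<Rightarrow> ennreal"
  assumes [measurable]: "f \<in> borel_measurable borel"
  shows "(\<integral>\<^sup>+x. f (c + x) \<partial>lborel) = (\<integral>\<^sup>+x. f x \<partial>lborel)"
  by (subst (2) lborel_distr_plus[of c, symmetric], subst nn_integral_distr) auto

lemma measurable_Complex [measurable]:
  assumes "f \<in> borel_measurable M" "g \<in> borel_measurable M"
  shows "(\<lambda>x. Complex (f x) (g x)) \<in> borel_measurable M"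
  using assms unfolding Complex_eq by measurable

lemma nn_integral_complex_shear_Re:
  fixes f :: "complex \<Rightarrow> ennreal"
  assumes [measurable]: "f \<in> borel_measurable borel"
  shows "(\<integral>\<^sup>+z. f (Complex (a * Im z + Re z) (Im z)) \<partial>lborel) = (\<integral>\<^sup>+z. f z \<partial>lborel)"
  by (subst (1 2) nn_integral_lborel_complex(2))
     (auto intro!: nn_integral_cong nn_integral_lborel_shift[of "\<lambda>x. f (Complex x _)"])

lemma nn_integral_complex_shear_Im:
  fixes f :: "complex \<Rightarrow> ennreal"
  assumes [measurable]: "f \<in> borel_measurable borel"
  shows "(\<integral>\<^sup>+z. f (Complex (Re z) (a * Re z + Im z)) \<partial>lborel) = (\<integral>\<^sup>+z. f z \<partial>lborel)"
  by (subst (1 2) nn_integral_lborel_complex(1))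
     (auto intro!: nn_integral_cong nn_integral_lborel_shift[of "\<lambda>y. f (Complex _ y)"])

lemma nn_integral_complex_rotate:
  fixes f :: "complex \<Rightarrow> ennreal"
  assumes [measurable]: "f \<in> borel_measurable borel" and u: "cmod u = 1"
  shows "(\<integral>\<^sup>+z. f (u * z) \<partial>lborel) = (\<integral>\<^sup>+z. f z \<partial>lborel)"
proof -
  have main: "(\<integral>\<^sup>+z. g (v * z) \<partial>lborel) = (\<integral>\<^sup>+z. g z \<partial>lborel)"
    if v: "cmod v = 1" "v \<noteq> - 1" and [measurable]: "g \<in> borel_measurable borel"
    for g :: "complex \<Rightarrow> ennreal" and v
  proof -
    \<comment> \<open>For \<open>v = cis t\<close> this is \<open>- tan (t / 2)\<close>, the
      classical shear factor; it is finite because \<open>v \<noteq> - 1\<close>.\<close>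
    define a where "a = - Im v / (1 + Re v)"
    define s where "s = Im v"
    have n: "(Re v)\<^sup>2 + (Im v)\<^sup>2 = 1" using v by (simp add: cmod_def)
    have ne: "1 + Re v \<noteq> 0"
    proof
      assume "1 + Re v = 0"
      then have "Re v = -1" by simp
      with n have "Im v = 0" by simp
      with \<open>Re v = -1\<close> v(2) show False by (simp add: complex_eq_iff)
    qed
    have c: "1 + a * s = Re v"
    proof -
      have "(Im v)\<^sup>2 = (1 - Re v) * (1 + Re v)" using n by algebra
      then show ?thesis unfolding a_def s_def using ne by (simp add: field_simps power2_eq_square)
    qed
    have b: "a + a * (a * s) + a = - s"
    proof -
      have "a + a * (a * s) + a = a * (1 + (1 + a * s))" by algebra
      also have "\<dots> = - s" unfolding c using ne by (simp add: a_def s_def)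
      finally show ?thesis .
    qed
    \<comment> \<open>a rotation by an angle other than \<open>\<pi>\<close> is a product of three shears\<close>
    have "v * z = Complex (a * (s * (a * Im z + Re z) + Im z) + (a * Im z + Re z)) (s * (a * Im z + Re z) + Im z)" for z
    proof (rule complex_eqI)
      have "Re (v * z) = Re v * Re z - s * Im z" by (simp add: s_def)
      also have "\<dots> = (1 + a * s) * Re z + (a + a * (a * s) + a) * Im z" unfolding b c by simp
      finally show "Re (v * z) = Re (Complex (a * (s * (a * Im z + Re z) + Im z) + (a * Im z + Re z)) (s * (a * Im z + Re z) + Im z))"
        by (simp add: algebra_simps)
      have "Im (v * z) = Re v * Im z + s * Re z" by (simp add: s_def algebra_simps)
      also have "\<dots> = (1 + a * s) * Im z + s * Re z" unfolding c ..
      finally show "Im (v * z) = Im (Complex (a * (s * (a * Im z + Re z) + Im z) + (a * Im z + Re z)) (s * (a * Im z + Re z) + Im z))"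
        by (simp add: algebra_simps)
    qed
    then have "(\<integral>\<^sup>+z. g (v * z) \<partial>lborel)
       = (\<integral>\<^sup>+z. (\<lambda>z. (\<lambda>z. g (Complex (a * Im z + Re z) (Im z))) (Complex (Re z) (s * Re z + Im z))) (Complex (a * Im z + Re z) (Im z)) \<partial>lborel)"
      by simp
    also have "\<dots> = (\<integral>\<^sup>+z. (\<lambda>z. g (Complex (a * Im z + Re z) (Im z))) (Complex (Re z) (s * Re z + Im z)) \<partial>lborel)"
      by (rule nn_integral_complex_shear_Re) simp
    also have "\<dots> = (\<integral>\<^sup>+z. g (Complex (a * Im z + Re z) (Im z)) \<partial>lborel)"
      by (rule nn_integral_complex_shear_Im) simp
    also have "\<dots> = (\<integral>\<^sup>+z. g z \<partial>lborel)"
      by (rule nn_integral_complex_shear_Re) simp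
    finally show ?thesis .
  qed
  show ?thesis
  proof (cases "u = -1")
    case False
    then show ?thesis using main u by simp
  next
    \<comment> \<open>The half-turn, where the shear factor has its pole, is performed as two
      quarter-turns.\<close>
    case True
    have "(\<integral>\<^sup>+z. f (u * z) \<partial>lborel) = (\<integral>\<^sup>+z. (\<lambda>z. f (\<i> * z)) (\<i> * z) \<partial>lborel)"
      unfolding True by (simp add: mult.assoc[symmetric])
    also have "\<dots> = (\<integral>\<^sup>+z. f (\<i> * z) \<partial>lborel)" by (rule main) (auto simp: complex_eq_iff)
    also have "\<dots> = (\<integral>\<^sup>+z. f z \<partial>lborel)" by (rule main) (auto simp: complex_eq_iff)
    finally show ?thesis .
  qed
qed

text \<open>The disc of squared radius \<open>a\<close> has area \<open>pi * a\<close>, which is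
  linear in \<open>a\<close>. This gives polar integration of radial functions without an angular
  variable.\<close>

lemma distr_lborel_norm_square:
  "distr lborel borel (\<lambda>z::complex. (cmod z)\<^sup>2) = density lborel (\<lambda>t. ennreal (pi * indicator {0..} t))"
proof (rule measure_eqI_generator_eq[where E = "range (\<lambda>a::real. {..a})" and A = "\<lambda>n::nat. {..real n}" and \<Omega> = UNIV])
  show "Int_stable (range (\<lambda>a::real. {..a}))"
    by (auto simp: Int_stable_def)
  show sets_eq: "sets (distr lborel borel (\<lambda>z::complex. (cmod z)\<^sup>2)) = sigma_sets UNIV (range atMost)"
    unfolding borel_eq_atMost by (simp add: sets_measure_of)
  show "sets (density lborel (\<lambda>t::real. ennreal (pi * indicator {0..} t))) = sigma_sets UNIV (range atMost)"
    using sets_eq by simp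
  have eq: "emeasure (distr lborel borel (\<lambda>z::complex. (cmod z)\<^sup>2)) {..a} = ennreal (pi * max 0 a)" for a
  proof -
    have "emeasure (distr lborel borel (\<lambda>z::complex. (cmod z)\<^sup>2)) {..a} = emeasure lborel ((\<lambda>z::complex. (cmod z)\<^sup>2) -` {..a})"
      by (subst emeasure_distr) auto
    also have "\<dots> = ennreal (pi * max 0 a)"
    proof (cases "a \<ge> 0")
      case True
      have "(\<lambda>z::complex. (cmod z)\<^sup>2) -` {..a} = cball 0 (sqrt a)"
        using True by (auto simp: power_mono_iff[symmetric, of _ "sqrt a" 2] simp del: power_mono_iff)
      moreover have "emeasure lborel (cball (0::complex) (sqrt a)) = ennreal (pi * a)"
        using True by (subst emeasure_cball) (auto simp: unit_ball_vol_2)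
      ultimately show ?thesis using True by (simp add: max_def)
    next
      case False
      then have "(\<lambda>z::complex. (cmod z)\<^sup>2) -` {..a} = {}" by (auto simp: not_le) (smt (verit) zero_le_power2)
      with False show ?thesis by simp
    qed
    finally show ?thesis .
  qed
  have eq2: "emeasure (density lborel (\<lambda>t. ennreal (pi * indicator {0..} t))) {..a} = ennreal (pi * max 0 a)" for a
  proof -
    have "emeasure (density lborel (\<lambda>t. ennreal (pi * indicator {0..} t))) {..a} = (\<integral>\<^sup>+t. ennreal pi * indicator {0..a} t \<partial>lborel)"
      by (subst emeasure_density) (auto intro!: nn_integral_cong simp: indicator_def)
    also have "\<dots> = ennreal pi * emeasure lborel {0..a}" by (simp add: nn_integral_cmult)
    also have "\<dots> = ennreal (pi * max 0 a)"
      by (cases "0 \<le> a") (auto simp: ennreal_mult max_def)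
    finally show ?thesis .
  qed
  show "emeasure (distr lborel borel (\<lambda>z::complex. (cmod z)\<^sup>2)) X = emeasure (density lborel (\<lambda>t. ennreal (pi * indicator {0..} t))) X"
    if "X \<in> range atMost" for X
    using that eq eq2 by auto
  show "emeasure (distr lborel borel (\<lambda>z::complex. (cmod z)\<^sup>2)) {..real i} \<noteq> \<infinity>" for i
    unfolding eq by simp
  show "(\<Union>i. {..real i}) = UNIV" by (auto intro: real_arch_simple)
qed auto

lemma nn_integral_complex_radial:
  fixes g :: "real \<Rightarrow> ennreal"
  assumes [measurable]: "g \<in> borel_measurable borel"
  shows "(\<integral>\<^sup>+z. g ((cmod z)\<^sup>2) \<partial>lborel) = (\<integral>\<^sup>+t. ennreal (pi * indicator {0..} t) * g t \<partial>lborel)"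
proof -
  have "(\<integral>\<^sup>+z. g ((cmod z)\<^sup>2) \<partial>lborel) = (\<integral>\<^sup>+t. g t \<partial>distr lborel borel (\<lambda>z::complex. (cmod z)\<^sup>2))"
    by (subst nn_integral_distr) auto
  also have "\<dots> = (\<integral>\<^sup>+t. ennreal (pi * indicator {0..} t) * g t \<partial>lborel)"
    unfolding distr_lborel_norm_square by (rule nn_integral_density) auto
  finally show ?thesis .
qed

section \<open>The Gaussian law of a single Fourier coefficient\<close>

definition complex_gauss :: "real \<Rightarrow> complex measure" where
  "complex_gauss \<theta> = density lborel (\<lambda>z. ennreal (\<theta> / (2 * pi) * exp (- \<theta> * (cmod z)\<^sup>2 / 2)))"

lemma sets_complex_gauss [simp, measurable_cong]: "sets (complex_gauss \<theta>) = sets borel"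
  and space_complex_gauss [simp]: "space (complex_gauss \<theta>) = UNIV"
  by (simp_all add: complex_gauss_def)

lemma nn_integral_complex_gauss:
  assumes [measurable]: "f \<in> borel_measurable borel"
  shows "(\<integral>\<^sup>+z. f z \<partial>complex_gauss \<theta>) = (\<integral>\<^sup>+z. ennreal (\<theta> / (2 * pi) * exp (- \<theta> * (cmod z)\<^sup>2 / 2)) * f z \<partial>lborel)"
  unfolding complex_gauss_def by (rule nn_integral_density) auto

abbreviation exp_law :: "real \<Rightarrow> real measure" where
  "exp_law l \<equiv> density lborel (\<lambda>t. ennreal (exponential_density l t))"

text \<open>The area factor \<open>pi\<close> turns the constant \<open>\<theta> / (2 * pi)\<close>
  into \<open>\<theta> / 2\<close>, so the squared modulus is exponential with that rate.\<close>

lemma nn_integral_complex_gauss_radial: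
  assumes \<theta>: "\<theta> > 0" and [measurable]: "g \<in> borel_measurable borel"
  shows "(\<integral>\<^sup>+z. g ((cmod z)\<^sup>2) \<partial>complex_gauss \<theta>) = (\<integral>\<^sup>+t. g t \<partial>exp_law (\<theta> / 2))"
proof -
  have "(\<integral>\<^sup>+z. g ((cmod z)\<^sup>2) \<partial>complex_gauss \<theta>) =
      (\<integral>\<^sup>+t. ennreal (pi * indicator {0..} t) * (ennreal (\<theta> / (2 * pi) * exp (- \<theta> * t / 2)) * g t) \<partial>lborel)"
    by (subst nn_integral_complex_gauss, simp)
       (rule nn_integral_complex_radial[of "\<lambda>t. ennreal (\<theta> / (2 * pi) * exp (- \<theta> * t / 2)) * g t"], simp)
  also have "\<dots> = (\<integral>\<^sup>+t. ennreal (exponential_density (\<theta> / 2) t) * g t \<partial>lborel)"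
    using \<theta> by (auto intro!: nn_integral_cong simp: exponential_density_def indicator_def mult.assoc[symmetric] ennreal_mult[symmetric])
       (auto simp: algebra_simps)
  also have "\<dots> = (\<integral>\<^sup>+t. g t \<partial>exp_law (\<theta> / 2))"
    by (rule nn_integral_density[symmetric]) auto
  finally show ?thesis .
qed

lemma prob_space_complex_gauss:
  assumes "\<theta> > 0" shows "prob_space (complex_gauss \<theta>)"
proof
  interpret prob_space "exp_law (\<theta> / 2)" using assms by (intro prob_space_exponential_density) auto
  have "emeasure (complex_gauss \<theta>) (space (complex_gauss \<theta>)) = (\<integral>\<^sup>+z. 1 \<partial>complex_gauss \<theta>)" by simp
  also have "\<dots> = (\<integral>\<^sup>+t. 1 \<partial>exp_law (\<theta> / 2))"
    using nn_integral_complex_gauss_radial[OF assms, of "\<lambda>_. 1"] by simp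
  also have "\<dots> = 1" using emeasure_space_1 by simp
  finally show "emeasure (complex_gauss \<theta>) (space (complex_gauss \<theta>)) = 1" .
qed

lemma complex_gauss_rotate:
  assumes [measurable]: "f \<in> borel_measurable borel" and u: "cmod u = 1"
  shows "(\<integral>\<^sup>+z. f (u * z) \<partial>complex_gauss \<theta>) = (\<integral>\<^sup>+z. f z \<partial>complex_gauss \<theta>)"
proof -
  have "(\<integral>\<^sup>+z. f (u * z) \<partial>complex_gauss \<theta>) =
     (\<integral>\<^sup>+z. (\<lambda>z. ennreal (\<theta> / (2 * pi) * exp (- \<theta> * (cmod z)\<^sup>2 / 2)) * f z) (u * z) \<partial>lborel)"
    by (subst nn_integral_complex_gauss) (auto simp: norm_mult u)
  also have "\<dots> = (\<integral>\<^sup>+z. f z \<partial>complex_gauss \<theta>)"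
    by (subst nn_integral_complex_rotate[OF _ u]) (auto simp: nn_integral_complex_gauss)
  finally show ?thesis .
qed

text \<open>Completing the square moves the centre of the Gaussian and leaves a constant factor; by
  translation invariance the rest integrates to 1. The Chernoff bounds rest on this formula.\<close>

lemma complex_gauss_mgf:
  assumes \<theta>: "\<theta> > 0"
  shows "(\<integral>\<^sup>+z. ennreal (exp (Re (c * z))) \<partial>complex_gauss \<theta>) = ennreal (exp ((cmod c)\<^sup>2 / (2 * \<theta>)))"
proof -
  interpret prob_space "complex_gauss \<theta>" by (rule prob_space_complex_gauss[OF \<theta>])
  define d where "d = - cnj c / of_real \<theta>"
  have sq: "- \<theta> * (cmod z)\<^sup>2 / 2 + Re (c * z) = (cmod c)\<^sup>2 / (2 * \<theta>) - \<theta> * (cmod (d + z))\<^sup>2 / 2" for z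
  proof -
    have "(cmod (d + z))\<^sup>2 = (Re z - Re c / \<theta>)\<^sup>2 + (Im z + Im c / \<theta>)\<^sup>2"
      unfolding cmod_power2 d_def by (simp add: algebra_simps)
    also have "\<theta> * \<dots> = \<theta> * ((Re z)\<^sup>2 + (Im z)\<^sup>2) - 2 * (Re c * Re z - Im c * Im z) + ((Re c)\<^sup>2 + (Im c)\<^sup>2) / \<theta>"
      using \<theta> by (simp add: power2_eq_square field_simps)
    finally show ?thesis unfolding cmod_power2 using \<theta> by (simp add: field_simps)
  qed
  have "(\<integral>\<^sup>+z. ennreal (exp (Re (c * z))) \<partial>complex_gauss \<theta>)
     = (\<integral>\<^sup>+z. ennreal (exp ((cmod c)\<^sup>2 / (2 * \<theta>))) * ennreal (\<theta> / (2 * pi) * exp (- \<theta> * (cmod (d + z))\<^sup>2 / 2)) \<partial>lborel)"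
  proof (subst nn_integral_complex_gauss, simp, rule nn_integral_cong)
    fix z
    have "exp (- \<theta> * (cmod z)\<^sup>2 / 2) * exp (Re (c * z)) = exp ((cmod c)\<^sup>2 / (2 * \<theta>)) * exp (- \<theta> * (cmod (d + z))\<^sup>2 / 2)"
      by (simp only: exp_add[symmetric] sq) simp
    then show "ennreal (\<theta> / (2 * pi) * exp (- \<theta> * (cmod z)\<^sup>2 / 2)) * ennreal (exp (Re (c * z)))
      = ennreal (exp ((cmod c)\<^sup>2 / (2 * \<theta>))) * ennreal (\<theta> / (2 * pi) * exp (- \<theta> * (cmod (d + z))\<^sup>2 / 2))"
      using \<theta> by (subst (1 2) ennreal_mult[symmetric]) (auto simp: mult_ac del: times_complex.sel)
  qed
  also have "\<dots> = ennreal (exp ((cmod c)\<^sup>2 / (2 * \<theta>))) * (\<integral>\<^sup>+z. ennreal (\<theta> / (2 * pi) * exp (- \<theta> * (cmod (d + z))\<^sup>2 / 2)) \<partial>lborel)"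
    by (rule nn_integral_cmult) auto
  also have "(\<integral>\<^sup>+z. ennreal (\<theta> / (2 * pi) * exp (- \<theta> * (cmod (d + z))\<^sup>2 / 2)) \<partial>lborel) = (\<integral>\<^sup>+z. 1 \<partial>complex_gauss \<theta>)"
    by (subst nn_integral_lborel_shift[of "\<lambda>z. ennreal (\<theta> / (2 * pi) * exp (- \<theta> * (cmod z)\<^sup>2 / 2))" d])
       (simp, subst nn_integral_complex_gauss, simp_all)
  also have "\<dots> = 1" using emeasure_space_1 by simp
  finally show ?thesis by simp
qed

text \<open>The exponential law of the squared modulus has no atoms. This serves to discard
  \<open>z = 0\<close>, where the phase is undefined, and to see that the mass outside the zero mode
  avoids any given value.\<close>

lemma emeasure_complex_gauss_eq_0I:
  assumes "\<theta> > 0" shows "emeasure (complex_gauss \<theta>) {z. (cmod z)\<^sup>2 = a} = 0"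
proof -
  have "emeasure (complex_gauss \<theta>) {z. (cmod z)\<^sup>2 = a} = (\<integral>\<^sup>+z. indicator {a} ((cmod z)\<^sup>2) \<partial>complex_gauss \<theta>)"
  proof -
    have "(\<lambda>z. indicator {a} ((cmod z)\<^sup>2) :: ennreal) = indicator {z. (cmod z)\<^sup>2 = a}" by (auto simp: indicator_def)
    then show ?thesis by simp
  qed
  also have "\<dots> = (\<integral>\<^sup>+t. indicator {a} t \<partial>exp_law (\<theta> / 2))"
    by (rule nn_integral_complex_gauss_radial[OF assms]) simp
  also have "\<dots> = (\<integral>\<^sup>+t\<in>{a}. ennreal (exponential_density (\<theta> / 2) t) \<partial>lborel)"
    by (subst nn_integral_density) auto
  also have "\<dots> = (\<integral>\<^sup>+t\<in>{}. ennreal (exponential_density (\<theta> / 2) t) \<partial>lborel)"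
    by (rule nn_integral_null_delta) auto
  finally show ?thesis by simp
qed

text \<open>Positivity of the density. It feeds the proof that the normalising constant of the
  conditioned measure is positive.\<close>

lemma complex_gauss_small_ball:
  assumes "\<theta> > 0" "\<epsilon> > 0" shows "emeasure (complex_gauss \<theta>) {z. (cmod z)\<^sup>2 < \<epsilon>} > 0"
proof (rule ccontr)
  assume "\<not> ?thesis"
  then have "emeasure (complex_gauss \<theta>) {z. (cmod z)\<^sup>2 < \<epsilon>} = 0" by simp
  then have "{z. (cmod z)\<^sup>2 < \<epsilon>} \<in> null_sets (complex_gauss \<theta>)" by (auto intro!: null_setsI)
  then have "AE z in lborel. z \<in> {z. (cmod z)\<^sup>2 < \<epsilon>} \<longrightarrow> ennreal (\<theta> / (2 * pi) * exp (- \<theta> * (cmod z)\<^sup>2 / 2)) = 0"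
    unfolding complex_gauss_def by (subst (asm) null_sets_density_iff) auto
  then have "AE z in lborel. z \<notin> ball (0::complex) (sqrt \<epsilon>)"
  proof eventually_elim
    case (elim z)
  show ?case
    proof
      assume "z \<in> ball 0 (sqrt \<epsilon>)"
      then have "cmod z < sqrt \<epsilon>" by simp
      then have "(cmod z)\<^sup>2 < (sqrt \<epsilon>)\<^sup>2" by (rule power_strict_mono) auto
      then have "(cmod z)\<^sup>2 < \<epsilon>" using assms by simp
      with elim have "ennreal (\<theta> / (2 * pi) * exp (- \<theta> * (cmod z)\<^sup>2 / 2)) = 0" by simp
      then have "\<theta> / (2 * pi) * exp (- \<theta> * (cmod z)\<^sup>2 / 2) \<le> 0" by (simp add: ennreal_eq_0_iff)
      moreover have "\<theta> / (2 * pi) * exp (- \<theta> * (cmod z)\<^sup>2 / 2) > 0" using assms by simp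
      ultimately show False by linarith
    qed
  qed
  then have "emeasure lborel (ball (0::complex) (sqrt \<epsilon>)) = 0" by (intro AE_iff_measurable[THEN iffD1]) auto
  then show False using assms by (simp add: emeasure_ball unit_ball_vol_2)
qed

text \<open>Modulus and phase are independent. An independent copy \<open>v\<close> is adjoined and
  rotation invariance replaces \<open>z\<close> by \<open>sgn v * z\<close>; after an exchange of
  the integrals, rotation invariance in \<open>v\<close> absorbs the phase of \<open>z\<close>, so
  that only \<open>cmod z\<close> and \<open>sgn v\<close> remain.\<close>

lemma complex_gauss_polar:
  assumes \<theta>: "\<theta> > 0" and [measurable]: "h \<in> borel_measurable borel"
  shows "(\<integral>\<^sup>+z. h z \<partial>complex_gauss \<theta>) = (\<integral>\<^sup>+z. \<integral>\<^sup>+t. h (complex_of_real (sqrt t) * sgn z) \<partial>exp_law (\<theta> / 2) \<partial>complex_gauss \<theta>)"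
proof -
  let ?G = "complex_gauss \<theta>"
  interpret G: prob_space ?G by (rule prob_space_complex_gauss[OF \<theta>])
  interpret GG: pair_prob_space ?G ?G ..
  have ne: "AE z in ?G. z \<noteq> 0"
    using emeasure_complex_gauss_eq_0I[OF \<theta>, of 0] by (intro AE_I[of _ _ "{0}"]) auto
  have "(\<integral>\<^sup>+z. h z \<partial>?G) = (\<integral>\<^sup>+v. \<integral>\<^sup>+z. h z \<partial>?G \<partial>?G)"
    using G.emeasure_space_1 by simp
  also have "\<dots> = (\<integral>\<^sup>+v. \<integral>\<^sup>+z. h (sgn v * z) \<partial>?G \<partial>?G)"
    using ne by (intro nn_integral_cong_AE, eventually_elim)
      (simp add: complex_gauss_rotate norm_sgn)
  also have "\<dots> = (\<integral>\<^sup>+z. \<integral>\<^sup>+v. h (sgn v * z) \<partial>?G \<partial>?G)"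
    by (rule GG.Fubini'[symmetric]) simp
  also have "\<dots> = (\<integral>\<^sup>+z. \<integral>\<^sup>+v. h (complex_of_real (cmod z) * sgn v) \<partial>?G \<partial>?G)"
    using ne
  proof (intro nn_integral_cong_AE, eventually_elim)
    case (elim z)
    have "(\<integral>\<^sup>+v. h (sgn v * z) \<partial>?G) = (\<integral>\<^sup>+v. (\<lambda>v. h (complex_of_real (cmod z) * sgn v)) (sgn z * v) \<partial>?G)"
    proof (intro nn_integral_cong arg_cong[where f = h])
      fix v
      have "z = complex_of_real (cmod z) * sgn z" using elim by (simp add: sgn_eq)
      moreover have "sgn (sgn z * v) = sgn z * sgn v" by (simp add: sgn_mult)
      ultimately show "sgn v * z = complex_of_real (cmod z) * sgn (sgn z * v)" by (metis mult.commute mult.left_commute)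
    qed
    also have "\<dots> = (\<integral>\<^sup>+v. h (complex_of_real (cmod z) * sgn v) \<partial>?G)"
      using elim by (intro complex_gauss_rotate) (auto simp: norm_sgn)
    finally show ?case .
  qed
  also have "\<dots> = (\<integral>\<^sup>+v. \<integral>\<^sup>+z. h (complex_of_real (cmod z) * sgn v) \<partial>?G \<partial>?G)"
    by (rule GG.Fubini') simp
  also have "\<dots> = (\<integral>\<^sup>+v. \<integral>\<^sup>+z. (\<lambda>t. h (complex_of_real (sqrt t) * sgn v)) ((cmod z)\<^sup>2) \<partial>?G \<partial>?G)"
    by simp
  also have "\<dots> = (\<integral>\<^sup>+v. \<integral>\<^sup>+t. h (complex_of_real (sqrt t) * sgn v) \<partial>exp_law (\<theta> / 2) \<partial>?G)"
    by (intro nn_integral_cong nn_integral_complex_gauss_radial[OF \<theta>]) simp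
  finally show ?thesis .
qed

section \<open>The Fejer kernel\<close>

lemma set_lborel_integral_cis:
  assumes "a \<le> b" "\<omega> \<noteq> 0" "cis (\<omega> * a) = cis (\<omega> * b)"
  shows "(LINT x:{a..b}|lborel. cis (\<omega> * x)) = 0"
proof -
  have "(\<integral>x. indicator {a..b} x *\<^sub>R cis (\<omega> * x) \<partial>lborel) = cis (\<omega> * b) / (\<i> * of_real \<omega>) - cis (\<omega> * a) / (\<i> * of_real \<omega>)"
  proof (rule integral_FTC_atLeastAtMost[OF assms(1)])
    fix x
    have "((\<lambda>z. exp (\<i> * of_real \<omega> * z) / (\<i> * of_real \<omega>)) has_field_derivative exp (\<i> * of_real \<omega> * of_real x)) (at (of_real x))"
      using assms by (auto intro!: derivative_eq_intros)
    then have "((\<lambda>x. exp (\<i> * of_real \<omega> * of_real x) / (\<i> * of_real \<omega>)) has_vector_derivative exp (\<i> * of_real \<omega> * of_real x)) (at x within {a..b})"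
      by (rule has_vector_derivative_real_field)
    then show "((\<lambda>x. cis (\<omega> * x) / (\<i> * of_real \<omega>)) has_vector_derivative cis (\<omega> * x)) (at x within {a..b})"
      by (simp add: cis_conv_exp mult.assoc)
  qed (auto intro!: continuous_intros)
  then show ?thesis using assms by (simp add: set_lebesgue_integral_def)
qed

lemma cos_eq_1_small: "\<bar>t\<bar> \<le> pi \<Longrightarrow> cos t = 1 \<longleftrightarrow> t = 0"
proof (safe)
  assume "\<bar>t\<bar> \<le> pi" "cos t = 1"
  then have "cos \<bar>t\<bar> = cos 0" by simp
  with \<open>\<bar>t\<bar> \<le> pi\<close> show "t = 0" using cos_inj_pi[of "\<bar>t\<bar>" 0] by auto
qed auto

text \<open>The kernel is \<open>1 / l\<close> times the squared modulus of a geometric sum of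
  powers of \<open>cis t\<close>. As a double sum of exponentials it can be integrated against a
  function of which only the Fourier coefficients are known.\<close>

lemma fejer_kernel_eq_sum:
  assumes "\<bar>t\<bar> \<le> pi" "l > 0"
  shows "complex_of_real (fejer_kernel l t) = (\<Sum>i<l. \<Sum>j<l. cis ((real i - real j) * t)) / of_nat l"
proof -
  have sq: "(\<Sum>i<l. \<Sum>j<l. cis ((real i - real j) * t)) = of_real ((cmod (\<Sum>i<l. cis t ^ i))\<^sup>2)"
  proof -
    have "(\<Sum>i<l. \<Sum>j<l. cis ((real i - real j) * t)) = (\<Sum>i<l. \<Sum>j<l. cis t ^ i * cnj (cis t ^ j))"
      by (intro sum.cong refl) (simp add: Complex.DeMoivre cis_cnj cis_mult left_diff_distrib del: complex_cnj_power)
    also have "\<dots> = (\<Sum>i<l. cis t ^ i) * cnj (\<Sum>i<l. cis t ^ i)"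
      by (simp add: sum_product)
    also have "\<dots> = of_real ((cmod (\<Sum>i<l. cis t ^ i))\<^sup>2)"
      by (rule complex_norm_square[symmetric])
    finally show ?thesis .
  qed
  show ?thesis
  proof (cases "t = 0")
    case True
    then show ?thesis using assms sq by (simp add: fejer_kernel_def power2_eq_square)
  next
    case False
    then have c: "cos t \<noteq> 1" using cos_eq_1_small assms by blast
    then have "cis t \<noteq> 1" by (auto simp: complex_eq_iff)
    have n: "(cmod (1 - cis s))\<^sup>2 = 2 * (1 - cos s)" for s
    proof -
      have "(cmod (1 - cis s))\<^sup>2 = (1 - cos s)\<^sup>2 + (sin s)\<^sup>2" by (simp add: cmod_power2)
      also have "\<dots> = 2 * (1 - cos s)" using sin_cos_squared_add[of s] by (simp add: power2_eq_square algebra_simps)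
      finally show ?thesis .
    qed
    have gp: "(\<Sum>i<l. cis t ^ i) = (1 - cis (real l * t)) / (1 - cis t)"
      using \<open>cis t \<noteq> 1\<close> by (simp add: sum_gp_strict Complex.DeMoivre[symmetric])
    have "(cmod (\<Sum>i<l. cis t ^ i))\<^sup>2 = (1 - cos (real l * t)) / (1 - cos t)"
      unfolding gp norm_divide power_divide n by (rule mult_divide_mult_cancel_left) simp
    then show ?thesis unfolding sq using False assms by (simp add: fejer_kernel_def)
  qed
qed

lemma fejer_kernel_nonneg: "fejer_kernel l t \<ge> 0"
  by (auto simp: fejer_kernel_def)

lemma fejer_kernel_le: "fejer_kernel l t \<le> real l"
proof (cases "\<bar>t\<bar> \<le> pi \<and> l > 0")
  case True
  have "cmod (\<Sum>i<l. \<Sum>j<l. cis ((real i - real j) * t)) \<le> (\<Sum>i<l. \<Sum>j<l. 1)"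
    by (intro order.trans[OF norm_sum] sum_mono) (simp add: norm_sum[THEN order.trans])
  then have "cmod (complex_of_real (fejer_kernel l t)) \<le> real l"
    using True by (subst fejer_kernel_eq_sum) (auto simp: norm_divide field_simps)
  then show ?thesis by simp
qed (auto simp: fejer_kernel_def)

lemma borel_measurable_fejer_kernel [measurable]: "fejer_kernel l \<in> borel_measurable borel"
  unfolding fejer_kernel_def by measurable

lemma fejer_kernel_outside: "t \<notin> {-pi..pi} \<Longrightarrow> fejer_kernel l t = 0"
  by (auto simp: fejer_kernel_def)

lemma integrable_fejer_scaleR:
  fixes g :: "real \<Rightarrow> 'b::{banach, second_countable_topology}"
  assumes [measurable]: "g \<in> borel_measurable borel" and B: "\<And>t. norm (g t) \<le> B"
  shows "integrable lborel (\<lambda>t. fejer_kernel l t *\<^sub>R g t)"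
proof (rule Bochner_Integration.integrable_bound)
  show "integrable lborel (\<lambda>t. (real l * B) * indicator {-pi..pi} t)" by auto
  show "AE t in lborel. norm (fejer_kernel l t *\<^sub>R g t) \<le> norm (real l * B * indicator {-pi..pi} t)"
  proof (rule AE_I2)
    fix t
    have "B \<ge> 0" using B[of 0] norm_ge_zero order.trans by blast
    then show "norm (fejer_kernel l t *\<^sub>R g t) \<le> norm (real l * B * indicator {-pi..pi} t)"
      using fejer_kernel_outside[of t l] mult_mono[OF fejer_kernel_le[of l t] B[of t]] fejer_kernel_nonneg[of l t]
      by (cases "t \<in> {-pi..pi}") (auto simp: abs_mult)
  qed
qed simp

lemma integrable_fejer: "integrable lborel (fejer_kernel l)"
  using integrable_fejer_scaleR[of "\<lambda>_. 1::real" 1 l] by simp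

text \<open>Only the \<open>l\<close> diagonal terms survive. The total mass is
  \<open>2 * pi\<close> and not 1; the factor cancels later in the ratio that defines the tilted
  measures.\<close>

lemma integral_fejer:
  assumes "l > 0" shows "(\<integral>t. fejer_kernel l t \<partial>lborel) = 2 * pi"
proof -
  have I: "(LINT t:{-pi..pi}|lborel. cis ((real i - real j) * t)) = (if i = j then 2 * pi else 0)" for i j
  proof (cases "i = j")
    case True
    then show ?thesis by (simp add: set_lebesgue_integral_def scaleR_conv_of_real)
  next
    case False
    have "cis ((real i - real j) * - pi) = cis ((real i - real j) * pi)"
    proof -
      have "cis ((real i - real j) * pi) = cis ((real i - real j) * - pi + 2 * pi * of_int (int i - int j))"
        by (rule arg_cong[of _ _ cis]) (simp add: algebra_simps)
      also have "\<dots> = cis ((real i - real j) * - pi)"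
        unfolding cis_mult[symmetric] by (simp add: complex_eq_iff cos_int_2pin sin_int_2pin)
      finally show ?thesis by simp
    qed
    with False show ?thesis by (simp, intro set_lborel_integral_cis) auto
  qed
  have int: "set_integrable lborel {-pi..pi} (\<lambda>t. cis ((real i - real j) * t))" for i j
    by (intro borel_integrable_atLeastAtMost' continuous_intros)
  have "complex_of_real (\<integral>t. fejer_kernel l t \<partial>lborel) = (\<integral>t. complex_of_real (fejer_kernel l t) \<partial>lborel)"
    by simp
  also have "\<dots> = (LINT t:{-pi..pi}|lborel. (\<Sum>i<l. \<Sum>j<l. cis ((real i - real j) * t)) / of_nat l)"
    unfolding set_lebesgue_integral_def
  proof (rule Bochner_Integration.integral_cong)
    fix t show "complex_of_real (fejer_kernel l t) = indicator {-pi..pi} t *\<^sub>R ((\<Sum>i<l. \<Sum>j<l. cis ((real i - real j) * t)) / of_nat l)"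
      using assms fejer_kernel_eq_sum[of t l] fejer_kernel_outside[of t l]
      by (cases "t \<in> {-pi..pi}") auto
  qed simp
  also have "\<dots> = (\<Sum>i<l. \<Sum>j<l. (LINT t:{-pi..pi}|lborel. cis ((real i - real j) * t))) / of_nat l"
  proof -
    have "(LINT t:{-pi..pi}|lborel. (\<Sum>i<l. \<Sum>j<l. cis ((real i - real j) * t)) / of_nat l)
       = (\<integral>t. (\<Sum>i<l. \<Sum>j<l. indicator {-pi..pi} t *\<^sub>R cis ((real i - real j) * t)) / of_nat l \<partial>lborel)"
      unfolding set_lebesgue_integral_def
      by (intro Bochner_Integration.integral_cong refl) (auto simp: indicator_def)
    also have "\<dots> = (\<Sum>i<l. \<Sum>j<l. (\<integral>t. indicator {-pi..pi} t *\<^sub>R cis ((real i - real j) * t) \<partial>lborel)) / of_nat l"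
      unfolding Bochner_Integration.integral_divide_zero
      by (subst Bochner_Integration.integral_sum; (intro Bochner_Integration.integrable_sum int[unfolded set_integrable_def])?)
         (intro arg_cong2[where f = "(/)"] sum.cong refl Bochner_Integration.integral_sum int[unfolded set_integrable_def])
    finally show ?thesis unfolding set_lebesgue_integral_def .
  qed
  also have "\<dots> = complex_of_real (2 * pi)"
    using assms by (simp add: I if_distrib[of complex_of_real] cong: if_cong)
  finally show ?thesis unfolding of_real_eq_iff .
qed

text \<open>Near 0 continuity controls \<open>g\<close>, away from 0 the kernel is of order
  \<open>1 / l\<close>. The values lie in a Banach space because the lemma serves complex functions
  in the Fourier uniqueness theorem and real ones in the conditioning.\<close>

lemma fejer_approx_identity_0:
  fixes g :: "real \<Rightarrow> 'b::{banach, second_countable_topology}"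
  assumes [measurable]: "g \<in> borel_measurable borel" and B: "\<And>t. norm (g t) \<le> B" and cont: "isCont g 0"
  shows "(\<lambda>l. \<integral>t. fejer_kernel l t *\<^sub>R g t \<partial>lborel) \<longlonglongrightarrow> (2 * pi) *\<^sub>R g 0"
proof (rule LIMSEQ_I)
  fix e :: real assume "e > 0"
  have "B \<ge> 0" using B[of 0] norm_ge_zero order.trans by blast
  \<comment> \<open>The kernel mass \<open>2 * pi\<close> times this is \<open>e / 2\<close>, which
    leaves as much for the far part.\<close>
  define \<epsilon> where "\<epsilon> = e / (4 * pi)"
  have "\<epsilon> > 0" using \<open>e > 0\<close> by (simp add: \<epsilon>_def)
  obtain d where d: "d > 0" "\<And>t. \<bar>t\<bar> < d \<Longrightarrow> norm (g t - g 0) < \<epsilon>"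
    using cont[unfolded continuous_at_eps_delta, rule_format, OF \<open>\<epsilon> > 0\<close>] by (auto simp: dist_norm)
  define \<delta> where "\<delta> = min d pi"
  have \<delta>: "\<delta> > 0" "\<delta> \<le> pi" "\<And>t. \<bar>t\<bar> < \<delta> \<Longrightarrow> norm (g t - g 0) < \<epsilon>"
    using d by (auto simp: \<delta>_def)
  have cd: "1 - cos \<delta> > 0" using cos_eq_1_small[of \<delta>] \<delta> cos_le_one[of \<delta>] by linarith
  \<comment> \<open>Bounds the integrand on \<open>\<delta> \<le> \<bar>t\<bar> \<le> pi\<close>:
    the oscillation of \<open>g\<close> is at most \<open>2 * B\<close>, and the other factor is the
    kernel bound \<open>far\<close>.\<close>
  define c where "c l = 2 * B * (1 / real l * (2 / (1 - cos \<delta>)))" for l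
  have "(\<lambda>l. c l * (2 * pi)) \<longlonglongrightarrow> 0"
    unfolding c_def by real_asymp
  then obtain N where N: "\<And>l. l \<ge> N \<Longrightarrow> \<bar>c l * (2 * pi)\<bar> < e / 2"
    using LIMSEQ_D[of _ 0 "e / 2"] \<open>e > 0\<close> by (metis diff_zero half_gt_zero real_norm_def)
  have far: "fejer_kernel l t \<le> 1 / real l * (2 / (1 - cos \<delta>))" if "\<delta> \<le> \<bar>t\<bar>" "\<bar>t\<bar> \<le> pi" for l t
  proof -
    have "cos \<bar>t\<bar> \<le> cos \<delta>" using that \<delta> by (subst cos_mono_le_eq) auto
    then have "(1 - cos (real l * t)) / (1 - cos t) \<le> 2 / (1 - cos \<delta>)"
      using cd cos_ge_minus_one[of "real l * t"] by (intro frac_le) auto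
    then have "1 / real l * ((1 - cos (real l * t)) / (1 - cos t)) \<le> 1 / real l * (2 / (1 - cos \<delta>))"
      by (intro mult_left_mono) auto
    then show ?thesis using that \<delta> by (auto simp: fejer_kernel_def)
  qed
  show "\<exists>no. \<forall>l\<ge>no. norm ((\<integral>t. fejer_kernel l t *\<^sub>R g t \<partial>lborel) - (2 * pi) *\<^sub>R g 0) < e"
  proof (intro exI[of _ "max N 1"] allI impI)
    fix l assume l: "l \<ge> max N 1"
    have i1: "integrable lborel (\<lambda>t. fejer_kernel l t *\<^sub>R g t)"
      by (rule integrable_fejer_scaleR[OF _ B]) simp
    have i2: "integrable lborel (\<lambda>t. fejer_kernel l t *\<^sub>R g 0)"
      using integrable_fejer by simp
    have "(\<integral>t. fejer_kernel l t *\<^sub>R g t \<partial>lborel) - (2 * pi) *\<^sub>R g 0 = (\<integral>t. fejer_kernel l t *\<^sub>R g t - fejer_kernel l t *\<^sub>R g 0 \<partial>lborel)"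
      using l by (subst Bochner_Integration.integral_diff[OF i1 i2]) (simp add: integral_fejer integrable_fejer)
    also have "norm \<dots> \<le> (\<integral>t. \<epsilon> * fejer_kernel l t + c l * indicator {-pi..pi} t \<partial>lborel)"
    proof (rule Bochner_Integration.integral_norm_bound_integral)
      fix t
      have n: "norm (fejer_kernel l t *\<^sub>R g t - fejer_kernel l t *\<^sub>R g 0) = fejer_kernel l t * norm (g t - g 0)"
        using fejer_kernel_nonneg[of l t] by (simp add: scaleR_diff_right[symmetric])
      have "c l \<ge> 0" using \<open>B \<ge> 0\<close> cd by (auto simp: c_def)
      consider "t \<notin> {-pi..pi}" | "\<bar>t\<bar> < \<delta>" | "\<delta> \<le> \<bar>t\<bar>" "\<bar>t\<bar> \<le> pi" by force
      then show "norm (fejer_kernel l t *\<^sub>R g t - fejer_kernel l t *\<^sub>R g 0) \<le> \<epsilon> * fejer_kernel l t + c l * indicator {-pi..pi} t"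
      proof cases
        case 1 then show ?thesis by (simp add: fejer_kernel_outside)
      next
        case 2
        have "fejer_kernel l t * norm (g t - g 0) \<le> fejer_kernel l t * \<epsilon>"
          using \<delta>(3)[OF 2] fejer_kernel_nonneg by (intro mult_left_mono) auto
        moreover have "0 \<le> c l * indicator {-pi..pi} t" using \<open>c l \<ge> 0\<close> by simp
        ultimately show ?thesis unfolding n by (simp add: mult.commute)
      next
        case 3
        have "norm (g t - g 0) \<le> 2 * B" using norm_triangle_ineq4[of "g t" "g 0"] B[of t] B[of 0] by linarith
        then have "fejer_kernel l t * norm (g t - g 0) \<le> (1 / real l * (2 / (1 - cos \<delta>))) * (2 * B)"
          using far[OF 3, of l] cd by (intro mult_mono) auto
        also have "t \<in> {-pi..pi}" using 3 by auto
        then have "(1 / real l * (2 / (1 - cos \<delta>))) * (2 * B) = c l * indicator {-pi..pi} t" by (simp add: c_def)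
        finally show ?thesis unfolding n using \<open>\<epsilon> > 0\<close> fejer_kernel_nonneg[of l t] by (smt (verit) mult_nonneg_nonneg)
      qed
    qed (use i1 i2 integrable_fejer in auto)
    also have "\<dots> = \<epsilon> * (2 * pi) + c l * (2 * pi)"
      using l by (subst Bochner_Integration.integral_add) (auto simp: integrable_fejer integral_fejer)
    also have "\<epsilon> * (2 * pi) = e / 2" by (simp add: \<epsilon>_def)
    also have "e / 2 + c l * (2 * pi) < e" using N[of l] l by auto
    finally show "norm ((\<integral>t. fejer_kernel l t *\<^sub>R g t \<partial>lborel) - (2 * pi) *\<^sub>R g 0) < e" .
  qed
qed

text \<open>A translation moves the point of concentration from 0 to \<open>a\<close>. The second
  bound is uniform in \<open>l\<close> and later dominates the integrals over the remaining
  modes.\<close>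

lemma fejer_approx_identity:
  fixes g :: "real \<Rightarrow> 'b::{banach, second_countable_topology}"
  assumes [measurable]: "g \<in> borel_measurable borel" and B: "\<And>t. norm (g t) \<le> B" and cont: "isCont g a"
  shows "(\<lambda>l. \<integral>t. fejer_kernel l (a - t) *\<^sub>R g t \<partial>lborel) \<longlonglongrightarrow> (2 * pi) *\<^sub>R g a"
    and "norm (\<integral>t. fejer_kernel l (a - t) *\<^sub>R g t \<partial>lborel) \<le> 2 * pi * B"
proof -
  have eq: "(\<integral>t. fejer_kernel l (a - t) *\<^sub>R g t \<partial>lborel) = (\<integral>t. fejer_kernel l t *\<^sub>R g (a - t) \<partial>lborel)" for l
    by (subst lborel_integral_real_affine[of "-1" _ a]) auto
  have "isCont (\<lambda>t. g (a - t)) 0"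
    using cont by (intro continuous_at_compose[of 0 "\<lambda>t. a - t" g, unfolded comp_def]) auto
  then have "(\<lambda>l. \<integral>t. fejer_kernel l t *\<^sub>R g (a - t) \<partial>lborel) \<longlonglongrightarrow> (2 * pi) *\<^sub>R g (a - 0)"
    by (intro fejer_approx_identity_0[where B = B] B) simp
  then show "(\<lambda>l. \<integral>t. fejer_kernel l (a - t) *\<^sub>R g t \<partial>lborel) \<longlonglongrightarrow> (2 * pi) *\<^sub>R g a"
    unfolding eq by simp
  have "B \<ge> 0" using B[of 0] norm_ge_zero order.trans by blast
  have "norm (\<integral>t. fejer_kernel l t *\<^sub>R g (a - t) \<partial>lborel) \<le> (\<integral>t. fejer_kernel l t * B \<partial>lborel)"
    by (rule Bochner_Integration.integral_norm_bound_integral)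
       (auto intro!: integrable_fejer_scaleR[where B = B] B integrable_mult_left integrable_fejer mult_left_mono fejer_kernel_nonneg
          simp: abs_of_nonneg[OF fejer_kernel_nonneg])
  \<comment> \<open>An inequality because of \<open>l = 0\<close>, where the kernel is identically
    zero.\<close>
  also have "\<dots> \<le> 2 * pi * B"
    using \<open>B \<ge> 0\<close> by (cases "l = 0") (auto simp: integral_fejer fejer_kernel_def[of 0] Let_def cong: if_cong)
  finally show "norm (\<integral>t. fejer_kernel l (a - t) *\<^sub>R g t \<partial>lborel) \<le> 2 * pi * B" unfolding eq .
qed

lemma set_lborel_integral_eq_integral_continuous:
  fixes f :: "real \<Rightarrow> 'a::euclidean_space"
  assumes "continuous_on {a..b} f"
  shows "(LINT x:{a..b}|lborel. f x) = integral {a..b} f"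
  using set_borel_integral_eq_integral(2)[OF borel_integrable_atLeastAtMost'[OF assms]] .

text \<open>The part of the window beyond \<open>L\<close> is shifted back by one period; for
  \<open>c\<close> between 0 and \<open>L\<close> a single shift is enough.\<close>

lemma integral_periodic_window:
  fixes f :: "real \<Rightarrow> 'a::euclidean_space"
  assumes cont: "continuous_on UNIV f" and per: "\<And>x. f (x + L) = f x" and c: "0 \<le> c" "c \<le> L"
  shows "integral {c..c + L} f = integral {0..L} f"
proof -
  have int: "f integrable_on {a..b}" for a b
    by (intro integrable_continuous_real continuous_on_subset[OF cont]) auto
  have "integral {L..c + L} f = integral {0 + L..c + L} f" by simp
  also have "\<dots> = integral {0..c} f"
  proof -
    have "f \<circ> (+) L = f" using per by (auto simp: fun_eq_iff add.commute)
    then show ?thesis using integral_shift_Icc_real[of 0 c f L] by simp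
  qed
  finally have s: "integral {L..c + L} f = integral {0..c} f" .
  have "integral {c..c + L} f = integral {c..L} f + integral {L..c + L} f"
    using c int by (intro Henstock_Kurzweil_Integration.integral_combine[symmetric]) auto
  also have "\<dots> = integral {0..c} f + integral {c..L} f" by (simp add: s)
  also have "\<dots> = integral {0..L} f"
    using c int by (intro Henstock_Kurzweil_Integration.integral_combine) auto
  finally show ?thesis .
qed

section \<open>Fourier analysis on the circle\<close>

lemma norm_fourier_mode: "L > 0 \<Longrightarrow> cmod (fourier_mode L j x) = 1 / sqrt L"
proof -
  assume "L > 0"
  then have "L powr (- (1 / 2)) = 1 / sqrt L"
    unfolding powr_minus_divide by (simp add: powr_half_sqrt)
  then show "cmod (fourier_mode L j x) = 1 / sqrt L" using \<open>L > 0\<close> by (simp add: fourier_mode_def norm_mult norm_divide)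
qed

lemma fourier_mode_periodic: "L > 0 \<Longrightarrow> fourier_mode L j (x + L) = fourier_mode L j x"
proof -
  assume "L > 0"
  then have "cis (2 * pi * real_of_int j * (x + L) / L) = cis (2 * pi * real_of_int j * x / L) * cis (2 * pi * real_of_int j)"
    unfolding cis_mult by (simp add: field_simps)
  also have "cis (2 * pi * real_of_int j) = 1" by (simp add: complex_eq_iff cos_int_2pin sin_int_2pin)
  finally show ?thesis by (simp add: fourier_mode_def)
qed

lemma continuous_on_fourier_mode [continuous_intros]:
  "continuous_on S f \<Longrightarrow> continuous_on S (\<lambda>x. fourier_mode L j (f x))"
  unfolding fourier_mode_def divide_inverse by (intro continuous_intros)

definition mode_term :: "real \<Rightarrow> int \<Rightarrow> complex \<Rightarrow> (real \<Rightarrow>\<^sub>C complex)" where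
  "mode_term L j c = Bcontfun (\<lambda>x. c * fourier_mode L j x)"

lemma norm_fourier_mode_eq: "cmod (fourier_mode L j x) = L powr (- 1 / 2)"
  by (simp add: fourier_mode_def norm_mult)

lemma apply_mode_term [simp]: "apply_bcontfun (mode_term L j c) x = c * fourier_mode L j x"
proof -
  have "(\<lambda>x. c * fourier_mode L j x) \<in> bcontfun"
    by (rule bcontfun_normI[where b = "cmod c * L powr (- 1 / 2)"])
       (auto intro!: continuous_intros simp: norm_mult norm_fourier_mode_eq)
  then show ?thesis by (simp add: mode_term_def Bcontfun_inverse)
qed

lemma mode_term_0 [simp]: "mode_term L j 0 = 0"
  and mode_term_diff: "mode_term L j (a - b) = mode_term L j a - mode_term L j b"
  by (auto intro!: bcontfun_eqI simp: algebra_simps)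

lemma norm_mode_term_le: "L > 0 \<Longrightarrow> norm (mode_term L j c) \<le> cmod c / sqrt L"
  by (rule norm_bound) (simp add: norm_mult norm_fourier_mode)

lemma continuous_on_mode_term [continuous_intros]:
  assumes "continuous_on S f" "L > 0" shows "continuous_on S (\<lambda>x. mode_term L j (f x))"
proof -
  have "continuous_on UNIV (mode_term L j)"
  proof (rule continuous_on_iff[THEN iffD2], intro ballI allI impI)
    fix a :: complex and e :: real assume "e > 0"
    show "\<exists>d>0. \<forall>b\<in>UNIV. dist b a < d \<longrightarrow> dist (mode_term L j b) (mode_term L j a) < e"
    proof (intro exI[of _ "e * sqrt L"] conjI ballI impI)
      fix b assume "dist b a < e * sqrt L"
      then have "cmod (b - a) / sqrt L < e" using \<open>L > 0\<close> by (simp add: dist_norm field_simps)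
      then show "dist (mode_term L j b) (mode_term L j a) < e"
        using norm_mode_term_le[OF \<open>L > 0\<close>, of j "b - a"] by (simp add: dist_norm mode_term_diff)
    qed (use \<open>e > 0\<close> \<open>L > 0\<close> in auto)
  qed
  from continuous_on_compose2[OF this assms(1)] show ?thesis by simp
qed

lemma Omega_0 [simp]: "0 \<in> Omega L"
  and Omega_add: "\<phi> \<in> Omega L \<Longrightarrow> \<psi> \<in> Omega L \<Longrightarrow> \<phi> + \<psi> \<in> Omega L"
  and Omega_diff: "\<phi> \<in> Omega L \<Longrightarrow> \<psi> \<in> Omega L \<Longrightarrow> \<phi> - \<psi> \<in> Omega L"
  by (auto simp: Omega_def)

lemma mode_term_Omega [simp]: "L > 0 \<Longrightarrow> mode_term L j c \<in> Omega L"
  by (auto simp: Omega_def fourier_mode_periodic)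

lemma Omega_sum: "(\<And>i. i \<in> I \<Longrightarrow> f i \<in> Omega L) \<Longrightarrow> (\<Sum>i\<in>I. f i) \<in> Omega L"
  by (induction I rule: infinite_finite_induct) (auto intro: Omega_add)

lemma Omega_shift_of_int:
  assumes "\<phi> \<in> Omega L"
  shows "apply_bcontfun \<phi> (x + real_of_int n * L) = apply_bcontfun \<phi> x"
proof -
  have shift: "apply_bcontfun \<phi> (x + real i * L) = apply_bcontfun \<phi> x" for x i
  proof (induction i)
    case (Suc i)
    have e: "x + real (Suc i) * L = (x + real i * L) + L" by (simp add: algebra_simps)
    show ?case unfolding e using assms Suc.IH by (simp add: Omega_def)
  qed simp
  show ?thesis
  proof (cases "n \<ge> 0")
    case True
    then show ?thesis using shift[of x "nat n"] by simp
  next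
    case False
    then show ?thesis using shift[of "x + real_of_int n * L" "nat (- n)"] by simp
  qed
qed

lemma tendsto_apply_bcontfun:
  assumes "(f \<longlongrightarrow> l) F" shows "((\<lambda>n. apply_bcontfun (f n) x) \<longlongrightarrow> apply_bcontfun l x) F"
  using tendsto_uniform_limitI[OF tendsto_bcontfun_uniform_limit[OF assms]] by simp

lemma closed_Omega: "closed (Omega L)"
  unfolding closed_sequential_limits
proof (intro allI impI, elim conjE)
  fix f l assume f: "\<forall>n. f n \<in> Omega L" "f \<longlonglongrightarrow> l"
  have "apply_bcontfun l (x + L) = apply_bcontfun l x" for x
  proof (rule LIMSEQ_unique)
    show "(\<lambda>n. apply_bcontfun (f n) x) \<longlonglongrightarrow> apply_bcontfun l x" by (rule tendsto_apply_bcontfun[OF f(2)])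
    have "(\<lambda>n. apply_bcontfun (f n) (x + L)) \<longlonglongrightarrow> apply_bcontfun l (x + L)" by (rule tendsto_apply_bcontfun[OF f(2)])
    then show "(\<lambda>n. apply_bcontfun (f n) x) \<longlonglongrightarrow> apply_bcontfun l (x + L)" using f(1) by (simp add: Omega_def)
  qed
  then show "l \<in> Omega L" by (simp add: Omega_def)
qed

lemma fourier_coeff_eq_integral:
  "fourier_coeff L j \<phi> = integral {0..L} (\<lambda>x. cnj (fourier_mode L j x) * apply_bcontfun \<phi> x)"
  unfolding fourier_coeff_def
  by (rule set_lborel_integral_eq_integral_continuous) (intro continuous_intros continuous_on_apply_bcontfun)

lemma integrable_fourier: "(\<lambda>x. cnj (fourier_mode L j x) * apply_bcontfun \<phi> x) integrable_on {0..L}"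
  by (intro integrable_continuous_real continuous_intros continuous_on_apply_bcontfun)

lemma fourier_coeff_add: "fourier_coeff L j (\<phi> + \<psi>) = fourier_coeff L j \<phi> + fourier_coeff L j \<psi>"
  and fourier_coeff_diff: "fourier_coeff L j (\<phi> - \<psi>) = fourier_coeff L j \<phi> - fourier_coeff L j \<psi>"
  and fourier_coeff_0 [simp]: "fourier_coeff L j 0 = 0"
  unfolding fourier_coeff_eq_integral
  using integrable_fourier[of L j \<phi>] integrable_fourier[of L j \<psi>]
  by (simp_all add: distrib_left right_diff_distrib Henstock_Kurzweil_Integration.integral_add Henstock_Kurzweil_Integration.integral_diff)

lemma fourier_coeff_sum: "fourier_coeff L j (\<Sum>i\<in>I. f i) = (\<Sum>i\<in>I. fourier_coeff L j (f i))"
  by (induction I rule: infinite_finite_induct) (auto simp: fourier_coeff_add)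

lemma norm_fourier_coeff_le:
  assumes "L > 0" shows "cmod (fourier_coeff L j \<phi>) \<le> sqrt L * norm \<phi>"
proof -
  have "cmod (fourier_coeff L j \<phi>) \<le> (norm \<phi> / sqrt L) * (L - 0)"
    unfolding fourier_coeff_eq_integral
  proof (rule integral_bound)
    fix x
    have "cmod (apply_bcontfun \<phi> x) / sqrt L \<le> norm \<phi> / sqrt L"
      using norm_bounded[of \<phi> x] assms by (intro divide_right_mono) auto
    then show "cmod (cnj (fourier_mode L j x) * apply_bcontfun \<phi> x) \<le> norm \<phi> / sqrt L"
      using assms by (simp add: norm_mult norm_fourier_mode)
  qed (use assms in \<open>auto intro!: continuous_intros\<close>)
  also have "\<dots> = sqrt L * norm \<phi>" using assms by (simp add: field_simps)
  finally show ?thesis .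
qed

lemma fourier_coeff_mode_term:
  assumes "L > 0" shows "fourier_coeff L j (mode_term L i c) = (if i = j then c else 0)"
proof -
  have eq: "cnj (fourier_mode L j x) * (c * fourier_mode L i x) = (c / of_real L) * cis ((2 * pi * real_of_int (i - j) / L) * x)" for x
  proof -
    have "cnj (fourier_mode L j x) * (c * fourier_mode L i x) =
      c * (of_real (L powr (- 1 / 2) * L powr (- 1 / 2))) * (cis (- (2 * pi * real_of_int j * x / L)) * cis (2 * pi * real_of_int i * x / L))"
      by (simp add: fourier_mode_def cis_cnj)
    also have "L powr (- 1 / 2) * L powr (- 1 / 2) = 1 / L"
      using assms by (simp add: powr_add[symmetric] powr_minus_divide)
    also have "cis (- (2 * pi * real_of_int j * x / L)) * cis (2 * pi * real_of_int i * x / L) = cis ((2 * pi * real_of_int (i - j) / L) * x)"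
      unfolding cis_mult by (rule arg_cong[of _ _ cis]) (use assms in \<open>simp add: field_simps\<close>)
    finally show ?thesis by simp
  qed
  have "(LINT x:{0..L}|lborel. cis ((2 * pi * real_of_int (i - j) / L) * x)) = (if i = j then L else 0)"
  proof (cases "i = j")
    case True
    then show ?thesis using assms by (simp add: set_lebesgue_integral_def scaleR_conv_of_real)
  next
    case False
    have "cis (2 * pi * real_of_int (i - j)) = 1" by (simp add: complex_eq_iff cos_int_2pin sin_int_2pin del: of_int_diff)
    with False have "real_of_int (i - j) \<noteq> 0" by simp
    then have "2 * pi * real_of_int (i - j) / L \<noteq> 0" using assms pi_gt_zero
      by (metis divide_eq_0_iff less_numeral_extra(3) mult_eq_0_iff pi_neq_zero zero_neq_numeral)
    with \<open>cis _ = 1\<close> assms have "(LINT x:{0..L}|lborel. cis ((2 * pi * real_of_int (i - j) / L) * x)) = 0"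
      by (intro set_lborel_integral_cis) auto
    then show ?thesis using False by simp
  qed
  then have I: "integral {0..L} (\<lambda>x. cis ((2 * pi * real_of_int (i - j) / L) * x)) = (if i = j then L else 0)"
    by (subst (asm) set_lborel_integral_eq_integral_continuous) (use assms in \<open>auto intro!: continuous_intros\<close>)
  have "fourier_coeff L j (mode_term L i c) = integral {0..L} (\<lambda>x. (c / of_real L) * cis ((2 * pi * real_of_int (i - j) / L) * x))"
    unfolding fourier_coeff_eq_integral apply_mode_term eq ..
  also have "\<dots> = (c / of_real L) * (if i = j then L else 0)"
    unfolding I[symmetric] by (rule integral_mult_right)
  also have "\<dots> = (if i = j then c else 0)" using assms by simp
  finally show ?thesis .
qed

lemma continuous_on_fourier_coeff: "L > 0 \<Longrightarrow> continuous_on S (fourier_coeff L j)"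
proof (rule continuous_on_iff[THEN iffD2], intro ballI allI impI)
  fix \<phi> and e :: real assume "L > 0" "e > 0"
  show "\<exists>d>0. \<forall>\<psi>\<in>S. dist \<psi> \<phi> < d \<longrightarrow> dist (fourier_coeff L j \<psi>) (fourier_coeff L j \<phi>) < e"
  proof (intro exI[of _ "e / sqrt L"] conjI ballI impI)
    fix \<psi> assume "dist \<psi> \<phi> < e / sqrt L"
    then have "sqrt L * norm (\<psi> - \<phi>) < e" using \<open>L > 0\<close> by (simp add: dist_norm field_simps)
    then show "dist (fourier_coeff L j \<psi>) (fourier_coeff L j \<phi>) < e"
      using norm_fourier_coeff_le[OF \<open>L > 0\<close>, of j "\<psi> - \<phi>"] by (simp add: dist_norm fourier_coeff_diff)
  qed (use \<open>e > 0\<close> \<open>L > 0\<close> in auto)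
qed

section \<open>L^q integrals, mass and Bessel's inequality\<close>

definition power_integral :: "real \<Rightarrow> real \<Rightarrow> (real \<Rightarrow>\<^sub>C complex) \<Rightarrow> real" where
  "power_integral L q \<phi> = (LINT x:{0..L}|lborel. cmod (apply_bcontfun \<phi> x) powr q)"

lemma power_integral_nonneg: "power_integral L q \<phi> \<ge> 0"
  unfolding power_integral_def set_lebesgue_integral_def by (intro Bochner_Integration.integral_nonneg) auto

lemma circle_norm_powr: "q > 0 \<Longrightarrow> circle_norm L q \<phi> powr q = power_integral L q \<phi>"
  using power_integral_nonneg[of L q \<phi>] by (simp add: circle_norm_def power_integral_def[symmetric] powr_powr)

lemma particle_number_eq_power_integral: "particle_number L \<phi> = power_integral L 2 \<phi>"
proof -
  have "particle_number L \<phi> = circle_norm L 2 \<phi> powr 2"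
    by (simp add: particle_number_def circle_norm_def)
  then show ?thesis by (simp add: circle_norm_powr)
qed

lemma power_integral_eq_integral: "q > 0 \<Longrightarrow> power_integral L q \<phi> = integral {0..L} (\<lambda>x. cmod (apply_bcontfun \<phi> x) powr q)"
  unfolding power_integral_def
  by (rule set_lborel_integral_eq_integral_continuous) (intro continuous_on_powr' continuous_on_norm continuous_on_const continuous_on_apply_bcontfun, auto)

lemma integrable_powr:
  fixes \<phi> :: "real \<Rightarrow>\<^sub>C complex"
  shows "q > 0 \<Longrightarrow> (\<lambda>x. cmod (apply_bcontfun \<phi> x) powr q) integrable_on {0..L}"
  by (intro integrable_continuous_real continuous_on_powr' continuous_on_norm continuous_on_const continuous_on_apply_bcontfun, auto)

lemma particle_number_eq_integral: "particle_number L \<phi> = integral {0..L} (\<lambda>x. (cmod (apply_bcontfun \<phi> x))\<^sup>2)"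
  by (simp add: particle_number_eq_power_integral power_integral_eq_integral)

lemma particle_number_nonneg: "particle_number L \<phi> \<ge> 0"
  by (simp add: particle_number_def)

lemma particle_number_0 [simp]: "particle_number L 0 = 0"
  by (simp add: particle_number_eq_integral)

lemma power_integral_le:
  assumes "q \<ge> 2" shows "power_integral L q \<phi> \<le> norm \<phi> powr (q - 2) * particle_number L \<phi>"
proof -
  have "power_integral L q \<phi> \<le> integral {0..L} (\<lambda>x. norm \<phi> powr (q - 2) * (cmod (apply_bcontfun \<phi> x))\<^sup>2)"
    unfolding power_integral_eq_integral[OF less_le_trans[OF zero_less_numeral assms]]
  proof (rule integral_le)
    show "(\<lambda>x. norm \<phi> powr (q - 2) * (cmod (apply_bcontfun \<phi> x))\<^sup>2) integrable_on {0..L}"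
      by (intro integrable_continuous_real continuous_intros continuous_on_apply_bcontfun)
    fix x
    have "cmod (apply_bcontfun \<phi> x) powr q = cmod (apply_bcontfun \<phi> x) powr (q - 2) * cmod (apply_bcontfun \<phi> x) powr 2"
      unfolding powr_add[symmetric] by simp
    also have "\<dots> = cmod (apply_bcontfun \<phi> x) powr (q - 2) * (cmod (apply_bcontfun \<phi> x))\<^sup>2"
      by simp
    also have "\<dots> \<le> norm \<phi> powr (q - 2) * (cmod (apply_bcontfun \<phi> x))\<^sup>2"
      using assms by (intro mult_right_mono powr_mono2 norm_bounded) auto
    finally show "cmod (apply_bcontfun \<phi> x) powr q \<le> norm \<phi> powr (q - 2) * (cmod (apply_bcontfun \<phi> x))\<^sup>2" .
  qed (use assms integrable_powr in auto)
  then show ?thesis by (simp add: particle_number_eq_integral)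
qed

lemma continuous_on_power_integral:
  assumes "q > 0" shows "continuous_on S (power_integral L q)"
proof (rule continuous_on_sequentiallyI)
  fix u :: "nat \<Rightarrow> (real \<Rightarrow>\<^sub>C complex)" and \<phi> assume "u \<longlonglongrightarrow> \<phi>"
  then have "Bseq u" by (intro convergent_imp_Bseq convergentI)
  then obtain K where K: "K > 0" "\<And>n. norm (u n) \<le> K" by (auto simp: Bseq_def)
  have b: "apply_bcontfun f \<in> borel_measurable borel" for f :: "real \<Rightarrow>\<^sub>C complex"
    by (intro borel_measurable_continuous_onI) auto
  show "(\<lambda>n. power_integral L q (u n)) \<longlonglongrightarrow> power_integral L q \<phi>"
    unfolding power_integral_def set_lebesgue_integral_def
  proof (rule integral_dominated_convergence[where w = "\<lambda>x. indicator {0..L} x * K powr q"])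
    show "AE x in lborel. (\<lambda>n. indicat_real {0..L} x *\<^sub>R cmod (apply_bcontfun (u n) x) powr q)
       \<longlonglongrightarrow> indicat_real {0..L} x *\<^sub>R cmod (apply_bcontfun \<phi> x) powr q"
      using assms by (intro AE_I2 tendsto_intros tendsto_apply_bcontfun \<open>u \<longlonglongrightarrow> \<phi>\<close> tendsto_powr') auto
    show "AE x in lborel. norm (indicat_real {0..L} x *\<^sub>R cmod (apply_bcontfun (u n) x) powr q) \<le> indicat_real {0..L} x * K powr q" for n
      using assms K by (intro AE_I2) (auto simp: indicator_def intro!: powr_mono2 order.trans[OF norm_bounded])
    show "integrable lborel (\<lambda>x. indicat_real {0..L} x * K powr q)"
      by (intro integrable_mult_left integrable_real_indicator) (auto simp: emeasure_lborel_Icc_eq)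
  qed (use b in measurable)
qed

lemma continuous_on_particle_number: "continuous_on S (particle_number L)"
  unfolding particle_number_eq_power_integral[abs_def] by (rule continuous_on_power_integral) simp

text \<open>The cross term of the expanded square is the \<open>j\<close>-th Fourier coefficient.
  This one identity lies behind both Bessel's inequality and the change of mass when a single mode
  is updated.\<close>

lemma particle_number_add_mode:
  assumes "L > 0"
  shows "particle_number L (\<phi> + mode_term L j c) = particle_number L \<phi> + 2 * Re (cnj c * fourier_coeff L j \<phi>) + (cmod c)\<^sup>2"
proof -
  have eq: "(cmod (apply_bcontfun (\<phi> + mode_term L j c) x))\<^sup>2 =
     (cmod (apply_bcontfun \<phi> x))\<^sup>2 + 2 * Re (cnj c * (cnj (fourier_mode L j x) * apply_bcontfun \<phi> x)) + (cmod c)\<^sup>2 / L" for x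
  proof -
    have "(cmod (z + w))\<^sup>2 = (cmod z)\<^sup>2 + 2 * Re (cnj w * z) + (cmod w)\<^sup>2" for z w
      unfolding cmod_power2 by (simp add: power2_eq_square algebra_simps)
    from this[of "apply_bcontfun \<phi> x" "c * fourier_mode L j x"] show ?thesis
      using assms by (simp add: norm_mult norm_fourier_mode power_mult_distrib power_divide mult.assoc del: times_complex.sel)
  qed
  have bl: "bounded_linear (\<lambda>z. 2 * Re (cnj c * z))"
    by (intro bounded_linear_const_mult bounded_linear_compose[OF bounded_linear_Re] bounded_linear_mult_right)
  have i1: "(\<lambda>x. (cmod (apply_bcontfun \<phi> x))\<^sup>2) integrable_on {0..L}"
    by (intro integrable_continuous_real continuous_intros continuous_on_apply_bcontfun)
  have i2: "(\<lambda>x. 2 * Re (cnj c * (cnj (fourier_mode L j x) * apply_bcontfun \<phi> x))) integrable_on {0..L}"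
    by (intro integrable_continuous_real continuous_intros continuous_on_apply_bcontfun)
  have "integral {0..L} (\<lambda>x. 2 * Re (cnj c * (cnj (fourier_mode L j x) * apply_bcontfun \<phi> x))) = 2 * Re (cnj c * fourier_coeff L j \<phi>)"
    using integral_linear[OF integrable_fourier bl, of L j \<phi>] unfolding fourier_coeff_eq_integral comp_def .
  moreover have "integral {0..L} (\<lambda>x. (cmod c)\<^sup>2 / L) = (cmod c)\<^sup>2" using assms by simp
  ultimately show ?thesis
    unfolding particle_number_eq_integral eq
    by (subst Henstock_Kurzweil_Integration.integral_add[OF integrable_add[OF i1 i2] integrable_const_ivl],
        subst Henstock_Kurzweil_Integration.integral_add[OF i1 i2]) simp
qed

text \<open>The modes are subtracted one at a time: orthogonality leaves the next coefficient
  unchanged, so each step removes exactly its squared modulus. For infinite \<open>A\<close> both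
  sums are 0 by convention.\<close>

lemma particle_number_split:
  assumes "L > 0"
  shows "particle_number L \<phi> = (\<Sum>j\<in>A. (cmod (fourier_coeff L j \<phi>))\<^sup>2) + particle_number L (\<phi> - (\<Sum>j\<in>A. mode_term L j (fourier_coeff L j \<phi>)))"
proof (induction A rule: infinite_finite_induct)
  case (insert a A)
  define \<psi> where "\<psi> = \<phi> - (\<Sum>j\<in>A. mode_term L j (fourier_coeff L j \<phi>))"
  have c: "fourier_coeff L a \<psi> = fourier_coeff L a \<phi>"
    using insert.hyps by (auto simp: \<psi>_def fourier_coeff_diff fourier_coeff_sum fourier_coeff_mode_term[OF assms] intro!: sum.neutral)
  have "mode_term L a (- c) = - mode_term L a c" for c by (rule bcontfun_eqI) simp
  then have E: "\<phi> - (\<Sum>j\<in>insert a A. mode_term L j (fourier_coeff L j \<phi>)) = \<psi> + mode_term L a (- fourier_coeff L a \<phi>)"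
    using insert.hyps by (simp add: \<psi>_def)
  have Q: "particle_number L (\<phi> - (\<Sum>j\<in>insert a A. mode_term L j (fourier_coeff L j \<phi>)))
      = particle_number L \<psi> - (cmod (fourier_coeff L a \<phi>))\<^sup>2"
    unfolding E particle_number_add_mode[OF assms] c norm_minus_cancel cmod_power2 by (simp add: power2_eq_square)
  show ?case
    using insert.IH unfolding Q unfolding sum.insert[OF insert.hyps(1,2)] by (simp add: \<psi>_def)
qed auto

lemma bessel_inequality:
  "L > 0 \<Longrightarrow> (\<Sum>j\<in>A. (cmod (fourier_coeff L j \<phi>))\<^sup>2) \<le> particle_number L \<phi>"
  using particle_number_split[of L \<phi> A] particle_number_nonneg[of L "\<phi> - (\<Sum>j\<in>A. mode_term L j (fourier_coeff L j \<phi>))"] by linarith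

text \<open>Fejer's theorem. After rescaling to circumference \<open>2 * pi\<close>, the Fejer means
  of \<open>\<phi>\<close> at \<open>x\<close> are combinations of its Fourier coefficients, hence
  0, and they converge to a multiple of the value at \<open>x\<close>. This injectivity is what
  makes the Gaussian measure unique.\<close>

lemma Omega_eq_0I:
  assumes L: "L > 0" and \<phi>: "\<phi> \<in> Omega L" and zero: "\<And>j. fourier_coeff L j \<phi> = 0"
  shows "\<phi> = 0"
proof -
  have per: "apply_bcontfun \<phi> (x + L) = apply_bcontfun \<phi> x" for x using \<phi> by (simp add: Omega_def)
  \<comment> \<open>For these \<open>x\<close> the window \<open>{x - L / 2..x + L / 2}\<close>
    starts between 0 and \<open>L\<close>, as \<open>integral_periodic_window\<close> requires. All
    other points are reached at the end by periodicity.\<close>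
  have mid: "apply_bcontfun \<phi> x = 0" if x: "L / 2 \<le> x" "x \<le> 3 * L / 2" for x
  proof -
    define g where "g t = apply_bcontfun \<phi> (x + (- (L / (2 * pi))) * t)" for t
    have g_cont: "continuous_on S g" for S unfolding g_def
      by (rule continuous_on_compose2[of UNIV "apply_bcontfun \<phi>"]) (auto intro!: continuous_intros)
    have gm: "g \<in> borel_measurable borel" by (rule borel_measurable_continuous_onI[OF g_cont])
    \<comment> \<open>The substitution \<open>y = x - L * t / (2 * pi)\<close> turns this into a
      multiple of the \<open>n\<close>-th Fourier coefficient of \<open>\<phi>\<close>.\<close>
    have J: "(LINT t:{-pi..pi}|lborel. cis (real_of_int n * t) * g t) = 0" for n
    proof -
      define F where "F y = indicator {x - L / 2..x + L / 2} y *\<^sub>R (cis (2 * pi * real_of_int n * (x - y) / L) * apply_bcontfun \<phi> y)" for y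
      have "indicator {x - L / 2..x + L / 2} (x + - (L / (2 * pi)) * t) = (indicator {-pi..pi} t :: real)" for t
      proof -
        define c where "c = L / (2 * pi)"
        have c: "c > 0" "L / 2 = c * pi" using L by (auto simp: c_def)
        have "c * t \<le> c * pi \<longleftrightarrow> t \<le> pi" "c * - pi \<le> c * t \<longleftrightarrow> - pi \<le> t"
          using c(1) by (simp_all only: mult_le_cancel_left_pos)
        then show ?thesis unfolding c(2) c_def[symmetric] by (auto simp: indicator_def)
      qed
      moreover have "2 * pi * real_of_int n * (x - (x + - (L / (2 * pi)) * t)) / L = real_of_int n * t" for t
        using L by (simp add: field_simps)
      ultimately have F: "F (x + (- (L / (2 * pi))) * t) = indicator {-pi..pi} t *\<^sub>R (cis (real_of_int n * t) * g t)" for t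
        unfolding F_def g_def by presburger
      have "(\<integral>y. F y \<partial>lborel) = integral {x - L / 2..x - L / 2 + L} (\<lambda>y. cis (2 * pi * real_of_int n * (x - y) / L) * apply_bcontfun \<phi> y)"
      proof -
        have "(\<integral>y. F y \<partial>lborel) = (LINT y:{x - L / 2..x - L / 2 + L}|lborel. cis (2 * pi * real_of_int n * (x - y) / L) * apply_bcontfun \<phi> y)"
          unfolding F_def set_lebesgue_integral_def by (simp add: algebra_simps)
        also have "\<dots> = integral {x - L / 2..x - L / 2 + L} (\<lambda>y. cis (2 * pi * real_of_int n * (x - y) / L) * apply_bcontfun \<phi> y)"
          using L by (intro set_lborel_integral_eq_integral_continuous continuous_intros continuous_on_apply_bcontfun) auto
        finally show ?thesis .
      qed
      also have "\<dots> = integral {0..L} (\<lambda>y. cis (2 * pi * real_of_int n * (x - y) / L) * apply_bcontfun \<phi> y)"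
      proof (rule integral_periodic_window)
        show "continuous_on UNIV (\<lambda>y. cis (2 * pi * real_of_int n * (x - y) / L) * apply_bcontfun \<phi> y)"
          using L by (intro continuous_intros continuous_on_apply_bcontfun) auto
        fix y
        have "cis (2 * pi * real_of_int n * (x - (y + L)) / L) = cis (2 * pi * real_of_int n * (x - y) / L) * cis (2 * pi * real_of_int (- n))"
          unfolding cis_mult by (rule arg_cong[of _ _ cis]) (use L in \<open>simp add: field_simps\<close>)
        also have "cis (2 * pi * real_of_int (- n)) = 1" by (simp add: complex_eq_iff cos_int_2pin sin_int_2pin del: of_int_minus)
        finally show "cis (2 * pi * real_of_int n * (x - (y + L)) / L) * apply_bcontfun \<phi> (y + L) = cis (2 * pi * real_of_int n * (x - y) / L) * apply_bcontfun \<phi> y"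
          by (simp add: per)
      qed (use x in auto)
      also have "(\<lambda>y. cis (2 * pi * real_of_int n * (x - y) / L) * apply_bcontfun \<phi> y)
         = (\<lambda>y. (of_real (L powr (1 / 2)) * cis (2 * pi * real_of_int n * x / L)) * (cnj (fourier_mode L n y) * apply_bcontfun \<phi> y))"
      proof
        fix y
        have "cis (2 * pi * real_of_int n * (x - y) / L) = cis (2 * pi * real_of_int n * x / L) * cis (- (2 * pi * real_of_int n * y / L))"
          unfolding cis_mult by (rule arg_cong[of _ _ cis]) (use L in \<open>simp add: field_simps\<close>)
        moreover have "of_real (L powr (1 / 2)) * of_real (L powr (- 1 / 2)) = (1::complex)"
          using L unfolding of_real_mult[symmetric] powr_add[symmetric] by simp
        ultimately show "cis (2 * pi * real_of_int n * (x - y) / L) * apply_bcontfun \<phi> y =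
           of_real (L powr (1 / 2)) * cis (2 * pi * real_of_int n * x / L) * (cnj (fourier_mode L n y) * apply_bcontfun \<phi> y)"
          by (simp add: fourier_mode_def cis_cnj mult_ac)
      qed
      also have "integral {0..L} \<dots> = 0"
        using zero[of n] by (simp add: fourier_coeff_eq_integral)
      finally have "(\<integral>y. F y \<partial>lborel) = 0" .
      then have "(L / (2 * pi)) *\<^sub>R (\<integral>t. F (x + (- (L / (2 * pi))) * t) \<partial>lborel) = 0"
        using L by (subst (asm) lborel_integral_real_affine[of "- (L / (2 * pi))" _ x]) auto
      then show ?thesis using L unfolding F set_lebesgue_integral_def by simp
    qed
    have int: "set_integrable lborel {-pi..pi} (\<lambda>t. cis (real_of_int n * t) * g t)" for n
      by (intro borel_integrable_atLeastAtMost' continuous_intros g_cont)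
    have zero_l: "(\<integral>t. fejer_kernel l t *\<^sub>R g t \<partial>lborel) = 0" if "l > 0" for l
    proof -
      have "(\<integral>t. fejer_kernel l t *\<^sub>R g t \<partial>lborel)
         = (\<integral>t. (\<Sum>i<l. \<Sum>j<l. indicator {-pi..pi} t *\<^sub>R (cis (real_of_int (int i - int j) * t) * g t)) / of_nat l \<partial>lborel)"
      proof (intro Bochner_Integration.integral_cong refl)
        fix t
        show "fejer_kernel l t *\<^sub>R g t = (\<Sum>i<l. \<Sum>j<l. indicator {-pi..pi} t *\<^sub>R (cis (real_of_int (int i - int j) * t) * g t)) / of_nat l"
        proof (cases "t \<in> {-pi..pi}")
          case True
          then have "complex_of_real (fejer_kernel l t) = (\<Sum>i<l. \<Sum>j<l. cis ((real i - real j) * t)) / of_nat l"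
            using that by (intro fejer_kernel_eq_sum) auto
          then show ?thesis using True unfolding scaleR_conv_of_real by (simp add: sum_distrib_right)
        qed (simp add: fejer_kernel_outside)
      qed
      also have "\<dots> = (\<Sum>i<l. \<Sum>j<l. (\<integral>t. indicator {-pi..pi} t *\<^sub>R (cis (real_of_int (int i - int j) * t) * g t) \<partial>lborel)) / of_nat l"
        unfolding Bochner_Integration.integral_divide_zero
        by (subst Bochner_Integration.integral_sum; (intro Bochner_Integration.integrable_sum int[unfolded set_integrable_def])?)
           (intro arg_cong2[where f = "(/)"] sum.cong refl Bochner_Integration.integral_sum int[unfolded set_integrable_def])
      also have "\<dots> = 0" unfolding J[unfolded set_lebesgue_integral_def] by simp
      finally show ?thesis .
    qed
    have "isCont g 0" using g_cont[of UNIV] by (simp add: continuous_on_eq_continuous_at)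
    then have "(\<lambda>l. \<integral>t. fejer_kernel l t *\<^sub>R g t \<partial>lborel) \<longlonglongrightarrow> (2 * pi) *\<^sub>R g 0"
      by (intro fejer_approx_identity_0[OF gm, where B = "norm \<phi>"]) (simp add: g_def norm_bounded)
    moreover have "(\<lambda>l. \<integral>t. fejer_kernel l t *\<^sub>R g t \<partial>lborel) \<longlonglongrightarrow> 0"
      by (rule tendsto_eventually) (auto intro!: eventually_sequentiallyI[of 1] zero_l)
    ultimately have "(2 * pi) *\<^sub>R g 0 = 0" by (rule LIMSEQ_unique)
    then show ?thesis by (simp add: g_def)
  qed
  show ?thesis
  proof (rule bcontfun_eqI)
    fix x
    obtain n :: int where n: "L / 2 \<le> x + real_of_int n * L" "x + real_of_int n * L \<le> 3 * L / 2"
    proof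
      \<comment> \<open>The floor of \<open>y\<close> is the largest shift that keeps the translate
        at or below \<open>3 * L / 2\<close>; being within 1 of \<open>y\<close>, it also keeps it
        at or above \<open>L / 2\<close>.\<close>
      define y where "y = 3 / 2 - x / L"
      have "real_of_int \<lfloor>y\<rfloor> \<le> y" "y - 1 \<le> real_of_int \<lfloor>y\<rfloor>" by linarith+
      then have "real_of_int \<lfloor>y\<rfloor> * L \<le> y * L" "(y - 1) * L \<le> real_of_int \<lfloor>y\<rfloor> * L" using L by (auto intro: mult_right_mono)
      moreover have "y * L = 3 * L / 2 - x" using L by (simp add: y_def field_simps)
      ultimately show "L / 2 \<le> x + real_of_int \<lfloor>y\<rfloor> * L" "x + real_of_int \<lfloor>y\<rfloor> * L \<le> 3 * L / 2"
        by (auto simp: algebra_simps)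
    qed
    have "apply_bcontfun \<phi> (x + real_of_int n * L) = apply_bcontfun \<phi> x" by (rule Omega_shift_of_int[OF \<phi>])
    then show "apply_bcontfun \<phi> x = apply_bcontfun 0 x" using mid[OF n] by simp
  qed
qed

section \<open>Tail bounds for blocks of modes\<close>

lemma apply_bcontfun_sum: "apply_bcontfun (\<Sum>i\<in>I. f i) x = (\<Sum>i\<in>I. apply_bcontfun (f i) x)"
  by (induction I rule: infinite_finite_induct) auto

lemma cmod_cis_diff_le: "cmod (cis a - cis b) \<le> \<bar>a - b\<bar>"
proof -
  have "cis a - cis b = cis b * (cis (a - b) - 1)"
    by (simp add: right_diff_distrib cis_mult)
  then have "cmod (cis a - cis b) = cmod (cis (a - b) - 1)"
    by (simp add: norm_mult)
  also have "\<dots> = 2 * \<bar>sin ((a - b) / 2)\<bar>"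
    using dist_exp_i_1[of "a - b"] by (simp add: cis_conv_exp)
  also have "\<dots> \<le> \<bar>a - b\<bar>"
    using abs_sin_x_le_abs_x[of "(a - b) / 2"] by simp
  finally show ?thesis .
qed

lemma fourier_mode_lipschitz:
  assumes "L > 0"
  shows "cmod (fourier_mode L j x - fourier_mode L j y) \<le> 1 / sqrt L * (2 * pi * \<bar>real_of_int j\<bar> / L * \<bar>x - y\<bar>)"
proof -
  have "cmod (fourier_mode L j x - fourier_mode L j y)
     = cmod (complex_of_real (L powr (- 1 / 2))) * cmod (cis (2 * pi * real_of_int j * x / L) - cis (2 * pi * real_of_int j * y / L))"
    unfolding fourier_mode_def right_diff_distrib[symmetric] by (rule norm_mult)
  also have "cmod (complex_of_real (L powr (- 1 / 2))) = 1 / sqrt L"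
    unfolding norm_of_real using norm_fourier_mode[OF assms, of 0 0] norm_fourier_mode_eq[of L 0 0]
    by (metis abs_of_nonneg powr_ge_zero)
  finally have eq: "cmod (fourier_mode L j x - fourier_mode L j y)
    = 1 / sqrt L * cmod (cis (2 * pi * real_of_int j * x / L) - cis (2 * pi * real_of_int j * y / L))" .
  have "cmod (cis (2 * pi * real_of_int j * x / L) - cis (2 * pi * real_of_int j * y / L))
     \<le> \<bar>2 * pi * real_of_int j * x / L - 2 * pi * real_of_int j * y / L\<bar>"
    by (rule cmod_cis_diff_le)
  also have "2 * pi * real_of_int j * x / L - 2 * pi * real_of_int j * y / L = 2 * pi * real_of_int j / L * (x - y)"
    by (simp add: right_diff_distrib diff_divide_distrib)
  also have "\<bar>2 * pi * real_of_int j / L * (x - y)\<bar> = 2 * pi * \<bar>real_of_int j\<bar> / L * \<bar>x - y\<bar>"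
    using assms by (simp add: abs_mult)
  finally show ?thesis unfolding eq using assms by (intro mult_left_mono) auto
qed

lemma grid_point_near:
  assumes L: "L > 0" and \<phi>: "\<phi> \<in> Omega L" and G: "G > 0"
  obtains g y where "g < G" "apply_bcontfun \<phi> x = apply_bcontfun \<phi> y" "\<bar>y - real g * (L / real G)\<bar> \<le> L / real G"
proof -
  define k where "k = \<lfloor>x / L\<rfloor>"
  define y where "y = x - real_of_int k * L"
  have "apply_bcontfun \<phi> x = apply_bcontfun \<phi> y"
    using Omega_shift_of_int[OF \<phi>, of y k] by (simp add: y_def)
  have k: "real_of_int k \<le> x / L" "x / L < real_of_int k + 1" unfolding k_def by linarith+
  have y: "0 \<le> y" "y < L"
    using k L by (auto simp: y_def field_simps)
  define h where "h = L / real G"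
  have h: "h > 0" "real G * h = L" using L G by (auto simp: h_def)
  define g where "g = nat \<lfloor>y / h\<rfloor>"
  have "0 \<le> y / h" using y h by simp
  then have g: "real g \<le> y / h" "y / h < real g + 1" unfolding g_def by linarith+
  have "y / h < real G" using y h by (simp add: field_simps)
  then have "g < G" using g by linarith
  moreover have "real g * h \<le> y" "y < real g * h + h" using g h by (auto simp: field_simps)
  then have "\<bar>y - real g * h\<bar> \<le> h" by auto
  ultimately show ?thesis using that \<open>apply_bcontfun \<phi> x = apply_bcontfun \<phi> y\<close> unfolding h_def by blast
qed

section \<open>Sup norms of finite trigonometric sums\<close>

definition mode_sum :: "real \<Rightarrow> int set \<Rightarrow> (int \<Rightarrow> complex) \<Rightarrow> (real \<Rightarrow>\<^sub>C complex)" where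
  "mode_sum L A w = (\<Sum>j\<in>A. mode_term L j (w j))"

lemma apply_mode_sum: "apply_bcontfun (mode_sum L A w) x = (\<Sum>j\<in>A. w j * fourier_mode L j x)"
  by (simp add: mode_sum_def apply_bcontfun_sum)

lemma mode_sum_Omega [simp]: "L > 0 \<Longrightarrow> mode_sum L A w \<in> Omega L"
  unfolding mode_sum_def by (rule Omega_sum) simp

lemma fourier_coeff_mode_sum:
  assumes "L > 0" "finite A" shows "fourier_coeff L j (mode_sum L A w) = (if j \<in> A then w j else 0)"
proof -
  have "fourier_coeff L j (mode_sum L A w) = (\<Sum>i\<in>A. if i = j then w i else 0)"
    unfolding mode_sum_def fourier_coeff_sum using assms by (simp add: fourier_coeff_mode_term)
  then show ?thesis using assms by simp
qed

lemma continuous_on_mode_sum: "L > 0 \<Longrightarrow> continuous_on UNIV (mode_sum L A)"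
  unfolding mode_sum_def[abs_def]
  by (intro continuous_on_sum continuous_on_mode_term continuous_on_product_coordinates)

text \<open>A crude Bernstein inequality: the coefficients are bounded by the supremum norm, hence so
  is the Lipschitz constant, and the norm is controlled by the values on a fine grid.\<close>

lemma norm_mode_sum_le_grid:
  assumes L: "L > 0" and A: "finite A" "\<And>j. j \<in> A \<Longrightarrow> \<bar>real_of_int j\<bar> \<le> K" and G: "G > 0" "4 * pi * real (card A) * K \<le> real G"
    and \<tau>: "\<And>g. g < G \<Longrightarrow> cmod (apply_bcontfun (mode_sum L A w) (real g * (L / real G))) \<le> \<tau>"
  shows "norm (mode_sum L A w) \<le> 2 * \<tau>"
proof -
  let ?\<phi> = "mode_sum L A w"
  have lip: "cmod (apply_bcontfun ?\<phi> x - apply_bcontfun ?\<phi> y) \<le> real (card A) * (2 * pi * K / L * norm ?\<phi> * \<bar>x - y\<bar>)" for x y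
  proof -
    have "cmod (w j * (fourier_mode L j x - fourier_mode L j y)) \<le> 2 * pi * K / L * norm ?\<phi> * \<bar>x - y\<bar>" if j: "j \<in> A" for j
    proof -
      have "cmod (w j) \<le> sqrt L * norm ?\<phi>"
        using norm_fourier_coeff_le[OF L, of j ?\<phi>] j by (simp add: fourier_coeff_mode_sum[OF L A(1)])
      then have "cmod (w j) * cmod (fourier_mode L j x - fourier_mode L j y)
          \<le> (sqrt L * norm ?\<phi>) * (1 / sqrt L * (2 * pi * \<bar>real_of_int j\<bar> / L * \<bar>x - y\<bar>))"
        using L by (intro mult_mono fourier_mode_lipschitz) auto
      also have "\<dots> = norm ?\<phi> * (2 * pi * \<bar>real_of_int j\<bar> / L * \<bar>x - y\<bar>)" using L by simp
      also have "\<dots> \<le> norm ?\<phi> * (2 * pi * K / L * \<bar>x - y\<bar>)"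
        using A(2)[OF j] L by (intro mult_left_mono mult_right_mono divide_right_mono) auto
      finally show ?thesis by (simp add: norm_mult mult_ac)
    qed
    then have "(\<Sum>j\<in>A. cmod (w j * (fourier_mode L j x - fourier_mode L j y))) \<le> of_nat (card A) * (2 * pi * K / L * norm ?\<phi> * \<bar>x - y\<bar>)"
      by (rule sum_bounded_above)
    moreover have "apply_bcontfun ?\<phi> x - apply_bcontfun ?\<phi> y = (\<Sum>j\<in>A. w j * (fourier_mode L j x - fourier_mode L j y))"
      by (simp add: apply_mode_sum sum_subtractf right_diff_distrib)
    ultimately show ?thesis using norm_sum[of "\<lambda>j. w j * (fourier_mode L j x - fourier_mode L j y)" A] by simp
  qed
  \<comment> \<open>The condition on \<open>G\<close> makes the oscillation over one grid cell at
    most half the sup norm, which is then absorbed on the left; hence the factor 2 in the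
    conclusion.\<close>
  have "norm ?\<phi> \<le> \<tau> + norm ?\<phi> / 2"
  proof (rule norm_bound)
    fix x
    obtain g y where g: "g < G" "apply_bcontfun ?\<phi> x = apply_bcontfun ?\<phi> y" "\<bar>y - real g * (L / real G)\<bar> \<le> L / real G"
      using grid_point_near[OF L _ G(1), of ?\<phi> x] L by auto
    have "cmod (apply_bcontfun ?\<phi> y) \<le> \<tau> + real (card A) * (2 * pi * K / L * norm ?\<phi> * \<bar>y - real g * (L / real G)\<bar>)"
      using \<tau>[OF g(1)] lip[of y "real g * (L / real G)"]
        norm_triangle_sub[of "apply_bcontfun ?\<phi> y" "apply_bcontfun ?\<phi> (real g * (L / real G))"] by linarith
    also have "\<dots> \<le> \<tau> + norm ?\<phi> / 2"
    proof (cases "A = {}")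
      case False
      then obtain j where "j \<in> A" by auto
      then have "K \<ge> 0" using A(2)[of j] by linarith
      then have "real (card A) * (2 * pi * K / L * norm ?\<phi> * \<bar>y - real g * (L / real G)\<bar>)
          \<le> real (card A) * (2 * pi * K / L * norm ?\<phi> * (L / real G))"
        using L by (intro mult_left_mono g(3)) auto
      also have "\<dots> = (4 * pi * real (card A) * K) / real G * (norm ?\<phi> / 2)" using L by simp
      also have "\<dots> \<le> 1 * (norm ?\<phi> / 2)" using G by (intro mult_right_mono) auto
      finally show ?thesis by simp
    qed simp
    finally show "cmod (apply_bcontfun ?\<phi> x) \<le> \<tau> + norm ?\<phi> / 2" unfolding g(2) .
  qed
  then show ?thesis by simp
qed

text \<open>Dyadic shells of frequencies. Mode 0 lies in every \<open>low_modes n\<close> and in no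
  \<open>mode_block n\<close>, so changing it never affects the tail events, which are built from
  blocks.\<close>

definition low_modes :: "nat \<Rightarrow> int set" where "low_modes n = {j. \<bar>j\<bar> < 2 ^ n}"
definition mode_block :: "nat \<Rightarrow> int set" where "mode_block n = {j. 2 ^ n \<le> \<bar>j\<bar> \<and> \<bar>j\<bar> < 2 ^ Suc n}"

lemma low_modes_eq: "low_modes n = {- (2 ^ n)<..<2 ^ n}"
  by (auto simp: low_modes_def)

lemma finite_low_modes [simp]: "finite (low_modes n)"
  by (simp add: low_modes_eq)

lemma finite_mode_block [simp]: "finite (mode_block n)"
proof -
  have "mode_block n \<subseteq> low_modes (Suc n)" by (auto simp: mode_block_def low_modes_def)
  then show ?thesis by (rule finite_subset) (rule finite_low_modes)
qed

lemma low_modes_Suc: "low_modes (Suc n) = low_modes n \<union> mode_block n" "low_modes n \<inter> mode_block n = {}"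
proof -
  have "(2::int) ^ n \<le> 2 ^ Suc n" by simp
  then show "low_modes (Suc n) = low_modes n \<union> mode_block n" unfolding low_modes_def mode_block_def by auto
qed (auto simp: low_modes_def mode_block_def)

lemma card_low_modes: "card (low_modes n) \<le> 2 ^ Suc n"
proof -
  have "int (card (low_modes n)) \<le> int (2 ^ Suc n)" by (simp add: low_modes_eq)
  then show ?thesis by (simp only: of_nat_le_iff)
qed

lemma card_mode_block: "card (mode_block n) \<le> 2 ^ Suc n"
proof -
  have sub: "mode_block n \<subseteq> (\<lambda>j. j) ` {2 ^ n..<2 ^ Suc n} \<union> uminus ` {2 ^ n..<2 ^ Suc n}"
  proof
    fix j assume "j \<in> mode_block n"
    then show "j \<in> (\<lambda>j. j) ` {2 ^ n..<2 ^ Suc n} \<union> uminus ` {2 ^ n..<2 ^ Suc n}"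
      by (cases "j \<ge> 0") (auto simp: mode_block_def intro!: image_eqI[of j uminus "- j"])
  qed
  have "card (mode_block n) \<le> card ((\<lambda>j. j) ` {2 ^ n..<2 ^ Suc n :: int} \<union> uminus ` {2 ^ n..<2 ^ Suc n})"
    by (rule card_mono[OF _ sub]) auto
  also have "\<dots> \<le> card {2 ^ n..<2 ^ Suc n :: int} + card {2 ^ n..<2 ^ Suc n :: int}"
    by (intro order.trans[OF card_Un_le] add_mono card_image_le) auto
  also have "card {2 ^ n..<2 ^ Suc n :: int} = 2 ^ n" by (simp add: nat_power_eq)
  finally show ?thesis by simp
qed

section \<open>Independent Gaussian coefficients and their tail bounds\<close>

locale circle_field =
  fixes L m :: real
  assumes L_pos: "L > 0" and m_pos: "m > 0"
begin

definition mode_law :: "(int \<Rightarrow> complex) measure" where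
  "mode_law = (\<Pi>\<^sub>M j\<in>UNIV. complex_gauss (mode_weight L m 1 j))"

lemma mode_weight_pos: "mode_weight L m 1 j > 0"
  using m_pos by (auto simp: mode_weight_def intro!: add_nonneg_pos)

text \<open>With countably many coordinates the product sigma-algebra is the Borel one, so functions
  that are continuous in the coefficient sequence are measurable.\<close>

lemma sets_mode_law [simp, measurable_cong]: "sets mode_law = sets borel"
  unfolding mode_law_def sets_PiM_equal_borel[symmetric] by (rule sets_PiM_cong) auto

lemma space_mode_law [simp]: "space mode_law = UNIV"
  by (simp add: mode_law_def space_PiM)

lemma measurable_coordinate [measurable]: "(\<lambda>w::int \<Rightarrow> complex. w j) \<in> borel_measurable borel"
  by (rule borel_measurable_continuous_onI) (rule continuous_on_product_coordinates)

sublocale mode_law: prob_space mode_law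
  unfolding mode_law_def by (intro prob_space_PiM prob_space_complex_gauss mode_weight_pos)

lemma distr_coordinate: "distr mode_law borel (\<lambda>w. w j) = complex_gauss (mode_weight L m 1 j)"
proof -
  have "distr mode_law (complex_gauss (mode_weight L m 1 j)) (\<lambda>w. w j) = complex_gauss (mode_weight L m 1 j)"
    unfolding mode_law_def by (rule distr_PiM_component) (auto intro: prob_space_complex_gauss mode_weight_pos)
  moreover have "distr mode_law (complex_gauss (mode_weight L m 1 j)) (\<lambda>w. w j) = distr mode_law borel (\<lambda>w. w j)"
    by (rule distr_cong) auto
  ultimately show ?thesis by simp
qed

lemma indep_coordinates: "mode_law.indep_vars (\<lambda>_. borel) (\<lambda>j w. w j) UNIV"
proof (subst mode_law.indep_vars_iff_distr_eq_PiM)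
  have "distr mode_law (\<Pi>\<^sub>M i\<in>UNIV. borel) (\<lambda>x. \<lambda>i\<in>UNIV. x i) = distr mode_law mode_law (\<lambda>x. x)"
    by (rule distr_cong) (auto simp: sets_PiM_equal_borel)
  also have "\<dots> = (\<Pi>\<^sub>M j\<in>UNIV. distr mode_law borel (\<lambda>w. w j))"
    by (simp add: distr_coordinate) (simp add: mode_law_def)
  finally show "distr mode_law (\<Pi>\<^sub>M i\<in>UNIV. borel) (\<lambda>x. \<lambda>i\<in>UNIV. x i) = (\<Pi>\<^sub>M j\<in>UNIV. distr mode_law borel (\<lambda>w. w j))" .
qed auto

lemma measurable_mode_sum [measurable]: "mode_sum L A \<in> borel_measurable borel"
  by (rule borel_measurable_continuous_onI) (rule continuous_on_mode_sum[OF L_pos])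

text \<open>The exponential Markov inequality; by independence the moment generating functions of
  the coefficients multiply. \<open>\<omega>\<close> selects a direction in the plane, and
  \<open>V\<close> bounds the variance of the resulting real Gaussian variable.\<close>

lemma chernoff_mode_sum_Re:
  assumes A: "finite A" and V: "V > 0" "(\<Sum>j\<in>A. 1 / (L * mode_weight L m 1 j)) \<le> V" and \<omega>: "cmod \<omega> = 1" and a: "a \<ge> 0"
  shows "emeasure mode_law {w. a \<le> Re (\<omega> * apply_bcontfun (mode_sum L A w) x)} \<le> ennreal (exp (- (a\<^sup>2 / (2 * V))))"
proof -
  \<comment> \<open>Minimises the exponent \<open>s\<^sup>2 * V / 2 - s * a\<close>.\<close>
  define s where "s = a / V"
  have s: "s \<ge> 0" "s * V = a" using V a by (auto simp: s_def)
  define c where "c j = complex_of_real s * \<omega> * fourier_mode L j x" for j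
  have c: "(cmod (c j))\<^sup>2 = s\<^sup>2 / L" for j
    using s L_pos \<omega> by (simp add: c_def norm_mult norm_fourier_mode power_mult_distrib power_divide)
  have S: "s * Re (\<omega> * apply_bcontfun (mode_sum L A w) x) = (\<Sum>j\<in>A. Re (c j * w j))" for w
  proof -
    have "complex_of_real s * (\<omega> * apply_bcontfun (mode_sum L A w) x) = (\<Sum>j\<in>A. c j * w j)"
      unfolding apply_mode_sum sum_distrib_left c_def by (simp add: mult_ac)
    then have "Re (complex_of_real s * (\<omega> * apply_bcontfun (mode_sum L A w) x)) = (\<Sum>j\<in>A. Re (c j * w j))"
      by (simp only: Re_sum)
    moreover have "Re (complex_of_real s * z) = s * Re z" for z by simp
    ultimately show ?thesis by (simp only:)
  qed
  have ap: "(\<lambda>w. apply_bcontfun (mode_sum L A w) x) \<in> borel_measurable borel"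
    unfolding apply_mode_sum by measurable
  have "emeasure mode_law {w. a \<le> Re (\<omega> * apply_bcontfun (mode_sum L A w) x)}
     = (\<integral>\<^sup>+w. indicator {w. a \<le> Re (\<omega> * apply_bcontfun (mode_sum L A w) x)} w \<partial>mode_law)"
    using ap by (subst nn_integral_indicator) auto
  also have "\<dots> \<le> (\<integral>\<^sup>+w. ennreal (exp (- (s * a))) * (\<Prod>j\<in>A. ennreal (exp (Re (c j * w j)))) \<partial>mode_law)"
  proof (rule nn_integral_mono)
    fix w
    have "(\<Prod>j\<in>A. ennreal (exp (Re (c j * w j)))) = ennreal (exp (s * Re (\<omega> * apply_bcontfun (mode_sum L A w) x)))"
      unfolding S using A by (simp add: prod_ennreal exp_sum)
    moreover have "1 \<le> exp (- (s * a)) * exp (s * Re (\<omega> * apply_bcontfun (mode_sum L A w) x))"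
      if "a \<le> Re (\<omega> * apply_bcontfun (mode_sum L A w) x)"
      using mult_left_mono[OF that s(1)] unfolding exp_add[symmetric] by simp
    ultimately show "indicator {w. a \<le> Re (\<omega> * apply_bcontfun (mode_sum L A w) x)} w
        \<le> ennreal (exp (- (s * a))) * (\<Prod>j\<in>A. ennreal (exp (Re (c j * w j))))"
      by (auto simp: indicator_def ennreal_mult[symmetric] simp del: times_complex.sel)
  qed
  also have "\<dots> = ennreal (exp (- (s * a))) * (\<integral>\<^sup>+w. (\<Prod>j\<in>A. ennreal (exp (Re (c j * w j)))) \<partial>mode_law)"
    by (rule nn_integral_cmult) measurable
  also have "(\<integral>\<^sup>+w. (\<Prod>j\<in>A. ennreal (exp (Re (c j * w j)))) \<partial>mode_law) = (\<Prod>j\<in>A. \<integral>\<^sup>+w. ennreal (exp (Re (c j * w j))) \<partial>mode_law)"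
    by (intro mode_law.indep_vars_nn_integral A mode_law.indep_vars_compose2[OF mode_law.indep_vars_subset[OF indep_coordinates]]) auto
  also have "\<dots> = (\<Prod>j\<in>A. ennreal (exp (s\<^sup>2 / 2 * (1 / (L * mode_weight L m 1 j)))))"
  proof (rule prod.cong[OF refl])
    fix j
    have "(\<integral>\<^sup>+w. ennreal (exp (Re (c j * w j))) \<partial>mode_law) = (\<integral>\<^sup>+z. ennreal (exp (Re (c j * z))) \<partial>distr mode_law borel (\<lambda>w. w j))"
      by (subst nn_integral_distr) auto
    also have "\<dots> = ennreal (exp (s\<^sup>2 / L / (2 * mode_weight L m 1 j)))"
      unfolding distr_coordinate complex_gauss_mgf[OF mode_weight_pos] c ..
    finally show "(\<integral>\<^sup>+w. ennreal (exp (Re (c j * w j))) \<partial>mode_law) = ennreal (exp (s\<^sup>2 / 2 * (1 / (L * mode_weight L m 1 j))))"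
      by (simp add: mult_ac)
  qed
  also have "\<dots> = ennreal (exp (s\<^sup>2 / 2 * (\<Sum>j\<in>A. 1 / (L * mode_weight L m 1 j))))"
    using A by (simp add: prod_ennreal exp_sum[symmetric] sum_distrib_left)
  also have "ennreal (exp (- (s * a))) * \<dots> \<le> ennreal (exp (- (s * a))) * ennreal (exp (s\<^sup>2 / 2 * V))"
    using V by (intro mult_left_mono ennreal_leI) (auto intro!: mult_left_mono)
  also have "\<dots> = ennreal (exp (- (s * a) + s\<^sup>2 / 2 * V))"
    by (simp only: ennreal_mult[symmetric] exp_ge_zero exp_add)
  also have "- (s * a) + s\<^sup>2 / 2 * V = - (a\<^sup>2 / (2 * V))"
    using V by (simp add: s_def power2_eq_square)
  finally show "emeasure mode_law {w. a \<le> Re (\<omega> * apply_bcontfun (mode_sum L A w) x)} \<le> ennreal (exp (- (a\<^sup>2 / (2 * V))))" .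
qed

text \<open>A modulus above \<open>\<tau>\<close> forces a real part of at least
  \<open>\<tau> / 2\<close> after multiplication by one of the four units
  \<open>1, - 1, \<i>, - \<i>\<close>; the 8 is that of
  \<open>(\<tau> / 2)\<^sup>2 / (2 * V)\<close>.\<close>

lemma tail_mode_sum_at:
  assumes A: "finite A" and V: "V > 0" "(\<Sum>j\<in>A. 1 / (L * mode_weight L m 1 j)) \<le> V" and \<tau>: "\<tau> \<ge> 0"
  shows "emeasure mode_law {w. \<tau> < cmod (apply_bcontfun (mode_sum L A w) x)} \<le> ennreal (4 * exp (- (\<tau>\<^sup>2 / (8 * V))))"
proof -
  define E where "E \<omega> = {w. \<tau> / 2 \<le> Re (\<omega> * apply_bcontfun (mode_sum L A w) x)}" for \<omega>
  have ap [measurable]: "(\<lambda>w. apply_bcontfun (mode_sum L A w) x) \<in> borel_measurable borel"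
    unfolding apply_mode_sum by measurable
  have Em: "E \<omega> \<in> sets mode_law" for \<omega> unfolding E_def by (simp del: times_complex.sel)
  have b: "emeasure mode_law (E \<omega>) \<le> ennreal (exp (- (\<tau>\<^sup>2 / (8 * V))))" if "cmod \<omega> = 1" for \<omega>
  proof -
    have "(\<tau> / 2)\<^sup>2 / (2 * V) = \<tau>\<^sup>2 / (8 * V)" by (simp add: power_divide)
    then show ?thesis using chernoff_mode_sum_Re[OF A V that, of "\<tau> / 2" x] \<tau> unfolding E_def by auto
  qed
  have "{w. \<tau> < cmod (apply_bcontfun (mode_sum L A w) x)} \<subseteq> (\<Union>\<omega>\<in>{1, - 1, \<i>, - \<i>}. E \<omega>)"
  proof
    fix w assume "w \<in> {w. \<tau> < cmod (apply_bcontfun (mode_sum L A w) x)}"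
    then have "\<tau> < \<bar>Re (apply_bcontfun (mode_sum L A w) x)\<bar> + \<bar>Im (apply_bcontfun (mode_sum L A w) x)\<bar>"
      using cmod_le[of "apply_bcontfun (mode_sum L A w) x"] by auto
    then show "w \<in> (\<Union>\<omega>\<in>{1, - 1, \<i>, - \<i>}. E \<omega>)" by (simp add: E_def) linarith
  qed
  then have "emeasure mode_law {w. \<tau> < cmod (apply_bcontfun (mode_sum L A w) x)} \<le> emeasure mode_law (\<Union>\<omega>\<in>{1, - 1, \<i>, - \<i>}. E \<omega>)"
    using Em by (intro emeasure_mono) auto
  also have "\<dots> \<le> (\<Sum>\<omega>\<in>{1, - 1, \<i>, - \<i>}. emeasure mode_law (E \<omega>))"
    using Em by (intro emeasure_subadditive_finite) auto
  also have "\<dots> \<le> (\<Sum>\<omega>\<in>{1, - 1, \<i>, - \<i>}. ennreal (exp (- (\<tau>\<^sup>2 / (8 * V)))))"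
    by (intro sum_mono b) auto
  also have "\<dots> = of_nat (card {1, - 1, \<i>, - \<i>}) * ennreal (exp (- (\<tau>\<^sup>2 / (8 * V))))"
    by simp
  also have "\<dots> \<le> of_nat 4 * ennreal (exp (- (\<tau>\<^sup>2 / (8 * V))))"
    by (intro mult_right_mono of_nat_mono) (simp_all add: card_insert_if)
  also have "\<dots> = ennreal (4 * exp (- (\<tau>\<^sup>2 / (8 * V))))"
    by (simp add: ennreal_mult)
  finally show ?thesis .
qed

text \<open>A union bound over the grid. A block has at most \<open>2 ^ Suc n\<close> modes, each
  contributing variance at most \<open>L / (2 * 4 ^ n)\<close>, so the pointwise variance is at most
  \<open>L / 2 ^ n\<close>.\<close>

lemma tail_block:
  assumes t: "t \<ge> 0"
  shows "emeasure mode_law {w. t < norm (mode_sum L (mode_block n) w)} \<le> ennreal (256 * 4 ^ n * exp (- (t\<^sup>2 * 2 ^ n / (32 * L))))"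
proof -
  let ?A = "mode_block n"
  \<comment> \<open>Meets the grid condition when the cardinality and the largest frequency are
    bounded by \<open>2 ^ Suc n\<close> and \<open>pi\<close> by 4. Together with the factor 4 of
    \<open>tail_mode_sum_at\<close> it gives the 256.\<close>
  define G :: nat where "G = 64 * 4 ^ n"
  define V where "V = L / 2 ^ n"
  have V: "V > 0" using L_pos by (simp add: V_def)
  have four: "(4::real) ^ n = 2 ^ n * 2 ^ n" by (simp add: power_mult_distrib[symmetric])
  \<comment> \<open>The weak bound \<open>2 \<le> (2 * pi)\<^sup>2\<close> suffices: its 2 cancels
    against the cardinality \<open>2 ^ Suc n\<close>, and the sum of these bounds becomes exactly
    \<open>V\<close>.\<close>
  have w: "1 / (L * mode_weight L m 1 j) \<le> L / (2 * 4 ^ n)" if "j \<in> ?A" for j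
  proof -
    have "(2::real) ^ n \<le> \<bar>real_of_int j\<bar>"
      using that unfolding mode_block_def by (metis (mono_tags, lifting) mem_Collect_eq of_int_abs of_int_le_iff of_int_numeral of_int_power)
    then have "((2::real) ^ n)\<^sup>2 \<le> (real_of_int j)\<^sup>2" by (metis abs_le_square_iff abs_of_nonneg zero_le_numeral zero_le_power)
    then have "4 ^ n \<le> (real_of_int j)\<^sup>2" by (simp add: four power2_eq_square)
    moreover have "(2::real) \<le> (2 * pi)\<^sup>2" using mult_mono[of 1 "2 * pi" 2 "2 * pi"] pi_ge_two by (simp add: power2_eq_square)
    ultimately have "2 * 4 ^ n \<le> (2 * pi)\<^sup>2 * (real_of_int j)\<^sup>2" by (intro mult_mono) auto
    then have "2 * 4 ^ n / L\<^sup>2 \<le> (2 * pi * real_of_int j / L)\<^sup>2"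
      by (simp add: power_divide power_mult_distrib divide_right_mono)
    also have "\<dots> \<le> mode_weight L m 1 j" by (simp add: mode_weight_def)
    finally have "L * (2 * 4 ^ n / L\<^sup>2) \<le> L * mode_weight L m 1 j" using L_pos by (intro mult_left_mono) auto
    then have "1 / (L * mode_weight L m 1 j) \<le> 1 / (L * (2 * 4 ^ n / L\<^sup>2))"
      using L_pos mode_weight_pos[of j] by (intro divide_left_mono) auto
    also have "\<dots> = L / (2 * 4 ^ n)" using L_pos by (simp add: power2_eq_square)
    finally show ?thesis .
  qed
  have "(\<Sum>j\<in>?A. 1 / (L * mode_weight L m 1 j)) \<le> of_nat (card ?A) * (L / (2 * 4 ^ n))"
    by (rule sum_bounded_above) (rule w)
  also have "\<dots> \<le> real (2 ^ Suc n) * (L / (2 * 4 ^ n))"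
    using card_mode_block[of n] L_pos by (intro mult_right_mono) (simp_all only: of_nat_le_iff, auto)
  also have "\<dots> = V" by (simp add: V_def four)
  finally have sumV: "(\<Sum>j\<in>?A. 1 / (L * mode_weight L m 1 j)) \<le> V" .
  have G: "G > 0" by (simp add: G_def)
  have bd: "4 * pi * real (card ?A) * 2 ^ Suc n \<le> real G"
  proof -
    have "real (card ?A) \<le> real (2 ^ Suc n)" using card_mode_block[of n] by (simp only: of_nat_le_iff)
    then have "4 * pi * real (card ?A) * 2 ^ Suc n \<le> 4 * 4 * real (2 ^ Suc n) * 2 ^ Suc n"
      using pi_less_4 by (intro mult_mono) auto
    also have "\<dots> = real G" by (simp add: G_def four)
    finally show ?thesis .
  qed
  have jA: "\<bar>real_of_int j\<bar> \<le> 2 ^ Suc n" if "j \<in> ?A" for j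
  proof -
    have "\<bar>j\<bar> \<le> 2 ^ Suc n" using that by (simp add: mode_block_def)
    then have "real_of_int \<bar>j\<bar> \<le> real_of_int (2 ^ Suc n)" by (simp only: of_int_le_iff)
    then show ?thesis by simp
  qed
  define E where "E g = {w. t / 2 < cmod (apply_bcontfun (mode_sum L ?A w) (real g * (L / real G)))}" for g
  have ap [measurable]: "(\<lambda>w. apply_bcontfun (mode_sum L ?A w) x) \<in> borel_measurable borel" for x
    unfolding apply_mode_sum by measurable
  have Em: "E g \<in> sets mode_law" for g unfolding E_def by simp
  have "{w. t < norm (mode_sum L ?A w)} \<subseteq> (\<Union>g<G. E g)"
  proof
    fix w assume w: "w \<in> {w. t < norm (mode_sum L ?A w)}"
    show "w \<in> (\<Union>g<G. E g)"
    proof (rule ccontr)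
      assume "w \<notin> (\<Union>g<G. E g)"
      then have "norm (mode_sum L ?A w) \<le> 2 * (t / 2)"
        by (intro norm_mode_sum_le_grid[OF L_pos _ jA G bd]) (auto simp: E_def not_less)
      with w show False by simp
    qed
  qed
  then have "emeasure mode_law {w. t < norm (mode_sum L ?A w)} \<le> emeasure mode_law (\<Union>g<G. E g)"
    using Em by (intro emeasure_mono) auto
  also have "\<dots> \<le> (\<Sum>g<G. emeasure mode_law (E g))"
    using Em by (intro emeasure_subadditive_finite) auto
  also have "\<dots> \<le> (\<Sum>g<G. ennreal (4 * exp (- ((t / 2)\<^sup>2 / (8 * V)))))"
    unfolding E_def using t by (intro sum_mono tail_mode_sum_at V sumV) auto
  also have "\<dots> = ennreal (real G * (4 * exp (- ((t / 2)\<^sup>2 / (8 * V)))))"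
    by (simp add: ennreal_mult ennreal_of_nat_eq_real_of_nat)
  also have "real G * (4 * exp (- ((t / 2)\<^sup>2 / (8 * V)))) = 256 * 4 ^ n * exp (- (t\<^sup>2 * 2 ^ n / (32 * L)))"
    by (simp add: G_def V_def power_divide)
  finally show ?thesis .
qed

end

section \<open>The Gaussian measure\<close>

context circle_field
begin

section \<open>The random Fourier series and its uniform convergence\<close>

definition partial_field :: "nat \<Rightarrow> (int \<Rightarrow> complex) \<Rightarrow> (real \<Rightarrow>\<^sub>C complex)" where
  "partial_field n w = mode_sum L (low_modes n) w"

text \<open>A Cauchy condition involves only countably many distances between partial sums and is
  therefore measurable; by completeness it is the same as convergence.\<close>

definition convergent_modes :: "(int \<Rightarrow> complex) \<Rightarrow> bool" where
  "convergent_modes w \<longleftrightarrow> Cauchy (\<lambda>n. partial_field n w)"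

text \<open>The default 0 belongs to \<open>Omega L\<close>, so the field lies there for every
  \<open>w\<close> and not only for almost every one.\<close>

definition random_field :: "(int \<Rightarrow> complex) \<Rightarrow> (real \<Rightarrow>\<^sub>C complex)" where
  "random_field w = (if convergent_modes w then lim (\<lambda>n. partial_field n w) else 0)"

lemma partial_field_tendsto: "convergent_modes w \<Longrightarrow> (\<lambda>n. partial_field n w) \<longlonglongrightarrow> random_field w"
  unfolding convergent_modes_def random_field_def using Cauchy_convergent convergent_LIMSEQ_iff by auto

lemma random_field_eqI:
  assumes "(\<lambda>n. partial_field n w) \<longlonglongrightarrow> \<phi>"
  shows "convergent_modes w" "random_field w = \<phi>"
proof -
  show "convergent_modes w" using assms LIMSEQ_imp_Cauchy unfolding convergent_modes_def by blast
  then show "random_field w = \<phi>" using LIMSEQ_unique[OF partial_field_tendsto assms] by simp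
qed

lemma continuous_on_partial_field: "continuous_on UNIV (partial_field n)"
  unfolding partial_field_def[abs_def] by (rule continuous_on_mode_sum[OF L_pos])

lemma measurable_partial_field [measurable]: "partial_field n \<in> borel_measurable borel"
  by (rule borel_measurable_continuous_onI[OF continuous_on_partial_field])

text \<open>The target space is not separable, so the distance of two measurable fields need not be
  measurable in general; here it is, being continuous in \<open>w\<close>.\<close>

lemma measurable_convergent_modes [measurable]: "Measurable.pred borel convergent_modes"
proof -
  have "(\<lambda>w. dist (partial_field a w) (partial_field b w)) \<in> borel_measurable borel" for a b
    by (intro borel_measurable_continuous_onI continuous_on_dist continuous_on_partial_field)
  then show ?thesis
    unfolding convergent_modes_def[abs_def] metric_Cauchy_iff2 by measurable
qed

lemma measurable_random_field [measurable]: "random_field \<in> borel_measurable borel"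
proof (rule borel_measurable_LIMSEQ_metric)
  show "(\<lambda>w. if convergent_modes w then partial_field i w else 0) \<in> borel_measurable borel" for i
    by measurable
  show "(\<lambda>i. if convergent_modes w then partial_field i w else 0) \<longlonglongrightarrow> random_field w" for w
    using partial_field_tendsto by (cases "convergent_modes w") (auto simp: random_field_def)
qed

lemma random_field_Omega [simp]: "random_field w \<in> Omega L"
proof (cases "convergent_modes w")
  case True
  show ?thesis
    by (rule closed_sequentially[OF closed_Omega _ partial_field_tendsto[OF True]])
       (simp add: partial_field_def L_pos)
qed (simp add: random_field_def)

lemma fourier_coeff_random_field:
  assumes "convergent_modes w" shows "fourier_coeff L j (random_field w) = w j"
proof (rule LIMSEQ_unique)
  show "(\<lambda>n. fourier_coeff L j (partial_field n w)) \<longlonglongrightarrow> fourier_coeff L j (random_field w)"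
    using continuous_on_tendsto_compose[OF continuous_on_fourier_coeff[OF L_pos, of UNIV j] partial_field_tendsto[OF assms]] by simp
  show "(\<lambda>n. fourier_coeff L j (partial_field n w)) \<longlonglongrightarrow> w j"
  proof (rule tendsto_eventually, rule eventually_sequentiallyI[of "nat \<bar>j\<bar>"])
    fix n assume "nat \<bar>j\<bar> \<le> n"
    then have "\<bar>j\<bar> \<le> int n" by simp
    also have "int n < 2 ^ n" using of_nat_less_two_power[of n, where 'a = int] by simp
    finally have "j \<in> low_modes n" by (simp add: low_modes_def)
    then show "fourier_coeff L j (partial_field n w) = w j"
      by (simp add: partial_field_def fourier_coeff_mode_sum L_pos)
  qed
qed

text \<open>The \<open>d / 4\<close> is a compromise: these levels sum over \<open>d\<close> to a
  multiple of \<open>2 powr (n / 2)\<close>, while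
  \<open>(block_bound n d)\<^sup>2 * 2 ^ (n + d)\<close>, which equals
  \<open>4 ^ n * 2 powr (d / 2)\<close>, still grows in \<open>d\<close>, so that the failure
  probabilities stay summable.\<close>

definition block_bound :: "nat \<Rightarrow> nat \<Rightarrow> real" where
  "block_bound n d = 2 powr (real n / 2 - real d / 4)"

definition bad_event :: "nat \<Rightarrow> (int \<Rightarrow> complex) set" where
  "bad_event n = (\<Union>d. {w. block_bound n d < norm (mode_sum L (mode_block (n + d)) w)})"

lemma measurable_norm_mode_sum [measurable]: "(\<lambda>w. norm (mode_sum L A w)) \<in> borel_measurable borel"
  by (intro borel_measurable_continuous_onI continuous_on_norm continuous_on_mode_sum L_pos)

lemma bad_event_sets [measurable]: "bad_event n \<in> sets borel"
  unfolding bad_event_def by measurable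

lemma emeasure_bad_event_le:
  obtains C where "C \<ge> 0" "\<And>n. emeasure mode_law (bad_event n) \<le> ennreal (C * (4 ^ n * exp (- (4 ^ n / (64 * L)))))"
proof -
  define s where "s d = 4 ^ d * exp (- (2 powr (real d / 2) / (64 * L)))" for d :: nat
  have s_nn: "s d \<ge> 0" for d by (simp add: s_def)
  have "1 / (64 * L) > 0" using L_pos by simp
  have "(\<lambda>d. 4 ^ d * exp (- (2 powr (real d / 2) * c))) \<in> O(\<lambda>d. (1/2) ^ d)" if "c > 0" for c :: real
    using that by real_asymp
  from this[OF \<open>1 / (64 * L) > 0\<close>] have "s \<in> O(\<lambda>d. (1/2) ^ d)"
    by (simp add: s_def[abs_def])
  then have s_sum: "summable s"
    by (rule summable_comparison_test_bigo[rotated]) (simp add: summable_geometric)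
  have step: "emeasure mode_law {w. block_bound n d < norm (mode_sum L (mode_block (n + d)) w)}
      \<le> ennreal (256 * (4 ^ n * exp (- (4 ^ n / (64 * L)))) * s d)" for n d
  proof -
    define X where "X = (4::real) ^ n"
    define Y where "Y = 2 powr (real d / 2)"
    have XY: "X \<ge> 1" "Y \<ge> 1" by (auto simp: X_def Y_def ge_one_powr_ge_zero)
    have "(block_bound n d)\<^sup>2 * 2 ^ (n + d) = (2 powr (real n / 2 - real d / 4)) powr 2 * 2 powr (real (n + d))"
      by (simp add: block_bound_def powr_realpow del: of_nat_add)
    also have "\<dots> = 2 powr (2 * real n + real d / 2)"
      unfolding powr_powr powr_add[symmetric] by (rule arg_cong2[where f = "(powr)"]) (auto simp: field_simps)
    also have "\<dots> = X * Y"
    proof -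
      have "2 powr (2 * real n) = (2 powr 2) powr real n" by (simp only: powr_powr)
      also have "\<dots> = 4 ^ n" by (simp add: powr_realpow)
      finally show ?thesis by (simp add: powr_add X_def Y_def)
    qed
    finally have b: "(block_bound n d)\<^sup>2 * 2 ^ (n + d) = X * Y" .
    \<comment> \<open>At the cost of a factor 2 the product in the exponent is traded for a sum,
      which separates a factor depending on \<open>n\<close> alone from one that is summable in
      \<open>d\<close>.\<close>
    have "X + Y \<le> 2 * (X * Y)"
    proof -
      have "X * 1 \<le> X * Y" "1 * Y \<le> X * Y" using XY by (intro mult_mono; simp)+
      then show ?thesis by simp
    qed
    then have "(X + Y) / (64 * L) \<le> 2 * (X * Y) / (64 * L)" using L_pos by (intro divide_right_mono) auto
    then have e: "- (X * Y / (32 * L)) \<le> - (X / (64 * L)) + - (Y / (64 * L))" by (simp add: add_divide_distrib)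
    have "emeasure mode_law {w. block_bound n d < norm (mode_sum L (mode_block (n + d)) w)}
        \<le> ennreal (256 * 4 ^ (n + d) * exp (- (X * Y / (32 * L))))"
      unfolding b[symmetric] by (rule tail_block) (simp add: block_bound_def)
    also have "\<dots> \<le> ennreal (256 * 4 ^ (n + d) * exp (- (X / (64 * L)) + - (Y / (64 * L))))"
      using e by (intro ennreal_leI mult_left_mono) auto
    also have "256 * 4 ^ (n + d) * exp (- (X / (64 * L)) + - (Y / (64 * L))) = 256 * (4 ^ n * exp (- (4 ^ n / (64 * L)))) * s d"
      unfolding exp_add by (simp add: s_def X_def Y_def power_add)
    finally show ?thesis .
  qed
  show ?thesis
  proof
    show "256 * suminf s \<ge> 0" using s_nn s_sum by (simp add: suminf_nonneg)
    fix n
    let ?a = "256 * (4 ^ n * exp (- (4 ^ n / (64 * L))))"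
    have "emeasure mode_law (bad_event n) \<le> (\<Sum>d. emeasure mode_law {w. block_bound n d < norm (mode_sum L (mode_block (n + d)) w)})"
      unfolding bad_event_def by (rule emeasure_subadditive_countably) auto
    also have "\<dots> \<le> (\<Sum>d. ennreal (?a * s d))"
      by (intro suminf_le step) auto
    also have "\<dots> = ennreal (\<Sum>d. ?a * s d)"
      using s_nn s_sum by (intro suminf_ennreal2 summable_mult) auto
    also have "(\<Sum>d. ?a * s d) = 256 * suminf s * (4 ^ n * exp (- (4 ^ n / (64 * L))))"
      using s_sum by (subst suminf_mult) auto
    finally show "emeasure mode_law (bad_event n) \<le> ennreal (256 * suminf s * (4 ^ n * exp (- (4 ^ n / (64 * L)))))" .
  qed
qed

lemma partial_field_Suc: "partial_field (Suc n) w = partial_field n w + mode_sum L (mode_block n) w"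
  unfolding partial_field_def mode_sum_def low_modes_Suc(1)
  by (rule sum.union_disjoint) (auto simp: low_modes_Suc(2))

lemma norm_partial_field_diff_le:
  assumes "a \<le> b" shows "norm (partial_field b w - partial_field a w) \<le> (\<Sum>k\<in>{a..<b}. norm (mode_sum L (mode_block k) w))"
  using assms
proof (induction b rule: dec_induct)
  case (step b)
  have e: "partial_field (Suc b) w - partial_field a w = (partial_field b w - partial_field a w) + mode_sum L (mode_block b) w"
    by (simp add: partial_field_Suc)
  show ?case unfolding e using step norm_triangle_ineq[of "partial_field b w - partial_field a w" "mode_sum L (mode_block b) w"] by simp
qed simp

text \<open>The block levels are geometric in \<open>d\<close> with ratio
  \<open>2 powr (- 1 / 4)\<close>, whose sum is the constant. One good scale controls all blocks
  from that scale on, hence implies convergence.\<close>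

lemma good_event:
  assumes w: "w \<notin> bad_event n"
  shows "convergent_modes w"
    and "norm (random_field w - partial_field n w) \<le> 2 powr (real n / 2) * (1 / (1 - 2 powr (- 1 / 4)))"
proof -
  define q :: real where "q = 2 powr (- 1 / 4)"
  have q: "0 < q" "q < 1" by (auto simp: q_def powr_less_one)
  have bb: "block_bound n d = 2 powr (real n / 2) * q ^ d" for d
  proof -
    have "q ^ d = 2 powr (- 1 / 4 * real d)" using q by (simp add: powr_realpow[symmetric] q_def powr_powr)
    then show ?thesis by (simp add: block_bound_def powr_add[symmetric])
  qed
  have bl: "norm (mode_sum L (mode_block (n + d)) w) \<le> 2 powr (real n / 2) * q ^ d" for d
    using w unfolding bad_event_def bb[symmetric] by (auto simp: not_less)
  have "summable (\<lambda>d. norm (mode_sum L (mode_block (n + d)) w))"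
    by (rule summable_comparison_test[of _ "\<lambda>d. 2 powr (real n / 2) * q ^ d"])
       (use bl q in \<open>auto intro!: summable_mult summable_geometric\<close>)
  then have "summable (\<lambda>k. norm (mode_sum L (mode_block k) w))"
    by (subst summable_iff_shift[symmetric, of _ n]) (simp add: add.commute)
  then have sC: "\<And>e. e > 0 \<Longrightarrow> \<exists>N. \<forall>a\<ge>N. \<forall>b. norm (\<Sum>k\<in>{a..<b}. norm (mode_sum L (mode_block k) w)) < e"
    unfolding summable_Cauchy by blast
  show conv: "convergent_modes w"
    unfolding convergent_modes_def
  proof (rule metric_CauchyI)
    fix e :: real assume "e > 0"
    from sC[OF this] obtain N where N: "\<And>a b. a \<ge> N \<Longrightarrow> norm (\<Sum>k\<in>{a..<b}. norm (mode_sum L (mode_block k) w)) < e" by blast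
    have *: "dist (partial_field b w) (partial_field a w) < e" if "N \<le> a" "a \<le> b" for a b
      using norm_partial_field_diff_le[OF that(2), of w] N[OF that(1), of b] unfolding dist_norm by (auto simp: sum_nonneg)
    show "\<exists>M. \<forall>a\<ge>M. \<forall>b\<ge>M. dist (partial_field a w) (partial_field b w) < e"
      using * by (metis dist_commute linorder_le_cases)
  qed
  have le: "norm (partial_field b w - partial_field n w) \<le> 2 powr (real n / 2) * (1 / (1 - q))" if "n \<le> b" for b
  proof -
    have "(\<Sum>k\<in>{n..<b}. norm (mode_sum L (mode_block k) w)) = (\<Sum>d<b - n. norm (mode_sum L (mode_block (n + d)) w))"
      using that by (intro sum.reindex_bij_witness[of _ "\<lambda>d. n + d" "\<lambda>k. k - n"]) auto
    also have "\<dots> \<le> (\<Sum>d<b - n. 2 powr (real n / 2) * q ^ d)" by (intro sum_mono bl)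
    also have "\<dots> = 2 powr (real n / 2) * (\<Sum>d<b - n. q ^ d)" by (simp add: sum_distrib_left)
    also have "(\<Sum>d<b - n. q ^ d) \<le> (\<Sum>d. q ^ d)"
      using q by (intro sum_le_suminf summable_geometric) auto
    also have "(\<Sum>d. q ^ d) = 1 / (1 - q)" using q by (intro suminf_geometric) auto
    finally show ?thesis using norm_partial_field_diff_le[OF that, of w] by (simp add: mult_left_mono)
  qed
  have "(\<lambda>b. norm (partial_field b w - partial_field n w)) \<longlonglongrightarrow> norm (random_field w - partial_field n w)"
    by (intro tendsto_intros partial_field_tendsto conv)
  then show "norm (random_field w - partial_field n w) \<le> 2 powr (real n / 2) * (1 / (1 - 2 powr (- 1 / 4)))"
    by (rule tendsto_upperbound) (use le in \<open>auto simp: q_def intro!: eventually_sequentiallyI[of n]\<close>)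
qed

text \<open>The intersection of all bad events has probability below every term of a sequence that
  tends to 0.\<close>

lemma AE_good_event: "AE w in mode_law. \<exists>n. w \<notin> bad_event n"
proof (rule AE_I)
  obtain C where C: "C \<ge> 0" "\<And>n. emeasure mode_law (bad_event n) \<le> ennreal (C * (4 ^ n * exp (- (4 ^ n / (64 * L)))))"
    using emeasure_bad_event_le by blast
  show "{w \<in> space mode_law. \<not> (\<exists>n. w \<notin> bad_event n)} \<subseteq> (\<Inter>n. bad_event n)"
    by auto
  show "(\<Inter>n. bad_event n) \<in> sets mode_law" by (auto intro!: sets.countable_INT)
  have "(\<lambda>n. 4 ^ n * exp (- (4 ^ n * c))) \<longlonglongrightarrow> 0" if "c > 0" for c :: real
    using that by real_asymp
  from this[of "1 / (64 * L)"] have "(\<lambda>n. C * (4 ^ n * exp (- (4 ^ n / (64 * L))))) \<longlonglongrightarrow> C * 0"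
    using L_pos by (intro tendsto_mult tendsto_const) simp
  then have lim: "(\<lambda>n. ennreal (C * (4 ^ n * exp (- (4 ^ n / (64 * L)))))) \<longlonglongrightarrow> ennreal 0"
    by (intro tendsto_ennrealI) simp
  have "emeasure mode_law (\<Inter>n. bad_event n) \<le> ennreal (C * (4 ^ n * exp (- (4 ^ n / (64 * L)))))" for n
    by (rule order.trans[OF emeasure_mono C(2)]) auto
  with lim have "emeasure mode_law (\<Inter>n. bad_event n) \<le> ennreal 0"
    by (intro LIMSEQ_le_const) auto
  then show "emeasure mode_law (\<Inter>n. bad_event n) = 0" by simp
qed

lemma AE_convergent_modes: "AE w in mode_law. convergent_modes w"
  using AE_good_event by eventually_elim (use good_event(1) in blast)

section \<open>Existence and uniqueness of the Gaussian measure\<close>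

lemma space_borel_Omega [simp]: "space (borel_Omega L) = Omega L"
  by (simp_all add: borel_Omega_def space_restrict_space)

lemma measurable_borel_OmegaI:
  "f \<in> borel_measurable M \<Longrightarrow> (\<And>x. x \<in> space M \<Longrightarrow> f x \<in> Omega L) \<Longrightarrow> f \<in> M \<rightarrow>\<^sub>M borel_Omega L"
  unfolding borel_Omega_def by (rule measurable_restrict_space2) auto

lemma borel_measurable_borel_OmegaI:
  "continuous_on (Omega L) f \<Longrightarrow> f \<in> borel_measurable (borel_Omega L)"
  unfolding borel_Omega_def by (rule borel_measurable_continuous_on_restrict)

lemma measurable_random_field_Omega [measurable]: "random_field \<in> mode_law \<rightarrow>\<^sub>M borel_Omega L"
  by (rule measurable_borel_OmegaI) auto

definition field_coeffs :: "(real \<Rightarrow>\<^sub>C complex) \<Rightarrow> int \<Rightarrow> complex" where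
  "field_coeffs \<phi> = (\<lambda>j. fourier_coeff L j \<phi>)"

lemma measurable_fourier_coeff [measurable]: "fourier_coeff L j \<in> borel_measurable (borel_Omega L)"
  by (intro borel_measurable_borel_OmegaI continuous_on_fourier_coeff L_pos)

text \<open>Almost surely the Fourier coefficients of the field are the coordinates of
  \<open>w\<close>, whose joint law is a product by construction.\<close>

lemma is_gaussian_random_field: "is_gaussian_measure L m 1 (distr mode_law (borel_Omega L) random_field)"
proof -
  let ?M = "distr mode_law (borel_Omega L) random_field"
  interpret M: prob_space ?M by (intro mode_law.prob_space_distr) simp
  have coeff: "distr ?M borel (fourier_coeff L j) = complex_gauss (mode_weight L m 1 j)" for j
  proof -
    have "distr ?M borel (fourier_coeff L j) = distr mode_law borel (\<lambda>w. fourier_coeff L j (random_field w))"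
      by (subst distr_distr) (auto simp: comp_def)
    also have "\<dots> = distr mode_law borel (\<lambda>w. w j)"
      using AE_convergent_modes by (intro distr_cong_AE refl) (auto simp: fourier_coeff_random_field)
    finally show ?thesis by (simp add: distr_coordinate)
  qed
  have "M.indep_vars (\<lambda>_. borel) (fourier_coeff L) UNIV"
  proof (subst M.indep_vars_iff_distr_eq_PiM)
    have mc: "(\<lambda>\<phi>. \<lambda>i\<in>UNIV. fourier_coeff L i \<phi>) \<in> borel_Omega L \<rightarrow>\<^sub>M (\<Pi>\<^sub>M i\<in>UNIV. borel)"
      by measurable
    have "distr ?M (\<Pi>\<^sub>M i\<in>UNIV. borel) (\<lambda>\<phi>. \<lambda>i\<in>UNIV. fourier_coeff L i \<phi>)
        = distr mode_law (\<Pi>\<^sub>M i\<in>UNIV. borel) (\<lambda>w. \<lambda>i\<in>UNIV. fourier_coeff L i (random_field w))"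
      by (subst distr_distr[OF mc]) (auto simp: comp_def)
    also have "\<dots> = distr mode_law (\<Pi>\<^sub>M i\<in>UNIV. borel) (\<lambda>w. w)"
    proof (intro distr_cong_AE refl)
      show "(\<lambda>w. \<lambda>i\<in>UNIV. fourier_coeff L i (random_field w)) \<in> mode_law \<rightarrow>\<^sub>M (\<Pi>\<^sub>M i\<in>UNIV. borel)"
        by measurable
      show "(\<lambda>w. w) \<in> mode_law \<rightarrow>\<^sub>M (\<Pi>\<^sub>M i\<in>UNIV. borel)"
        by (rule measurable_ident_sets) (simp add: sets_PiM_equal_borel)
      show "AE w in mode_law. (\<lambda>i\<in>UNIV. fourier_coeff L i (random_field w)) = w"
        using AE_convergent_modes by eventually_elim (auto simp: fourier_coeff_random_field)
    qed
    also have "\<dots> = mode_law" by (rule distr_id2) (simp add: sets_PiM_equal_borel)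
    also have "\<dots> = (\<Pi>\<^sub>M i\<in>UNIV. distr ?M borel (fourier_coeff L i))"
      unfolding coeff by (simp add: mode_law_def)
    finally show "distr ?M (\<Pi>\<^sub>M i\<in>UNIV. borel) (\<lambda>\<phi>. \<lambda>i\<in>UNIV. fourier_coeff L i \<phi>) = (\<Pi>\<^sub>M i\<in>UNIV. distr ?M borel (fourier_coeff L i))" .
  qed auto
  moreover have "distributed ?M lborel (fourier_coeff L j) (\<lambda>z. ennreal (mode_weight L m 1 j / (2 * pi) * exp (- mode_weight L m 1 j * (cmod z)\<^sup>2 / 2)))" for j
  proof -
    have "distr ?M lborel (fourier_coeff L j) = distr ?M borel (fourier_coeff L j)" by (rule distr_cong) auto
    then show ?thesis unfolding distributed_def coeff by (auto simp: complex_gauss_def)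
  qed
  ultimately show ?thesis unfolding is_gaussian_measure_def using M.prob_space_axioms by simp
qed

text \<open>Under any such \<open>M\<close> the coefficient sequence has law
  \<open>mode_law\<close>, so its random series converges almost surely; the sum has the same
  coefficients as \<open>\<phi>\<close> and therefore is \<open>\<phi>\<close>. Thus
  \<open>M\<close> is the image of \<open>mode_law\<close> under
  \<open>random_field\<close>.\<close>

lemma is_gaussian_measure_unique:
  assumes G: "is_gaussian_measure L m 1 M"
  shows "M = distr mode_law (borel_Omega L) random_field"
proof -
  from G have "prob_space M" and sM [measurable_cong]: "sets M = sets (borel_Omega L)"
    and ind: "prob_space.indep_vars M (\<lambda>_. borel) (fourier_coeff L) UNIV"
    and dis: "\<And>j. distributed M lborel (fourier_coeff L j) (\<lambda>z. ennreal (mode_weight L m 1 j / (2 * pi) * exp (- mode_weight L m 1 j * (cmod z)\<^sup>2 / 2)))"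
    by (auto simp: is_gaussian_measure_def)
  interpret M: prob_space M by fact
  have spM: "space M = Omega L" using sets_eq_imp_space_eq[OF sM] by simp
  have coeff: "distr M borel (fourier_coeff L j) = complex_gauss (mode_weight L m 1 j)" for j
  proof -
    have "distr M lborel (fourier_coeff L j) = complex_gauss (mode_weight L m 1 j)"
      using dis[of j] unfolding distributed_def complex_gauss_def by simp
    moreover have "distr M lborel (fourier_coeff L j) = distr M borel (fourier_coeff L j)" by (rule distr_cong) auto
    ultimately show ?thesis by simp
  qed
  have mPi: "(\<lambda>\<phi>. \<lambda>i\<in>UNIV. fourier_coeff L i \<phi>) \<in> M \<rightarrow>\<^sub>M (\<Pi>\<^sub>M i\<in>UNIV. borel)" by measurable
  have "(\<lambda>\<phi>. \<lambda>i\<in>UNIV. fourier_coeff L i \<phi>) = field_coeffs" by (simp add: field_coeffs_def fun_eq_iff)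
  with mPi have mc [measurable]: "field_coeffs \<in> M \<rightarrow>\<^sub>M mode_law"
    using measurable_cong_sets[OF refl, of "\<Pi>\<^sub>M i\<in>UNIV. borel" mode_law M] by (simp add: sets_PiM_equal_borel)
  have law: "distr M mode_law field_coeffs = mode_law"
  proof -
    have "distr M mode_law field_coeffs = distr M (\<Pi>\<^sub>M i\<in>UNIV. borel) (\<lambda>\<phi>. \<lambda>i\<in>UNIV. fourier_coeff L i \<phi>)"
      by (rule distr_cong) (auto simp: sets_PiM_equal_borel field_coeffs_def)
    also have "\<dots> = (\<Pi>\<^sub>M i\<in>UNIV. distr M borel (fourier_coeff L i))"
      using ind by (subst (asm) M.indep_vars_iff_distr_eq_PiM) auto
    also have "\<dots> = mode_law" unfolding coeff by (simp add: mode_law_def)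
    finally show ?thesis .
  qed
  have "AE \<phi> in M. convergent_modes (field_coeffs \<phi>)"
    using AE_convergent_modes by (subst (asm) law[symmetric], subst (asm) AE_distr_iff) auto
  then have "AE \<phi> in M. random_field (field_coeffs \<phi>) = \<phi>"
    using AE_space
  proof eventually_elim
    case (elim \<phi>)
    have "fourier_coeff L j (random_field (field_coeffs \<phi>)) = fourier_coeff L j \<phi>" for j
      using fourier_coeff_random_field[OF elim(1)] by (simp add: field_coeffs_def)
    then have "random_field (field_coeffs \<phi>) - \<phi> = 0"
      using elim(2) by (intro Omega_eq_0I[OF L_pos Omega_diff]) (auto simp: spM fourier_coeff_diff)
    then show ?case by simp
  qed
  then have "distr M (borel_Omega L) (random_field \<circ> field_coeffs) = distr M (borel_Omega L) (\<lambda>\<phi>. \<phi>)"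
    by (intro distr_cong_AE refl) (auto intro: measurable_ident_sets[OF sM])
  also have "\<dots> = M" by (rule distr_id2) (simp add: sM)
  finally show ?thesis
    using distr_distr[of random_field mode_law "borel_Omega L" field_coeffs M] law by simp
qed

lemma gaussian_measure_eq: "gaussian_measure L m 1 = distr mode_law (borel_Omega L) random_field"
  unfolding gaussian_measure_def
  by (rule the_equality) (rule is_gaussian_random_field, rule is_gaussian_measure_unique)

end

section \<open>Resampling single modes\<close>

lemma measurable_fun_upd_borel [measurable (raw)]:
  fixes g :: "'a \<Rightarrow> int \<Rightarrow> complex"
  assumes "g \<in> borel_measurable M" "f \<in> borel_measurable M"
  shows "(\<lambda>x. (g x)(j := f x)) \<in> borel_measurable M"
proof -
  have "(\<lambda>x. (g x)(j := f x)) \<in> M \<rightarrow>\<^sub>M (\<Pi>\<^sub>M i\<in>UNIV. borel)"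
    using assms measurable_cong_sets[OF refl sets_PiM_equal_borel[where 'a = int and 'b = complex], of M]
    by (intro measurable_fun_upd[where J = UNIV]) auto
  then show ?thesis
    using measurable_cong_sets[OF refl sets_PiM_equal_borel[where 'a = int and 'b = complex], of M] by auto
qed

context circle_field
begin

lemma distr_resample:
  "distr (complex_gauss (mode_weight L m 1 j) \<Otimes>\<^sub>M mode_law) mode_law (\<lambda>(z, w). w(j := z)) = mode_law"
  using distr_pair_PiM_eq_PiM[of UNIV "\<lambda>j. complex_gauss (mode_weight L m 1 j)" j]
  by (simp add: mode_law_def prob_space_complex_gauss mode_weight_pos)

text \<open>Tonelli with coordinate \<open>j\<close> replaced by an independent copy: this is how
  one mode is integrated out while the others are held fixed.\<close>

lemma nn_integral_resample:
  assumes [measurable]: "f \<in> borel_measurable borel"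
  shows "(\<integral>\<^sup>+w. f w \<partial>mode_law) = (\<integral>\<^sup>+w. \<integral>\<^sup>+z. f (w(j := z)) \<partial>complex_gauss (mode_weight L m 1 j) \<partial>mode_law)"
proof -
  let ?G = "complex_gauss (mode_weight L m 1 j)"
  interpret G: prob_space ?G by (rule prob_space_complex_gauss[OF mode_weight_pos])
  interpret GP: pair_prob_space ?G mode_law ..
  have upd [measurable]: "(\<lambda>p. (snd p)(j := fst p)) \<in> borel_measurable (?G \<Otimes>\<^sub>M mode_law)"
    by measurable
  have "(\<integral>\<^sup>+w. f w \<partial>mode_law) = (\<integral>\<^sup>+p. f ((snd p)(j := fst p)) \<partial>(?G \<Otimes>\<^sub>M mode_law))"
    by (subst distr_resample[of j, symmetric], subst nn_integral_distr) (auto simp: case_prod_unfold)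
  also have "\<dots> = (\<integral>\<^sup>+w. \<integral>\<^sup>+z. f (w(j := z)) \<partial>?G \<partial>mode_law)"
    by (subst GP.nn_integral_snd[symmetric]) (auto simp: case_prod_unfold)
  finally show ?thesis .
qed

text \<open>Keeps the phase of the zero mode and sets its squared modulus to \<open>t\<close>. For
  \<open>w 0 = 0\<close> there is no phase, \<open>sgn\<close> gives 0 and the modulus is lost,
  which is why the mass formula asks for \<open>w 0 \<noteq> 0\<close>.\<close>

definition radial_update :: "(int \<Rightarrow> complex) \<Rightarrow> real \<Rightarrow> (int \<Rightarrow> complex)" where
  "radial_update w t = w(0 := complex_of_real (sqrt t) * sgn (w 0))"

abbreviation "energy_law \<equiv> exp_law (mode_weight L m 1 0 / 2)"

lemma prob_space_energy_law: "prob_space energy_law"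
  by (rule prob_space_exponential_density) (use mode_weight_pos[of 0] in simp)

lemma measurable_radial_update [measurable (raw)]:
  assumes [measurable]: "g \<in> borel_measurable M" "f \<in> borel_measurable M"
  shows "(\<lambda>x. radial_update (g x) (f x)) \<in> borel_measurable M"
proof -
  have [measurable]: "(\<lambda>x. g x 0) \<in> borel_measurable M"
    by (rule measurable_compose[OF assms(1) measurable_coordinate])
  show ?thesis unfolding radial_update_def by measurable
qed

text \<open>The zero mode is resampled, split by \<open>complex_gauss_polar\<close> into modulus and
  phase, and the copy that carries the phase is merged back into \<open>mode_law\<close>.\<close>

lemma nn_integral_radial_update:
  assumes [measurable]: "f \<in> borel_measurable borel"
  shows "(\<integral>\<^sup>+w. f w \<partial>mode_law) = (\<integral>\<^sup>+w. \<integral>\<^sup>+t. f (radial_update w t) \<partial>energy_law \<partial>mode_law)"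
proof -
  let ?G = "complex_gauss (mode_weight L m 1 0)"
  interpret E: prob_space energy_law by (rule prob_space_energy_law)
  have "(\<integral>\<^sup>+w. f w \<partial>mode_law) = (\<integral>\<^sup>+w. \<integral>\<^sup>+z. f (w(0 := z)) \<partial>?G \<partial>mode_law)"
    by (rule nn_integral_resample) simp
  also have "\<dots> = (\<integral>\<^sup>+w. \<integral>\<^sup>+z. \<integral>\<^sup>+t. f (w(0 := complex_of_real (sqrt t) * sgn z)) \<partial>energy_law \<partial>?G \<partial>mode_law)"
    by (intro nn_integral_cong complex_gauss_polar[OF mode_weight_pos, of "\<lambda>z. f (_(0 := z))"]) measurable
  also have "\<dots> = (\<integral>\<^sup>+w. \<integral>\<^sup>+z. (\<lambda>w. \<integral>\<^sup>+t. f (radial_update w t) \<partial>energy_law) (w(0 := z)) \<partial>?G \<partial>mode_law)"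
    by (simp add: radial_update_def)
  also have "\<dots> = (\<integral>\<^sup>+w. \<integral>\<^sup>+t. f (radial_update w t) \<partial>energy_law \<partial>mode_law)"
    by (rule nn_integral_resample[symmetric]) measurable
  finally show ?thesis .
qed

lemma distr_radial_update:
  "distr (mode_law \<Otimes>\<^sub>M energy_law) mode_law (\<lambda>p. radial_update (fst p) (snd p)) = mode_law" (is "?D = _")
proof (rule measure_eqI)
  interpret E: prob_space energy_law by (rule prob_space_energy_law)
  fix A assume "A \<in> sets ?D"
  then have A [measurable]: "A \<in> sets borel" by simp
  have [measurable]: "(\<lambda>p. radial_update (fst p) (snd p)) \<in> borel_measurable (mode_law \<Otimes>\<^sub>M energy_law)" by measurable
  have "emeasure ?D A = (\<integral>\<^sup>+w. indicator A w \<partial>?D)" by simp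
  also have "\<dots> = (\<integral>\<^sup>+p. indicator A (radial_update (fst p) (snd p)) \<partial>(mode_law \<Otimes>\<^sub>M energy_law))"
    by (subst nn_integral_distr) auto
  also have "\<dots> = (\<integral>\<^sup>+w. \<integral>\<^sup>+t. indicator A (radial_update w t) \<partial>energy_law \<partial>mode_law)"
    by (subst E.nn_integral_fst[symmetric]) auto
  also have "\<dots> = (\<integral>\<^sup>+w. indicator A w \<partial>mode_law)" by (rule nn_integral_radial_update[symmetric]) simp
  finally show "emeasure ?D A = emeasure mode_law A" by simp
qed simp

lemma partial_field_upd:
  assumes "a \<in> low_modes n"
  shows "partial_field n (w(a := z)) = partial_field n w + mode_term L a (z - w a)"
proof -
  have "(\<Sum>j\<in>low_modes n - {a}. mode_term L j ((w(a := z)) j)) = (\<Sum>j\<in>low_modes n - {a}. mode_term L j (w j))"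
    by (rule sum.cong) auto
  then show ?thesis
    using assms unfolding partial_field_def mode_sum_def by (simp add: sum.remove[of _ a] mode_term_diff)
qed

text \<open>For all large \<open>n\<close> the partial sums change by one and the same term, so
  convergence survives and the limit is shifted by that term.\<close>

lemma random_field_upd:
  assumes "convergent_modes w"
  shows "convergent_modes (w(a := z))"
    and "random_field (w(a := z)) = random_field w + mode_term L a (z - w a)"
proof -
  have "(\<lambda>n. partial_field n w + mode_term L a (z - w a)) \<longlonglongrightarrow> random_field w + mode_term L a (z - w a)"
    by (intro tendsto_intros partial_field_tendsto assms)
  moreover have "\<forall>\<^sub>F n in sequentially. partial_field n w + mode_term L a (z - w a) = partial_field n (w(a := z))"
  proof (rule eventually_sequentiallyI[of "nat \<bar>a\<bar>"])
    fix n assume "nat \<bar>a\<bar> \<le> n"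
    then have "\<bar>a\<bar> \<le> int n" by simp
    also have "int n < 2 ^ n" using of_nat_less_two_power[of n, where 'a = int] by simp
    finally have a: "a \<in> low_modes n" by (simp add: low_modes_def)
    show "partial_field n w + mode_term L a (z - w a) = partial_field n (w(a := z))"
      by (rule partial_field_upd[OF a, symmetric])
  qed
  ultimately have "(\<lambda>n. partial_field n (w(a := z))) \<longlonglongrightarrow> random_field w + mode_term L a (z - w a)"
    by (rule Lim_transform_eventually)
  from random_field_eqI[OF this] show "convergent_modes (w(a := z))"
    and "random_field (w(a := z)) = random_field w + mode_term L a (z - w a)" .
qed

text \<open>Starting from coefficient 0 at \<open>a\<close>, the cross term of
  \<open>particle_number_add_mode\<close> vanishes.\<close>

lemma particle_number_upd:
  assumes "convergent_modes w"
  shows "particle_number L (random_field (w(a := z))) = particle_number L (random_field (w(a := 0))) + (cmod z)\<^sup>2"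
proof -
  have c: "convergent_modes (w(a := 0))" by (rule random_field_upd(1)[OF assms])
  have "random_field (w(a := z)) = random_field (w(a := 0)) + mode_term L a z"
    using random_field_upd(2)[OF c, of a z] by simp
  then show ?thesis
    using particle_number_add_mode[OF L_pos, of "random_field (w(a := 0))" a z] fourier_coeff_random_field[OF c, of a] by simp
qed

section \<open>The mass carried by the nonzero modes\<close>

definition rest_number :: "(int \<Rightarrow> complex) \<Rightarrow> real" where
  "rest_number w = particle_number L (random_field (w(0 := 0)))"

lemma measurable_particle_number_Omega [measurable]: "particle_number L \<in> borel_measurable (borel_Omega L)"
  by (intro borel_measurable_borel_OmegaI continuous_on_particle_number)

lemma measurable_particle_number [measurable]: "particle_number L \<in> borel_measurable borel"
  by (intro borel_measurable_continuous_onI continuous_on_particle_number)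

lemma measurable_rest_number [measurable]: "rest_number \<in> borel_measurable borel"
  unfolding rest_number_def[abs_def] by measurable

lemma particle_number_radial_update:
  assumes "convergent_modes w" "w 0 \<noteq> 0" "t \<ge> 0"
  shows "particle_number L (random_field (radial_update w t)) = rest_number w + t"
  unfolding radial_update_def rest_number_def
    particle_number_upd[OF assms(1), of 0 "complex_of_real (sqrt t) * sgn (w 0)"]
  using assms by (simp add: norm_mult norm_sgn)

lemma AE_mode_0_nonzero: "AE w in mode_law. w 0 \<noteq> 0"
proof -
  have "AE z in complex_gauss (mode_weight L m 1 0). z \<noteq> 0"
    using emeasure_complex_gauss_eq_0I[OF mode_weight_pos, of 0 0] by (intro AE_I[of _ _ "{0}"]) auto
  then show ?thesis
    unfolding mode_law_def by (intro AE_PiM_component prob_space_complex_gauss mode_weight_pos) auto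
qed

text \<open>When mode 1 is resampled, the remaining mass is a constant plus
  \<open>(cmod z)\<^sup>2\<close>, whose law has no atoms. The value \<open>k\<close> is singled out
  because the exponential density, evaluated at \<open>k\<close> minus the remaining mass, jumps at
  0.\<close>

lemma AE_rest_number_neq: "AE w in mode_law. rest_number w \<noteq> k"
proof -
  let ?G = "complex_gauss (mode_weight L m 1 1)"
  define B where "B = {w. convergent_modes w \<and> rest_number w = k}"
  have B [measurable]: "B \<in> sets borel" unfolding B_def by measurable
  have "emeasure mode_law B = (\<integral>\<^sup>+w. indicator B w \<partial>mode_law)" by simp
  also have "\<dots> = (\<integral>\<^sup>+w. \<integral>\<^sup>+z. indicator B (w(1 := z)) \<partial>?G \<partial>mode_law)"
    by (rule nn_integral_resample) simp
  also have "\<dots> = (\<integral>\<^sup>+w. 0 \<partial>mode_law)"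
    using AE_convergent_modes
  proof (intro nn_integral_cong_AE, eventually_elim)
    case (elim w)
    have c: "convergent_modes (w(0 := 0))" by (rule random_field_upd(1)[OF elim(2)])
    have "(\<integral>\<^sup>+z. indicator B (w(1 := z)) \<partial>?G) \<le> (\<integral>\<^sup>+z. indicator {z. (cmod z)\<^sup>2 = k - particle_number L (random_field (w(0 := 0, 1 := 0)))} z \<partial>?G)"
    proof (rule nn_integral_mono)
      fix z
      have "rest_number (w(1 := z)) = particle_number L (random_field (w(0 := 0, 1 := 0))) + (cmod z)\<^sup>2"
        unfolding rest_number_def particle_number_upd[OF c, symmetric] by (simp add: fun_upd_twist)
      then show "indicator B (w(1 := z)) \<le> (indicator {z. (cmod z)\<^sup>2 = k - particle_number L (random_field (w(0 := 0, 1 := 0)))} z :: ennreal)"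
        by (auto simp: indicator_def B_def)
    qed
    also have "\<dots> = 0"
      by (subst nn_integral_indicator) (auto simp: emeasure_complex_gauss_eq_0I[OF mode_weight_pos])
    finally show ?case by simp
  qed
  finally have "B \<in> null_sets mode_law" by (intro null_setsI) auto
  from AE_not_in[OF this] show ?thesis
    using AE_convergent_modes by eventually_elim (auto simp: B_def)
qed

section \<open>Small mass has positive probability\<close>

definition zeroed :: "int set \<Rightarrow> (int \<Rightarrow> complex) \<Rightarrow> int \<Rightarrow> complex" where
  "zeroed A w = (\<lambda>j. if j \<in> A then 0 else w j)"

lemma zeroed_insert: "zeroed (insert a A) w = (zeroed A w)(a := 0)"
  by (auto simp: zeroed_def)

lemma measurable_zeroed [measurable]: "finite A \<Longrightarrow> zeroed A \<in> borel_measurable borel"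
proof (induction A rule: finite_induct)
  case empty
  then show ?case by (simp add: zeroed_def[abs_def])
next
  case (insert a A)
  then have [measurable]: "zeroed A \<in> borel_measurable borel" by simp
  show ?case unfolding zeroed_insert[abs_def] by measurable
qed

lemma random_field_zeroed:
  assumes "convergent_modes w" "finite A"
  shows "convergent_modes (zeroed A w) \<and> random_field (zeroed A w) = random_field w - mode_sum L A w"
  using assms(2)
proof (induction A rule: finite_induct)
  case empty
  then show ?case using assms by (simp add: zeroed_def mode_sum_def)
next
  case (insert a A)
  have "mode_term L a (- w a) = - mode_term L a (w a)" by (rule bcontfun_eqI) simp
  then have "mode_term L a (0 - zeroed A w a) = - mode_term L a (w a)" using insert.hyps by (simp add: zeroed_def)
  moreover have "mode_sum L (insert a A) w = mode_term L a (w a) + mode_sum L A w"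
    using insert.hyps by (simp add: mode_sum_def)
  moreover have IH: "convergent_modes (zeroed A w)" "random_field (zeroed A w) = random_field w - mode_sum L A w"
    using insert.IH by auto
  ultimately show ?case
    unfolding zeroed_insert random_field_upd(2)[OF IH(1), of a 0]
    using random_field_upd(1)[OF IH(1), of a 0] by (metis IH(2) add.commute diff_add_eq_diff_diff_swap diff_conv_add_uminus)
qed

text \<open>The event with mode \<open>a\<close> removed does not involve coordinate
  \<open>a\<close>, so it is independent of a fresh value \<open>z\<close> with
  \<open>(cmod z)\<^sup>2 < \<kappa> - \<kappa>'\<close>. When both occur, restoring the mode keeps
  the mass below \<open>\<kappa>\<close>.\<close>

lemma small_number_insert:
  assumes "finite A" "a \<notin> A" "\<kappa>' < \<kappa>"
    and pos: "emeasure mode_law {w. convergent_modes w \<and> particle_number L (random_field (zeroed (insert a A) w)) < \<kappa>'} > 0"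
  shows "emeasure mode_law {w. convergent_modes w \<and> particle_number L (random_field (zeroed A w)) < \<kappa>} > 0"
proof -
  let ?G = "complex_gauss (mode_weight L m 1 a)"
  let ?B' = "{w. convergent_modes w \<and> particle_number L (random_field (zeroed (insert a A) w)) < \<kappa>'}"
  let ?B = "{w. convergent_modes w \<and> particle_number L (random_field (zeroed A w)) < \<kappa>}"
  have [measurable]: "zeroed A \<in> borel_measurable borel" "zeroed (insert a A) \<in> borel_measurable borel"
    using assms by (auto intro: measurable_zeroed)
  have B [measurable]: "?B \<in> sets borel" "?B' \<in> sets borel" by measurable
  have [measurable]: "{z::complex. (cmod z)\<^sup>2 < \<kappa> - \<kappa>'} \<in> sets borel" by measurable
  have "emeasure ?G {z. (cmod z)\<^sup>2 < \<kappa> - \<kappa>'} > 0"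
    using assms by (intro complex_gauss_small_ball mode_weight_pos) auto
  then have "0 < emeasure mode_law ?B' * emeasure ?G {z. (cmod z)\<^sup>2 < \<kappa> - \<kappa>'}"
    using pos by (simp add: ennreal_zero_less_mult_iff)
  also have "\<dots> = (\<integral>\<^sup>+w. indicator ?B' w * emeasure ?G {z. (cmod z)\<^sup>2 < \<kappa> - \<kappa>'} \<partial>mode_law)"
    by (subst nn_integral_multc) auto
  also have "\<dots> = (\<integral>\<^sup>+w. \<integral>\<^sup>+z. indicator ?B' w * indicator {z. (cmod z)\<^sup>2 < \<kappa> - \<kappa>'} z \<partial>?G \<partial>mode_law)"
    by (intro nn_integral_cong nn_integral_cmult_indicator[symmetric]) simp
  also have "\<dots> \<le> (\<integral>\<^sup>+w. \<integral>\<^sup>+z. indicator ?B (w(a := z)) \<partial>?G \<partial>mode_law)"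
  proof (intro nn_integral_mono)
    fix w z
    show "indicator ?B' w * indicator {z. (cmod z)\<^sup>2 < \<kappa> - \<kappa>'} z \<le> (indicator ?B (w(a := z)) :: ennreal)"
    proof (cases "w \<in> ?B' \<and> (cmod z)\<^sup>2 < \<kappa> - \<kappa>'")
      case True
      then have c: "convergent_modes w" by simp
      have z: "zeroed A (w(a := z)) = (zeroed A w)(a := z)" using assms by (auto simp: zeroed_def)
      have "particle_number L (random_field (zeroed A (w(a := z)))) = particle_number L (random_field (zeroed (insert a A) w)) + (cmod z)\<^sup>2"
        unfolding z zeroed_insert using random_field_zeroed[OF c assms(1)] by (intro particle_number_upd) auto
      then have "w(a := z) \<in> ?B" using True random_field_upd(1)[OF c] by auto
      then show ?thesis by (simp add: indicator_def)
    qed (auto simp: indicator_def)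
  qed
  also have "\<dots> = (\<integral>\<^sup>+w. indicator ?B w \<partial>mode_law)"
    by (rule nn_integral_resample[symmetric]) simp
  finally show ?thesis by simp
qed

lemma small_number_zeroed:
  assumes "finite A" "\<kappa>' < \<kappa>"
    and "emeasure mode_law {w. convergent_modes w \<and> particle_number L (random_field (zeroed A w)) < \<kappa>'} > 0"
  shows "emeasure mode_law {w. convergent_modes w \<and> particle_number L (random_field w) < \<kappa>} > 0"
  using assms
proof (induction A arbitrary: \<kappa>' rule: finite_induct)
  case empty
  have "zeroed {} w = w" for w by (simp add: zeroed_def)
  then have "0 < emeasure mode_law {w. convergent_modes w \<and> particle_number L (random_field w) < \<kappa>'}" using empty by simp
  also have "\<dots> \<le> emeasure mode_law {w. convergent_modes w \<and> particle_number L (random_field w) < \<kappa>}"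
    using empty by (intro emeasure_mono) auto
  finally show ?case .
next
  case (insert a A)
  \<comment> \<open>The gap between the levels is divided, so that every restored mode has some
    slack to use.\<close>
  obtain \<kappa>'' where k: "\<kappa>' < \<kappa>''" "\<kappa>'' < \<kappa>" using dense[OF insert.prems(1)] by blast
  show ?case
    by (rule insert.IH[OF k(2)]) (rule small_number_insert[OF insert.hyps(1,2) k(1) insert.prems(2)])
qed

text \<open>Since the series converges, the mass of its tail tends to 0 almost surely, so some tail
  has mass below \<open>k / 2\<close> with positive probability; the finitely many low modes are
  then restored. This makes the normalising constant positive.\<close>

lemma rest_number_small_pos:
  assumes "k > 0" shows "emeasure mode_law {w. rest_number w < k} > 0"
proof -
  have "\<exists>n. emeasure mode_law {w. convergent_modes w \<and> particle_number L (random_field (zeroed (low_modes n) w)) < k / 2} > 0"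
  proof (rule ccontr)
    assume "\<not> ?thesis"
    then have z: "emeasure mode_law {w. convergent_modes w \<and> particle_number L (random_field (zeroed (low_modes n) w)) < k / 2} = 0" for n
      by (simp add: zero_less_iff_neq_zero)
    have [measurable]: "zeroed (low_modes n) \<in> borel_measurable borel" for n by (rule measurable_zeroed) simp
    have "AE w in mode_law. w \<notin> {w. convergent_modes w \<and> particle_number L (random_field (zeroed (low_modes n) w)) < k / 2}" for n
      by (intro AE_not_in null_setsI z) measurable
    then have "AE w in mode_law. \<forall>n. w \<notin> {w. convergent_modes w \<and> particle_number L (random_field (zeroed (low_modes n) w)) < k / 2}"
      unfolding AE_all_countable by blast
    then have "AE w in mode_law. False"
      using AE_convergent_modes
    proof eventually_elim
      case (elim w)
      have z: "random_field (zeroed (low_modes n) w) = random_field w - partial_field n w" for n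
        using random_field_zeroed[OF elim(2) finite_low_modes, of n] by (simp add: partial_field_def)
      have "(\<lambda>n. particle_number L (random_field w - partial_field n w)) \<longlonglongrightarrow> particle_number L (random_field w - random_field w)"
        by (rule continuous_on_tendsto_compose[OF continuous_on_particle_number[of UNIV L] tendsto_diff[OF tendsto_const partial_field_tendsto[OF elim(2)]]]) auto
      then have "(\<lambda>n. particle_number L (random_field w - partial_field n w)) \<longlonglongrightarrow> 0" by simp
      from order_tendstoD(2)[OF this, of "k / 2"] assms obtain n where "particle_number L (random_field w - partial_field n w) < k / 2"
        by (auto simp: eventually_sequentially)
      then show False using elim z by auto
    qed
    then show False using mode_law.AE_False by simp
  qed
  then obtain n where "emeasure mode_law {w. convergent_modes w \<and> particle_number L (random_field (zeroed (low_modes n) w)) < k / 2} > 0" ..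
  from small_number_zeroed[OF finite_low_modes _ this, of k] assms
  have "0 < emeasure mode_law {w. convergent_modes w \<and> particle_number L (random_field w) < k}" by simp
  also have "\<dots> \<le> emeasure mode_law {w. rest_number w < k}"
  proof (rule emeasure_mono)
    show "{w. convergent_modes w \<and> particle_number L (random_field w) < k} \<subseteq> {w. rest_number w < k}"
    proof safe
      fix w assume w: "convergent_modes w" "particle_number L (random_field w) < k"
      have "particle_number L (random_field w) = rest_number w + (cmod (w 0))\<^sup>2"
        using particle_number_upd[OF w(1), of 0 "w 0"] by (simp add: rest_number_def)
      then show "rest_number w < k" using w(2) zero_le_power2[of "cmod (w 0)"] by linarith
    qed
  qed measurable
  finally show ?thesis .
qed

end

section \<open>The conditioned measure\<close>

lemma exponential_density_le:
  assumes "l > 0" shows "exponential_density l x \<le> l"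
proof (cases "x < 0")
  case False
  then have "- x * l \<le> 0" using assms by (simp add: mult_nonneg_nonneg)
  then have "l * exp (- x * l) \<le> l * 1" using assms by (intro mult_left_mono) auto
  with False show ?thesis by (simp add: exponential_density_def)
qed (use assms in \<open>simp add: exponential_density_def\<close>)

text \<open>Indicators of closed sets are limits of bounded continuous functions, and closed sets
  are an intersection-stable generator. This makes the \<open>THE\<close> in
  \<open>conditioned_measure\<close> well defined.\<close>

lemma weak_limit_unique:
  assumes M: "prob_space M" "sets M = sets (borel_Omega L)" and N: "prob_space N" "sets N = sets (borel_Omega L)"
    and eq: "\<And>f :: (real \<Rightarrow>\<^sub>C complex) \<Rightarrow> real. continuous_on (Omega L) f \<Longrightarrow> bounded (f ` Omega L) \<Longrightarrow> (\<integral>x. f x \<partial>M) = (\<integral>x. f x \<partial>N)"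
  shows "M = N"
proof -
  have sp: "space M = Omega L" "space N = Omega L"
    using sets_eq_imp_space_eq[OF M(2)] sets_eq_imp_space_eq[OF N(2)] by (auto simp: borel_Omega_def space_restrict_space)
  have [measurable]: "Omega L \<in> sets borel" using closed_Omega by (rule borel_closed)
  have sub: "A \<inter> Omega L \<in> sets (borel_Omega L)" if "A \<in> sets borel" for A
    using that by (auto simp: borel_Omega_def sets_restrict_space)
  have closed_eq: "measure M (C \<inter> Omega L) = measure N (C \<inter> Omega L)" if C: "closed C" for C
  proof (cases "C = {}")
    case False
    \<comment> \<open>Continuous, with values between 0 and 1, and decreasing in \<open>n\<close> to
      the indicator of \<open>C\<close>.\<close>
    define f where "f n x = max 0 (1 - real n * infdist x C)" for n :: nat and x
    have f_cont: "continuous_on S (f n)" for S n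
      unfolding f_def by (intro continuous_intros)
    have f_bd: "0 \<le> f n x" "f n x \<le> 1" for n x
      by (auto simp: f_def infdist_nonneg)
    have f_lim: "(\<lambda>n. f n x) \<longlonglongrightarrow> indicator C x" for x
    proof (cases "x \<in> C")
      case True
      then show ?thesis by (simp add: f_def)
    next
      case False
      then have "infdist x C > 0"
        using in_closed_iff_infdist_zero[OF C \<open>C \<noteq> {}\<close>, of x] infdist_nonneg[of x C] by linarith
      then obtain n where n: "1 < real n * infdist x C" using reals_Archimedean3 by blast
      have "f k x = 0" if "k \<ge> n" for k
      proof -
        have "real n * infdist x C \<le> real k * infdist x C" using that by (intro mult_right_mono infdist_nonneg) auto
        then show ?thesis using n by (simp add: f_def)
      qed
      then have "(\<lambda>n. f n x) \<longlonglongrightarrow> 0" by (intro tendsto_eventually eventually_sequentiallyI)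
      then show ?thesis using False by simp
    qed
    have lim: "(\<lambda>n. \<integral>x. f n x \<partial>P) \<longlonglongrightarrow> measure P (C \<inter> Omega L)"
      if P: "prob_space P" "sets P = sets (borel_Omega L)" "space P = Omega L" for P
    proof -
      interpret prob_space P by fact
      have m: "f n \<in> borel_measurable P" for n
        using borel_measurable_continuous_on_restrict[OF f_cont[of "Omega L" n]]
        by (simp add: measurable_cong_sets[OF P(2) refl] borel_Omega_def)
      have ind: "(\<lambda>x. indicator C x :: real) \<in> borel_measurable P"
        by (rule borel_measurable_LIMSEQ_metric[OF m f_lim])
      have "(\<lambda>n. \<integral>x. f n x \<partial>P) \<longlonglongrightarrow> (\<integral>x. indicator C x \<partial>P)"
        by (rule integral_dominated_convergence[where w = "\<lambda>_. 1"])
           (use m ind f_lim f_bd in auto)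
      also have "(\<integral>x. indicator C x \<partial>P) = (\<integral>x. indicator (C \<inter> Omega L) x \<partial>P)"
        by (rule Bochner_Integration.integral_cong) (auto simp: P indicator_def)
      also have "\<dots> = measure P (C \<inter> Omega L)"
        using sub[OF borel_closed[OF C]] by (subst Bochner_Integration.integral_indicator) (auto simp: P Int_absorb2 Int_assoc)
      finally show ?thesis .
    qed
    have "(\<integral>x. f n x \<partial>M) = (\<integral>x. f n x \<partial>N)" for n
      by (intro eq f_cont boundedI[where B = 1]) (use f_bd in auto)
    with lim[OF M sp(1)] lim[OF N sp(2)] show ?thesis using LIMSEQ_unique by fastforce
  qed simp
  interpret M: prob_space M by fact
  interpret N: prob_space N by fact
  have idM: "(\<lambda>x. x) \<in> borel_measurable M" and idN: "(\<lambda>x. x) \<in> borel_measurable N"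
    unfolding measurable_cong_sets[OF M(2) refl] measurable_cong_sets[OF N(2) refl] borel_Omega_def
    by (auto intro: measurable_restrict_space1)
  \<comment> \<open>Both measures live on the trace sigma-algebra of \<open>Omega L\<close>; pushed
    to the whole space they can be compared on the closed sets that generate
    \<open>borel\<close>.\<close>
  have "distr M borel (\<lambda>x. x) = distr N borel (\<lambda>x. x)"
  proof (rule measure_eqI_generator_eq[where E = "Collect closed" and \<Omega> = UNIV and A = "\<lambda>_. UNIV"])
    show "Int_stable (Collect closed)" by (auto simp: Int_stable_def)
    show "sets (distr M borel (\<lambda>x. x)) = sigma_sets UNIV (Collect closed)"
      "sets (distr N borel (\<lambda>x. x)) = sigma_sets UNIV (Collect closed)"
      by (simp_all only: sets_distr) (simp_all only: borel_eq_closed sets_measure_of_conv subset_UNIV Pow_UNIV if_True)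
    show "emeasure (distr M borel (\<lambda>x. x)) X = emeasure (distr N borel (\<lambda>x. x)) X" if "X \<in> Collect closed" for X
      using that closed_eq[of X] idM idN
      by (simp add: emeasure_distr borel_closed sp M.emeasure_eq_measure N.emeasure_eq_measure)
    show "emeasure (distr M borel (\<lambda>x. x)) UNIV \<noteq> \<infinity>"
      using idM by (subst emeasure_distr) auto
  qed auto
  then have e: "emeasure (distr M borel (\<lambda>x. x)) A = emeasure (distr N borel (\<lambda>x. x)) A" for A by simp
  show ?thesis
  proof (rule measure_eqI)
    fix A assume "A \<in> sets M"
    then obtain B where B: "B \<in> sets borel" "A = Omega L \<inter> B"
      by (auto simp: M(2) borel_Omega_def sets_restrict_space)
    with e[of B] idM idN show "emeasure M A = emeasure N A"
      by (simp add: emeasure_distr sp Int_commute)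
  qed (simp add: M N)
qed

context circle_field
begin

context
  fixes k :: real assumes k_pos: "k > 0"
begin

text \<open>The zero mode is rescaled, phase kept, so as to bring the total mass to
  \<open>k\<close>. This is possible when the remaining mass is below \<open>k\<close>; beyond
  \<open>k\<close> the weight \<open>shell_density\<close> is 0.\<close>

definition shell_field :: "(int \<Rightarrow> complex) \<Rightarrow> (real \<Rightarrow>\<^sub>C complex)" where
  "shell_field w = random_field (radial_update w (k - rest_number w))"

text \<open>The conditional density of the particle number at \<open>k\<close> given the nonzero
  modes, that is, the density of the squared modulus of mode 0 at the mass still missing.\<close>

definition shell_density :: "(int \<Rightarrow> complex) \<Rightarrow> real" where
  "shell_density w = exponential_density (mode_weight L m 1 0 / 2) (k - rest_number w)"

lemma half_weight_pos: "mode_weight L m 1 0 / 2 > 0"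
  using mode_weight_pos[of 0] by simp

lemma shell_density_nonneg: "0 \<le> shell_density w"
  and shell_density_le: "shell_density w \<le> mode_weight L m 1 0 / 2"
  unfolding shell_density_def
  by (rule exponential_density_nonneg[OF half_weight_pos], rule exponential_density_le[OF half_weight_pos])

lemma measurable_shell_density [measurable]: "shell_density \<in> borel_measurable borel"
  unfolding shell_density_def[abs_def] by measurable

lemma measurable_shell_field [measurable]: "shell_field \<in> borel_measurable borel"
  unfolding shell_field_def[abs_def] by measurable

lemma measurable_shell_field_Omega [measurable]: "shell_field \<in> mode_law \<rightarrow>\<^sub>M borel_Omega L"
  by (rule measurable_borel_OmegaI) (auto simp: shell_field_def)

lemma integrable_shell_density: "integrable mode_law shell_density"
proof (rule mode_law.integrable_const_bound[where B = "mode_weight L m 1 0 / 2"])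
  show "AE w in mode_law. norm (shell_density w) \<le> mode_weight L m 1 0 / 2"
    unfolding real_norm_def abs_of_nonneg[OF shell_density_nonneg] by (intro AE_I2 shell_density_le)
qed measurable

text \<open>Otherwise the density would vanish almost surely, although the remaining mass is below
  \<open>k\<close> with positive probability.\<close>

lemma integral_shell_density_pos: "(\<integral>w. shell_density w \<partial>mode_law) > 0"
proof (rule ccontr)
  assume "\<not> ?thesis"
  then have "(\<integral>w. shell_density w \<partial>mode_law) = 0"
    using Bochner_Integration.integral_nonneg[of mode_law shell_density, OF shell_density_nonneg] by linarith
  then have "AE w in mode_law. shell_density w = 0"
    using integrable_shell_density by (subst (asm) integral_nonneg_eq_0_iff_AE) (auto simp: shell_density_nonneg)
  then have "AE w in mode_law. w \<notin> {w. rest_number w < k}"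
    by eventually_elim (use half_weight_pos in \<open>auto simp: shell_density_def exponential_density_def split: if_splits\<close>)
  then have "emeasure mode_law {w. rest_number w < k} = 0"
    by (subst (asm) AE_iff_measurable[OF _ refl]) auto
  then show False using rest_number_small_pos[OF k_pos] by simp
qed

lemma continuous_random_field_radial:
  assumes "convergent_modes w" shows "continuous_on S (\<lambda>t. random_field (radial_update w t))"
  unfolding radial_update_def random_field_upd(2)[OF assms]
  by (intro continuous_intros L_pos)

text \<open>With the nonzero modes and the phase fixed, the integral over the squared modulus
  \<open>t\<close> pairs the Fejer kernel at \<open>k - rest_number w - t\<close> with the
  exponential density times \<open>f\<close>: an approximate identity. Its uniform bound lets
  dominated convergence carry the limit through the outer integral.\<close>

lemma tilted_integral_tendsto:
  assumes f: "continuous_on (Omega L) f" and B: "\<And>\<phi>. \<phi> \<in> Omega L \<Longrightarrow> \<bar>f \<phi>\<bar> \<le> B"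
  shows "(\<lambda>l. \<integral>\<phi>. fejer_kernel l (k - particle_number L \<phi>) * f \<phi> \<partial>gaussian_measure L m 1)
     \<longlonglongrightarrow> 2 * pi * (\<integral>w. shell_density w * f (shell_field w) \<partial>mode_law)"
proof -
  interpret E: prob_space energy_law by (rule prob_space_energy_law)
  interpret PE: pair_prob_space mode_law energy_law ..
  let ?\<theta> = "mode_weight L m 1 0 / 2"
  have B0: "B \<ge> 0" using B[of 0] by (auto intro: order.trans[OF abs_ge_zero])
  have fm [measurable]: "f \<in> borel_measurable (borel_Omega L)" by (rule borel_measurable_borel_OmegaI[OF f])
  have frm [measurable]: "(\<lambda>w. f (random_field w)) \<in> borel_measurable borel"
  proof -
    have "(\<lambda>w. f (random_field w)) \<in> borel_measurable mode_law" by measurable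
    then show ?thesis by (simp add: measurable_cong_sets[OF sets_mode_law refl])
  qed
  define g where "g l w = fejer_kernel l (k - particle_number L (random_field w)) * f (random_field w)" for l w
  have gm [measurable]: "g l \<in> borel_measurable borel" for l unfolding g_def[abs_def] by measurable
  have g_bd: "\<bar>g l w\<bar> \<le> real l * B" for l w
    unfolding g_def abs_mult using fejer_kernel_le[of l] fejer_kernel_nonneg[of l] B[of "random_field w"] by (intro mult_mono) auto
  define I where "I l w = (\<integral>t. g l (radial_update w t) \<partial>energy_law)" for l w
  have eq1: "(\<integral>\<phi>. fejer_kernel l (k - particle_number L \<phi>) * f \<phi> \<partial>gaussian_measure L m 1) = (\<integral>w. I l w \<partial>mode_law)" for l
  proof -
    have "(\<integral>\<phi>. fejer_kernel l (k - particle_number L \<phi>) * f \<phi> \<partial>gaussian_measure L m 1) = (\<integral>w. g l w \<partial>mode_law)"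
      unfolding gaussian_measure_eq g_def by (rule integral_distr) measurable
    also have "\<dots> = (\<integral>w. g l w \<partial>distr (mode_law \<Otimes>\<^sub>M energy_law) mode_law (\<lambda>p. radial_update (fst p) (snd p)))"
      by (simp only: distr_radial_update)
    also have "\<dots> = (\<integral>p. g l (radial_update (fst p) (snd p)) \<partial>(mode_law \<Otimes>\<^sub>M energy_law))"
      by (rule integral_distr) measurable
    also have "\<dots> = (\<integral>p. (\<lambda>(w, t). g l (radial_update w t)) p \<partial>(mode_law \<Otimes>\<^sub>M energy_law))"
      by (simp add: case_prod_unfold)
    also have "\<dots> = (\<integral>w. \<integral>t. (\<lambda>(w, t). g l (radial_update w t)) (w, t) \<partial>energy_law \<partial>mode_law)"
    proof (rule PE.integral_fst'[symmetric])
      show "integrable (mode_law \<Otimes>\<^sub>M energy_law) (\<lambda>(w, t). g l (radial_update w t))"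
        by (rule PE.integrable_const_bound[where B = "real l * B"]) (auto simp: g_bd case_prod_unfold)
    qed
    also have "\<dots> = (\<integral>w. I l w \<partial>mode_law)" by (simp add: I_def)
    finally show ?thesis .
  qed
  have fejer: "(\<lambda>l. I l w) \<longlonglongrightarrow> (2 * pi) * (shell_density w * f (shell_field w)) \<and> (\<forall>l. \<bar>I l w\<bar> \<le> 2 * pi * (?\<theta> * B))"
    if w: "convergent_modes w" "w 0 \<noteq> 0" "rest_number w \<noteq> k" for w
  proof -
    define G where "G t = exponential_density ?\<theta> t * f (random_field (radial_update w t))" for t
    have fc: "continuous_on S (\<lambda>t. f (random_field (radial_update w t)))" for S
      by (rule continuous_on_compose2[OF f continuous_random_field_radial[OF w(1)]]) auto
    have [measurable]: "(\<lambda>t. f (random_field (radial_update w t))) \<in> borel_measurable borel"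
      by (rule borel_measurable_continuous_onI[OF fc])
    have Gm: "G \<in> borel_measurable borel" unfolding G_def by measurable
    have G_bd: "norm (G t) \<le> ?\<theta> * B" for t
    proof -
      have "\<bar>exponential_density ?\<theta> t\<bar> \<le> ?\<theta>"
        using exponential_density_le[OF half_weight_pos] exponential_density_nonneg[OF half_weight_pos] by (simp only: abs_of_nonneg)
      then show ?thesis unfolding G_def real_norm_def abs_mult using B half_weight_pos by (intro mult_mono) auto
    qed
    \<comment> \<open>The only possible discontinuity of \<open>G\<close> is the jump of the
      exponential density at 0, and \<open>rest_number w \<noteq> k\<close> stays away from
      it.\<close>
    have G_cont: "isCont G (k - rest_number w)"
    proof (cases "k - rest_number w > 0")
      case True
      have "continuous_on {0<..} (\<lambda>t. (?\<theta> * exp (- t * ?\<theta>)) * f (random_field (radial_update w t)))"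
        by (intro continuous_intros fc)
      then have "continuous_on {0<..} G"
        by (rule continuous_on_eq) (simp add: G_def exponential_density_def)
      then show ?thesis using True by (simp add: continuous_on_eq_continuous_at)
    next
      case False
      then have neg: "k - rest_number w < 0" using w by auto
      have "continuous_on {..<0} (\<lambda>t. 0 :: real)" by (rule continuous_on_const)
      then have "continuous_on {..<0} G"
        by (rule continuous_on_eq) (simp add: G_def exponential_density_def)
      then show ?thesis using neg by (simp add: continuous_on_eq_continuous_at)
    qed
    have I_eq: "I l w = (\<integral>t. fejer_kernel l ((k - rest_number w) - t) *\<^sub>R G t \<partial>lborel)" for l
    proof -
      have [measurable]: "(\<lambda>t. g l (radial_update w t)) \<in> borel_measurable borel" by measurable
      have "I l w = (\<integral>t. exponential_density ?\<theta> t *\<^sub>R g l (radial_update w t) \<partial>lborel)"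
        unfolding I_def by (rule integral_density) (use half_weight_pos in \<open>auto intro!: AE_I2 exponential_density_nonneg\<close>)
      also have "\<dots> = (\<integral>t. fejer_kernel l ((k - rest_number w) - t) *\<^sub>R G t \<partial>lborel)"
      proof (rule Bochner_Integration.integral_cong[OF refl])
        fix t
        \<comment> \<open>The mass formula for the updated field holds for \<open>t \<ge> 0\<close>;
          for negative \<open>t\<close> both sides are 0 because the exponential density
          vanishes.\<close>
        show "exponential_density ?\<theta> t *\<^sub>R g l (radial_update w t) = fejer_kernel l ((k - rest_number w) - t) *\<^sub>R G t"
          using particle_number_radial_update[OF w(1,2), of t]
          by (cases "t < 0") (auto simp: g_def G_def exponential_density_def algebra_simps)
      qed
      finally show ?thesis .
    qed
    have "G (k - rest_number w) = shell_density w * f (shell_field w)"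
      by (simp add: G_def shell_density_def shell_field_def)
    then show ?thesis
      unfolding I_eq using fejer_approx_identity[OF Gm G_bd G_cont] by simp
  qed
  have AEw: "AE w in mode_law. convergent_modes w \<and> w 0 \<noteq> 0 \<and> rest_number w \<noteq> k"
    using AE_convergent_modes AE_mode_0_nonzero AE_rest_number_neq by eventually_elim auto
  have "(\<lambda>l. \<integral>w. I l w \<partial>mode_law) \<longlonglongrightarrow> (\<integral>w. (2 * pi) * (shell_density w * f (shell_field w)) \<partial>mode_law)"
  proof (rule integral_dominated_convergence[where w = "\<lambda>_. 2 * pi * (?\<theta> * B)"])
    show "(\<lambda>w. 2 * pi * (shell_density w * f (shell_field w))) \<in> borel_measurable mode_law" by measurable
    show "I l \<in> borel_measurable mode_law" for l unfolding I_def[abs_def] by measurable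
    show "AE w in mode_law. (\<lambda>l. I l w) \<longlonglongrightarrow> 2 * pi * (shell_density w * f (shell_field w))"
      using AEw by eventually_elim (use fejer in auto)
    show "AE w in mode_law. norm (I l w) \<le> 2 * pi * (?\<theta> * B)" for l
      using AEw by eventually_elim (use fejer in auto)
  qed simp
  then show ?thesis unfolding eq1 by simp
qed

section \<open>The conditioned measure as an explicit image\<close>

definition shell_measure :: "(real \<Rightarrow>\<^sub>C complex) measure" where
  "shell_measure = distr (density mode_law (\<lambda>w. ennreal (shell_density w / (\<integral>w. shell_density w \<partial>mode_law)))) (borel_Omega L) shell_field"

lemma integral_shell_measure:
  fixes f :: "(real \<Rightarrow>\<^sub>C complex) \<Rightarrow> real"
  assumes [measurable]: "f \<in> borel_measurable (borel_Omega L)"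
  shows "(\<integral>\<phi>. f \<phi> \<partial>shell_measure) = (\<integral>w. shell_density w * f (shell_field w) \<partial>mode_law) / (\<integral>w. shell_density w \<partial>mode_law)"
proof -
  let ?C = "\<integral>w. shell_density w \<partial>mode_law"
  have "(\<integral>\<phi>. f \<phi> \<partial>shell_measure) = (\<integral>w. f (shell_field w) \<partial>density mode_law (\<lambda>w. ennreal (shell_density w / ?C)))"
    unfolding shell_measure_def by (rule integral_distr) measurable
  also have "\<dots> = (\<integral>w. (shell_density w / ?C) *\<^sub>R f (shell_field w) \<partial>mode_law)"
    by (rule integral_density) (use integral_shell_density_pos shell_density_nonneg in auto)
  also have "\<dots> = (\<integral>w. shell_density w * f (shell_field w) \<partial>mode_law) / ?C"
    by simp
  finally show ?thesis .
qed

lemma prob_space_shell_measure: "prob_space shell_measure"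
  unfolding shell_measure_def
proof (rule prob_space.prob_space_distr)
  let ?C = "\<integral>w. shell_density w \<partial>mode_law"
  show "prob_space (density mode_law (\<lambda>w. ennreal (shell_density w / ?C)))"
  proof
    have "emeasure (density mode_law (\<lambda>w. ennreal (shell_density w / ?C))) UNIV = (\<integral>\<^sup>+w. ennreal (shell_density w / ?C) \<partial>mode_law)"
      by (subst emeasure_density) auto
    also have "\<dots> = ennreal (\<integral>w. shell_density w / ?C \<partial>mode_law)"
      using integral_shell_density_pos shell_density_nonneg integrable_shell_density by (intro nn_integral_eq_integral) auto
    also have "(\<integral>w. shell_density w / ?C \<partial>mode_law) = 1" using integral_shell_density_pos by simp
    finally show "emeasure (density mode_law (\<lambda>w. ennreal (shell_density w / ?C))) (space (density mode_law (\<lambda>w. ennreal (shell_density w / ?C)))) = 1"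
      by simp
  qed
qed measurable

lemma sets_shell_measure [simp]: "sets shell_measure = sets (borel_Omega L)"
  by (simp add: shell_measure_def)

text \<open>Numerator and denominator of a tilted expectation both converge by
  \<open>tilted_integral_tendsto\<close>, the latter with \<open>f\<close> constantly 1, and the
  factor \<open>2 * pi\<close> cancels.\<close>

lemma is_conditioned_shell_measure: "is_conditioned_measure L m k 1 shell_measure"
  unfolding is_conditioned_measure_def weakly_converges_on_def
proof (intro conjI allI impI)
  fix f :: "(real \<Rightarrow>\<^sub>C complex) \<Rightarrow> real"
  assume f: "continuous_on (Omega L) f \<and> bounded (f ` Omega L)"
  let ?\<mu> = "gaussian_measure L m 1" and ?C = "\<integral>w. shell_density w \<partial>mode_law"
  have fm: "f \<in> borel_measurable (borel_Omega L)" using f by (intro borel_measurable_borel_OmegaI) auto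
  obtain B where B: "\<And>\<phi>. \<phi> \<in> Omega L \<Longrightarrow> \<bar>f \<phi>\<bar> \<le> B" using f by (auto simp: bounded_iff)
  have s\<mu>: "sets ?\<mu> = sets (borel_Omega L)" by (simp add: gaussian_measure_eq)
  have fm' [measurable]: "f \<in> borel_measurable ?\<mu>" using fm by (simp add: measurable_cong_sets[OF s\<mu> refl])
  have Nm [measurable]: "particle_number L \<in> borel_measurable ?\<mu>"
    using measurable_particle_number_Omega by (simp add: measurable_cong_sets[OF s\<mu> refl])
  have lim1: "(\<lambda>l. \<integral>\<phi>. fejer_kernel l (k - particle_number L \<phi>) * f \<phi> \<partial>?\<mu>)
      \<longlonglongrightarrow> 2 * pi * (\<integral>w. shell_density w * f (shell_field w) \<partial>mode_law)"
    using f B by (intro tilted_integral_tendsto) auto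
  have lim2: "(\<lambda>l. \<integral>\<phi>. fejer_kernel l (k - particle_number L \<phi>) \<partial>?\<mu>) \<longlonglongrightarrow> 2 * pi * ?C"
    using tilted_integral_tendsto[of "\<lambda>_. 1" 1] by simp
  have "(\<integral>\<phi>. f \<phi> \<partial>tilted_measure L m k 1 l)
     = (\<integral>\<phi>. fejer_kernel l (k - particle_number L \<phi>) * f \<phi> \<partial>?\<mu>) / (\<integral>\<phi>. fejer_kernel l (k - particle_number L \<phi>) \<partial>?\<mu>)" for l
  proof -
    let ?Z = "\<integral>\<phi>. fejer_kernel l (k - particle_number L \<phi>) \<partial>?\<mu>"
    \<comment> \<open>Nonnegativity is enough: if \<open>?Z = 0\<close>, the tilted measure is the
      zero measure and both sides vanish, since division by zero gives 0.\<close>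
    have "?Z \<ge> 0" by (intro Bochner_Integration.integral_nonneg fejer_kernel_nonneg)
    then have "(\<integral>\<phi>. f \<phi> \<partial>tilted_measure L m k 1 l) = (\<integral>\<phi>. (fejer_kernel l (k - particle_number L \<phi>) / ?Z) *\<^sub>R f \<phi> \<partial>?\<mu>)"
      unfolding tilted_measure_def Let_def by (intro integral_density) (auto simp: fejer_kernel_nonneg)
    then show ?thesis by simp
  qed
  moreover have "(\<lambda>l. (\<integral>\<phi>. fejer_kernel l (k - particle_number L \<phi>) * f \<phi> \<partial>?\<mu>) / (\<integral>\<phi>. fejer_kernel l (k - particle_number L \<phi>) \<partial>?\<mu>))
     \<longlonglongrightarrow> (2 * pi * (\<integral>w. shell_density w * f (shell_field w) \<partial>mode_law)) / (2 * pi * ?C)"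
    using integral_shell_density_pos by (intro tendsto_divide lim1 lim2) auto
  moreover have "(2 * pi * (\<integral>w. shell_density w * f (shell_field w) \<partial>mode_law)) / (2 * pi * ?C) = (\<integral>\<phi>. f \<phi> \<partial>shell_measure)"
    by (simp add: integral_shell_measure[OF fm])
  ultimately show "(\<lambda>l. \<integral>\<phi>. f \<phi> \<partial>tilted_measure L m k 1 l) \<longlonglongrightarrow> (\<integral>\<phi>. f \<phi> \<partial>shell_measure)"
    by simp
qed (auto simp: prob_space_shell_measure)

lemma conditioned_measure_eq: "conditioned_measure L m k 1 = shell_measure"
  unfolding conditioned_measure_def
proof (rule the_equality)
  show "is_conditioned_measure L m k 1 shell_measure" by (rule is_conditioned_shell_measure)
next
  fix N assume N: "is_conditioned_measure L m k 1 N"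
  show "N = shell_measure"
  proof (rule weak_limit_unique[of N L shell_measure])
    fix f :: "(real \<Rightarrow>\<^sub>C complex) \<Rightarrow> real"
    assume "continuous_on (Omega L) f" "bounded (f ` Omega L)"
    then show "(\<integral>x. f x \<partial>N) = (\<integral>x. f x \<partial>shell_measure)"
      using N is_conditioned_shell_measure LIMSEQ_unique unfolding is_conditioned_measure_def weakly_converges_on_def by blast
  qed (use N prob_space_shell_measure in \<open>auto simp: is_conditioned_measure_def\<close>)
qed

end

end

section \<open>Exponential moments\<close>

text \<open>As \<open>r < 4\<close>, the exponent \<open>M * r ^ Suc n\<close> is eventually below
  half of \<open>c * 4 ^ n\<close>; the other half of the decay makes the terms summable.\<close>

lemma summable_gaussian_vs_power:
  fixes M r c :: real
  assumes r: "0 < r" "r < 4" and c: "c > 0"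
  shows "summable (\<lambda>n. exp (M * r ^ Suc n) * (4 ^ n * exp (- (4 ^ n * c))))"
proof (rule summable_comparison_test_ev)
  have "(\<lambda>n. 4 ^ n * exp (- (4 ^ n * d))) \<in> O(\<lambda>n. (1/2) ^ n)" if "d > 0" for d :: real
    using that by real_asymp
  from this[of "c / 2"] c have "(\<lambda>n. 4 ^ n * exp (- (4 ^ n * (c / 2)))) \<in> O(\<lambda>n. (1/2) ^ n)" by simp
  then show "summable (\<lambda>n. 4 ^ n * exp (- (4 ^ n * (c / 2))))"
    by (rule summable_comparison_test_bigo[rotated]) (simp add: summable_geometric)
  have "(\<lambda>n. M * r * (r / 4) ^ n) \<longlonglongrightarrow> M * r * 0"
    using r by (intro tendsto_mult tendsto_const LIMSEQ_power_zero) auto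
  then have "\<forall>\<^sub>F n in sequentially. M * r * (r / 4) ^ n < c / 2"
    using c by (intro order_tendstoD(2)) auto
  then show "\<forall>\<^sub>F n in sequentially. norm (exp (M * r ^ Suc n) * (4 ^ n * exp (- (4 ^ n * c)))) \<le> 4 ^ n * exp (- (4 ^ n * (c / 2)))"
  proof eventually_elim
    case (elim n)
    have "M * r ^ Suc n = (M * r * (r / 4) ^ n) * 4 ^ n" by (simp add: power_divide)
    also have "\<dots> \<le> (c / 2) * 4 ^ n" using elim by (intro mult_right_mono) auto
    also have "\<dots> = 4 ^ n * c - 4 ^ n * (c / 2)" by (simp add: mult.commute)
    finally have "M * r ^ Suc n + - (4 ^ n * c) \<le> - (4 ^ n * (c / 2))" by linarith
    then have "exp (M * r ^ Suc n + - (4 ^ n * c)) \<le> exp (- (4 ^ n * (c / 2)))" by simp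
    then have "exp (M * r ^ Suc n) * exp (- (4 ^ n * c)) \<le> exp (- (4 ^ n * (c / 2)))" by (simp only: exp_add)
    then have "4 ^ n * (exp (M * r ^ Suc n) * exp (- (4 ^ n * c))) \<le> 4 ^ n * exp (- (4 ^ n * (c / 2)))"
      by (rule mult_left_mono) simp
    then show ?case by (simp add: mult_ac)
  qed
qed

lemma borel_measurable_power_integral: "q > 0 \<Longrightarrow> power_integral L q \<in> borel_measurable (borel_Omega L)"
  unfolding borel_Omega_def by (intro borel_measurable_continuous_on_restrict continuous_on_power_integral)

context circle_field
begin

text \<open>Below scale \<open>n\<close>, Bessel's inequality with mass \<open>k\<close> and
  Cauchy-Schwarz over at most \<open>2 ^ Suc n\<close> modes bound the sum of the moduli of the
  coefficients. Beyond it the shell field agrees with the unconditioned one, because only mode 0 was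
  changed, so \<open>good_event\<close> for \<open>w\<close> itself applies.\<close>

lemma norm_shell_field_le:
  assumes k: "k > 0" and w: "w \<notin> bad_event n" "w 0 \<noteq> 0" "rest_number w < k"
  shows "norm (shell_field k w) \<le> (sqrt (2 * k / L) + 1 / (1 - 2 powr (- 1 / 4))) * 2 powr (real n / 2)"
    and "particle_number L (shell_field k w) = k"
proof -
  have conv: "convergent_modes w" by (rule good_event(1)[OF w(1)])
  define v where "v = radial_update w (k - rest_number w)"
  have v: "v = w(0 := v 0)" by (auto simp: v_def radial_update_def)
  have vc: "convergent_modes v" using random_field_upd(1)[OF conv, of 0 "v 0"] v by simp
  have \<psi>: "shell_field k w = random_field v" by (simp add: shell_field_def[OF k] v_def)
  show N: "particle_number L (shell_field k w) = k"
    using particle_number_radial_update[OF conv w(2), of "k - rest_number w"] w(3) by (simp add: \<psi> v_def)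
  have "0 \<in> low_modes n" by (simp add: low_modes_def)
  then have "random_field v - partial_field n v = random_field w - partial_field n w"
    using random_field_upd(2)[OF conv, of 0 "v 0"] partial_field_upd[of 0 n w "v 0"] v by (metis add_diff_cancel_right)
  then have high: "norm (random_field v - partial_field n v) \<le> 2 powr (real n / 2) * (1 / (1 - 2 powr (- 1 / 4)))"
    using good_event(2)[OF w(1)] by simp
  have "norm (partial_field n v) \<le> (\<Sum>j\<in>low_modes n. cmod (v j) / sqrt L)"
    unfolding partial_field_def mode_sum_def
    by (rule order.trans[OF norm_sum]) (intro sum_mono norm_mode_term_le L_pos)
  also have "\<dots> = (\<Sum>j\<in>low_modes n. cmod (v j) * 1) / sqrt L" by (simp add: sum_divide_distrib)
  also have "(\<Sum>j\<in>low_modes n. cmod (v j) * 1) \<le> sqrt (k * 2 ^ Suc n)"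
  proof (rule real_le_rsqrt)
    have "(\<Sum>j\<in>low_modes n. cmod (v j) * 1)\<^sup>2 \<le> (\<Sum>j\<in>low_modes n. (cmod (v j))\<^sup>2) * (\<Sum>j\<in>low_modes n. 1\<^sup>2)"
      by (rule Cauchy_Schwarz_ineq_sum)
    also have "(\<Sum>j\<in>low_modes n. (cmod (v j))\<^sup>2) \<le> k"
      using bessel_inequality[OF L_pos, of "random_field v" "low_modes n"] N by (simp add: fourier_coeff_random_field[OF vc] \<psi>)
    also have "(\<Sum>j\<in>low_modes n. 1\<^sup>2) = real (card (low_modes n))" by simp
    also have "real (card (low_modes n)) \<le> real (2 ^ Suc n)"
      using card_low_modes[of n] by (simp only: of_nat_le_iff)
    finally show "(\<Sum>j\<in>low_modes n. cmod (v j) * 1)\<^sup>2 \<le> k * 2 ^ Suc n" using k by (simp add: mult_left_mono mult_right_mono)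
  qed
  also have "sqrt (k * 2 ^ Suc n) / sqrt L = sqrt (2 * k / L) * 2 powr (real n / 2)"
  proof -
    have "2 powr (real n / 2) = sqrt (2 ^ n)"
      by (simp add: powr_half_sqrt[symmetric] powr_realpow[symmetric] powr_powr)
    then show ?thesis by (simp add: real_sqrt_mult real_sqrt_divide)
  qed
  finally have low: "norm (partial_field n v) \<le> sqrt (2 * k / L) * 2 powr (real n / 2)"
    using L_pos by (simp add: divide_right_mono)
  have "norm (random_field v) \<le> norm (partial_field n v) + norm (random_field v - partial_field n v)"
    by (rule norm_triangle_sub)
  also have "\<dots> \<le> sqrt (2 * k / L) * 2 powr (real n / 2) + 2 powr (real n / 2) * (1 / (1 - 2 powr (- 1 / 4)))"
    by (rule add_mono[OF low high])
  finally show "norm (shell_field k w) \<le> (sqrt (2 * k / L) + 1 / (1 - 2 powr (- 1 / 4))) * 2 powr (real n / 2)"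
    by (simp add: \<psi> algebra_simps)
qed

lemma integrable_exp_power_integral:
  assumes k: "k > 0" and p: "2 < p" "p < 6" and a: "a \<ge> 0"
  shows "integrable (conditioned_measure L m k 1) (\<lambda>\<psi>. exp (a * power_integral L p \<psi>))"
proof -
  let ?\<nu> = "shell_measure k" and ?C = "\<integral>w. shell_density k w \<partial>mode_law"
  define K where "K = sqrt (2 * k / L) + 1 / (1 - 2 powr (- 1 / 4 :: real))"
  \<comment> \<open>The growth per scale of the sup norm to the power \<open>p - 2\<close>; the
    assumption \<open>p < 6\<close> enters as \<open>r < 4\<close>.\<close>
  define r where "r = 2 powr ((p - 2) / 2)"
  have "(2::real) powr (- 1 / 4) < 1" by (simp add: powr_less_one)
  then have K: "K \<ge> 0" using k L_pos by (auto simp: K_def intro!: add_nonneg_nonneg)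
  have "r < 2 powr 2" unfolding r_def using p by (intro powr_less_mono) auto
  then have r: "0 < r" "r < 4" by (auto simp: r_def)
  define M where "M = a * (K powr (p - 2) * k)"
  have bound: "exp (a * power_integral L p (shell_field k w)) \<le> exp (M * r ^ n)"
    if w: "w \<notin> bad_event n" "w 0 \<noteq> 0" "rest_number w < k" for n w
  proof -
    have "power_integral L p (shell_field k w) \<le> norm (shell_field k w) powr (p - 2) * k"
      using power_integral_le[of p L "shell_field k w"] p norm_shell_field_le(2)[OF k w] by simp
    also have "\<dots> \<le> (K * 2 powr (real n / 2)) powr (p - 2) * k"
      using norm_shell_field_le(1)[OF k w] p k unfolding K_def[symmetric] by (intro mult_right_mono powr_mono2) auto
    also have "\<dots> = K powr (p - 2) * k * r ^ n"
    proof -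
      have "(2 powr (real n / 2)) powr (p - 2) = (2 powr ((p - 2) / 2)) powr real n"
        unfolding powr_powr by (simp add: field_simps)
      also have "\<dots> = r ^ n" by (simp add: r_def powr_realpow)
      finally show ?thesis using K by (simp add: powr_mult)
    qed
    finally have "a * power_integral L p (shell_field k w) \<le> a * (K powr (p - 2) * k * r ^ n)"
      using a by (rule mult_left_mono)
    then show ?thesis by (simp add: M_def mult.assoc)
  qed
  obtain C where C: "C \<ge> 0" "\<And>n. emeasure mode_law (bad_event n) \<le> ennreal (C * (4 ^ n * exp (- (4 ^ n / (64 * L)))))"
    using emeasure_bad_event_le by blast
  define s where "s n = exp (M * r ^ Suc n) * (4 ^ n * exp (- (4 ^ n * (1 / (64 * L)))))" for n
  have s: "summable s" "\<And>n. s n \<ge> 0"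
    using summable_gaussian_vs_power[OF r, of "1 / (64 * L)" M] L_pos by (auto simp: s_def[abs_def])
  \<comment> \<open>on the first good scale \<open>n + 1\<close> the weight is at most \<open>exp (M * r ^ Suc n)\<close>, and scale \<open>n\<close> is bad\<close>
  define X where "X w = ennreal (exp M) + (\<Sum>n. ennreal (exp (M * r ^ Suc n)) * indicator (bad_event n) w)" for w
  have X: "ennreal (exp (a * power_integral L p (shell_field k w))) \<le> X w"
    if w: "\<exists>n. w \<notin> bad_event n" "w 0 \<noteq> 0" "rest_number w < k" for w
  proof -
    define n where "n = (LEAST n. w \<notin> bad_event n)"
    have n: "w \<notin> bad_event n" unfolding n_def using w(1) by (rule LeastI_ex)
    show ?thesis
    proof (cases n)
      case 0
      then show ?thesis using bound[OF n w(2,3)] unfolding X_def by (intro add_increasing2) (auto intro!: ennreal_leI)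
    next
      case (Suc i)
      then have "w \<in> bad_event i" using not_less_Least[of i "\<lambda>n. w \<notin> bad_event n"] unfolding n_def[symmetric] by auto
      then have "ennreal (exp (M * r ^ Suc i)) = (\<Sum>n\<in>{i}. ennreal (exp (M * r ^ Suc n)) * indicator (bad_event n) w)" by simp
      also have "\<dots> \<le> (\<Sum>n. ennreal (exp (M * r ^ Suc n)) * indicator (bad_event n) w)"
        by (intro sum_le_suminf) auto
      finally have "ennreal (exp (M * r ^ Suc i)) \<le> X w" unfolding X_def by (intro add_increasing) auto
      then show ?thesis using bound[OF n w(2,3)] Suc by (auto intro: order.trans[OF ennreal_leI])
    qed
  qed
  have [measurable]: "power_integral L p \<in> borel_measurable (borel_Omega L)"
    using p by (intro borel_measurable_power_integral) auto
  note [measurable] = measurable_shell_field_Omega[OF k] measurable_shell_density[OF k]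
  have "(\<integral>\<^sup>+\<psi>. ennreal (exp (a * power_integral L p \<psi>)) \<partial>?\<nu>)
     = (\<integral>\<^sup>+w. ennreal (exp (a * power_integral L p (shell_field k w))) \<partial>density mode_law (\<lambda>w. ennreal (shell_density k w / ?C)))"
    unfolding shell_measure_def[OF k] by (rule nn_integral_distr) measurable
  also have "\<dots> = (\<integral>\<^sup>+w. ennreal (shell_density k w / ?C) * ennreal (exp (a * power_integral L p (shell_field k w))) \<partial>mode_law)"
    by (rule nn_integral_density) measurable
  also have "\<dots> \<le> (\<integral>\<^sup>+w. ennreal (mode_weight L m 1 0 / 2 / ?C) * X w \<partial>mode_law)"
    using AE_good_event AE_mode_0_nonzero AE_rest_number_neq[of k]
  proof (intro nn_integral_mono_AE, eventually_elim)
    case (elim w)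
    show ?case
    proof (cases "rest_number w < k")
      case True
      then show ?thesis
        using X elim shell_density_le[OF k, of w] integral_shell_density_pos[OF k]
        by (intro mult_mono ennreal_leI divide_right_mono) auto
    next
      \<comment> \<open>Where the nonzero modes already carry more than \<open>k\<close> the weight
        is 0, so the pointwise estimate is needed only below \<open>k\<close>.\<close>
      case False
      then show ?thesis using elim by (simp add: shell_density_def[OF k] exponential_density_def)
    qed
  qed
  also have "\<dots> = ennreal (mode_weight L m 1 0 / 2 / ?C) * (\<integral>\<^sup>+w. X w \<partial>mode_law)"
    by (rule nn_integral_cmult) (simp add: X_def[abs_def])
  also have "\<dots> < \<infinity>"
  proof -
    have "(\<integral>\<^sup>+w. X w \<partial>mode_law) = ennreal (exp M) + (\<Sum>n. ennreal (exp (M * r ^ Suc n)) * emeasure mode_law (bad_event n))"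
      unfolding X_def by (subst nn_integral_add) (auto simp: nn_integral_suminf nn_integral_cmult_indicator mode_law.emeasure_space_1[simplified])
    also have "\<dots> \<le> ennreal (exp M) + (\<Sum>n. ennreal (C * s n))"
    proof (intro add_left_mono suminf_le)
      fix n
      have "ennreal (exp (M * r ^ Suc n)) * emeasure mode_law (bad_event n)
          \<le> ennreal (exp (M * r ^ Suc n)) * ennreal (C * (4 ^ n * exp (- (4 ^ n / (64 * L)))))"
        by (intro mult_left_mono C(2)) auto
      also have "\<dots> = ennreal (C * s n)"
        using C(1) by (subst ennreal_mult[symmetric]) (auto simp: s_def mult_ac)
      finally show "ennreal (exp (M * r ^ Suc n)) * emeasure mode_law (bad_event n) \<le> ennreal (C * s n)" .
    qed auto
    also have "\<dots> = ennreal (exp M) + ennreal (\<Sum>n. C * s n)"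
      using C(1) s by (subst suminf_ennreal2) (auto intro: summable_mult)
    also have "\<dots> < \<infinity>" by simp
    finally show ?thesis by (simp add: ennreal_mult_less_top)
  qed
  finally have fin: "(\<integral>\<^sup>+\<psi>. ennreal (exp (a * power_integral L p \<psi>)) \<partial>?\<nu>) < \<infinity>" .
  have "integrable ?\<nu> (\<lambda>\<psi>. exp (a * power_integral L p \<psi>))"
  proof (rule integrableI_bounded)
    show "(\<lambda>\<psi>. exp (a * power_integral L p \<psi>)) \<in> borel_measurable ?\<nu>"
      unfolding measurable_cong_sets[OF sets_shell_measure[OF k] refl] by measurable
  qed (use fin in simp)
  then show ?thesis by (simp add: conditioned_measure_eq[OF k])
qed

end

section \<open>Analyticity\<close>

text \<open>The partial sums of the exponential series are dominated by
  \<open>exp (cmod c * X x)\<close>, which is integrable. Integration term by term then gives a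
  power series in \<open>c\<close> that converges everywhere.\<close>

lemma holomorphic_mgf:
  fixes X :: "'a \<Rightarrow> real"
  assumes M: "prob_space M" and [measurable]: "X \<in> borel_measurable M" and nn: "\<And>x. 0 \<le> X x"
    and int: "\<And>a. a \<ge> 0 \<Longrightarrow> integrable M (\<lambda>x. exp (a * X x))"
  shows "integrable M (\<lambda>x. exp (c * complex_of_real (X x)))"
    and "(\<lambda>c. \<integral>x. exp (c * complex_of_real (X x)) \<partial>M) holomorphic_on UNIV"
proof -
  interpret prob_space M by fact
  have sumbnd: "(\<Sum>i\<in>I. (a * X x) ^ i / fact i) \<le> exp (a * X x)" if "a \<ge> 0" "finite I" for a x I
  proof -
    have "(\<lambda>n. (a * X x) ^ n / fact n) sums exp (a * X x)"
      using exp_converges[of "a * X x"] by (simp add: divide_inverse mult.commute)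
    then have s: "summable (\<lambda>n. (a * X x) ^ n / fact n)" "(\<Sum>n. (a * X x) ^ n / fact n) = exp (a * X x)"
      by (auto simp: sums_iff)
    have "(\<Sum>i\<in>I. (a * X x) ^ i / fact i) \<le> (\<Sum>n. (a * X x) ^ n / fact n)"
      using that nn by (intro sum_le_suminf s) auto
    then show ?thesis by (simp add: s)
  qed
  have bnd: "(a * X x) ^ n / fact n \<le> exp (a * X x)" if "a \<ge> 0" for a x n
    using sumbnd[OF that, of "{n}" x] by simp
  have intn: "integrable M (\<lambda>x. (a * X x) ^ n / fact n)" if "a \<ge> 0" for a n
    by (rule Bochner_Integration.integrable_bound[OF int[OF that]]) (use bnd[OF that] nn that in auto)
  show "integrable M (\<lambda>x. exp (c * complex_of_real (X x)))"
  proof (rule Bochner_Integration.integrable_bound[OF int[of "cmod c"]])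
    have "Re c * X x \<le> cmod c * X x" for x using nn complex_Re_le_cmod by (intro mult_right_mono) auto
    then show "AE x in M. norm (exp (c * complex_of_real (X x))) \<le> norm (exp (cmod c * X x))"
      by (simp add: norm_exp_eq_Re)
  qed auto
  define f where "f = (\<lambda>c. \<integral>x. exp (c * complex_of_real (X x)) \<partial>M)"
  have sums: "(\<lambda>n. (\<integral>x. complex_of_real (X x) ^ n / fact n \<partial>M) * c ^ n) sums f c" for c
  proof -
    have ni: "norm ((c * complex_of_real (X x)) ^ n / fact n) = (cmod c * X x) ^ n / fact n" for n x
      using nn by (simp add: norm_divide norm_power norm_mult)
    have "(\<lambda>n. \<integral>x. (c * complex_of_real (X x)) ^ n / fact n \<partial>M) sums (\<integral>x. (\<Sum>n. (c * complex_of_real (X x)) ^ n / fact n) \<partial>M)"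
    proof (rule sums_integral)
      show "integrable M (\<lambda>x. (c * complex_of_real (X x)) ^ n / fact n)" for n
        by (rule Bochner_Integration.integrable_bound[OF intn[of "cmod c" n]]) (auto simp: ni intro!: AE_I2 divide_right_mono)
      show "AE x in M. summable (\<lambda>n. norm ((c * complex_of_real (X x)) ^ n / fact n))"
        unfolding ni using summable_exp[of "cmod c * X _"] by (simp add: divide_inverse mult.commute)
      show "summable (\<lambda>n. \<integral>x. norm ((c * complex_of_real (X x)) ^ n / fact n) \<partial>M)"
        unfolding ni
      proof (rule summableI_nonneg_bounded)
        show "0 \<le> (\<integral>x. (cmod c * X x) ^ n / fact n \<partial>M)" for n
          using nn by (intro Bochner_Integration.integral_nonneg) auto
        fix n
        have "(\<Sum>i<n. \<integral>x. (cmod c * X x) ^ i / fact i \<partial>M) = (\<integral>x. (\<Sum>i<n. (cmod c * X x) ^ i / fact i) \<partial>M)"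
          by (rule Bochner_Integration.integral_sum[symmetric]) (rule intn, simp)
        also have "\<dots> \<le> (\<integral>x. exp (cmod c * X x) \<partial>M)"
          by (rule integral_mono) (auto intro!: Bochner_Integration.integrable_sum intn int sumbnd)
        finally show "(\<Sum>i<n. \<integral>x. (cmod c * X x) ^ i / fact i \<partial>M) \<le> (\<integral>x. exp (cmod c * X x) \<partial>M)" .
      qed
    qed
    moreover have "(\<integral>x. (c * complex_of_real (X x)) ^ n / fact n \<partial>M) = (\<integral>x. complex_of_real (X x) ^ n / fact n \<partial>M) * c ^ n" for n
      by (subst Bochner_Integration.integral_mult_left_zero[symmetric]) (simp add: power_mult_distrib mult_ac)
    moreover have "(\<Sum>n. (c * complex_of_real (X x)) ^ n / fact n) = exp (c * complex_of_real (X x))" for x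
      using exp_converges[of "c * complex_of_real (X x)"]
      by (simp add: sums_iff scaleR_conv_of_real divide_inverse mult.commute)
    ultimately show ?thesis by (simp add: f_def)
  qed
  have hol: "f holomorphic_on ball 0 r" for r
    by (rule power_series_holomorphic[where a = "\<lambda>n. \<integral>x. complex_of_real (X x) ^ n / fact n \<partial>M"]) (use sums in simp)
  have "f field_differentiable (at c)" for c
    by (rule holomorphic_on_imp_differentiable_at[OF hol[of "cmod c + 1"]]) auto
  then show "(\<lambda>c. \<integral>x. exp (c * complex_of_real (X x)) \<partial>M) holomorphic_on UNIV"
    unfolding f_def[symmetric] by (auto simp: holomorphic_on_def)
qed

text \<open>Expand first in \<open>w\<close>: the Taylor coefficients are holomorphic in \<open>z\<close>, and the Cauchy
  inequalities in both variables bound the resulting double series by a geometric one.\<close>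

lemma double_power_series_compose_mult:
  fixes H \<gamma> :: "complex \<Rightarrow> complex"
  assumes H: "H holomorphic_on S" "open S" and \<gamma>: "\<gamma> holomorphic_on U" "open U" and ab: "a \<in> U" "\<gamma> a * b \<in> S"
  shows "\<exists>r>0. \<exists>c :: nat \<Rightarrow> nat \<Rightarrow> complex. \<forall>z w. cmod (z - a) < r \<and> cmod (w - b) < r \<longrightarrow>
     ((\<lambda>(i, j). c i j * (z - a) ^ i * (w - b) ^ j) has_sum H (\<gamma> z * w)) UNIV"
proof -
  \<comment> \<open>The open set on which the composition makes sense; a closed bidisc of radius
    \<open>s\<close> around \<open>(a, b)\<close> is fitted into it.\<close>
  define W where "W = {x \<in> U \<times> UNIV. \<gamma> (fst x) * snd x \<in> S}"
  have \<gamma>_cont: "continuous_on (U \<times> UNIV) (\<lambda>x. \<gamma> (fst x) * snd x)"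
    by (intro continuous_intros continuous_on_compose2[OF holomorphic_on_imp_continuous_on[OF \<gamma>(1)]]) auto
  have "W = (U \<times> UNIV) \<inter> (\<lambda>x. \<gamma> (fst x) * snd x) -` S" by (auto simp: W_def)
  then have "open W" using continuous_open_preimage[OF \<gamma>_cont _ H(2)] \<gamma>(2) by (auto intro: open_Times)
  moreover have "(a, b) \<in> W" using ab by (auto simp: W_def)
  ultimately obtain A B where AB: "open A" "open B" "a \<in> A" "b \<in> B" "A \<times> B \<subseteq> W"
    by (rule open_prod_elim) auto
  obtain s1 where s1: "s1 > 0" "cball a s1 \<subseteq> A" using AB open_contains_cball by blast
  obtain s2 where s2: "s2 > 0" "cball b s2 \<subseteq> B" using AB open_contains_cball by blast
  define s where "s = min s1 s2"
  have s: "s > 0" "cball a s \<subseteq> A" "cball b s \<subseteq> B"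
    using s1 s2 by (auto simp: s_def)
  have inS: "z \<in> U \<and> \<gamma> z * w \<in> S" if "z \<in> cball a s" "w \<in> cball b s" for z w
  proof -
    have "(z, w) \<in> W" using that s AB(5) by blast
    then show ?thesis by (auto simp: W_def)
  qed
  obtain C where C: "\<And>z w. z \<in> cball a s \<Longrightarrow> w \<in> cball b s \<Longrightarrow> cmod (H (\<gamma> z * w)) \<le> C"
  proof -
    have "continuous_on (cball a s \<times> cball b s) (\<lambda>x. H (\<gamma> (fst x) * snd x))"
    proof (rule continuous_on_compose2[OF holomorphic_on_imp_continuous_on[OF H(1)]])
      show "continuous_on (cball a s \<times> cball b s) (\<lambda>x. \<gamma> (fst x) * snd x)"
        using inS[of _ b] s(1) by (intro continuous_on_subset[OF \<gamma>_cont]) auto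
    qed (use inS in auto)
    then have "compact ((\<lambda>x. H (\<gamma> (fst x) * snd x)) ` (cball a s \<times> cball b s))"
      by (rule compact_continuous_image) (intro compact_Times compact_cball)
    from compact_imp_bounded[OF this] obtain C where "\<And>x. x \<in> cball a s \<times> cball b s \<Longrightarrow> cmod (H (\<gamma> (fst x) * snd x)) \<le> C"
      unfolding bounded_iff by blast
    then show ?thesis using that[of C] by force
  qed
  \<comment> \<open>The \<open>j\<close>-th Taylor coefficient at \<open>b\<close> in the variable
    \<open>w\<close>. In this form, given by the chain rule, it is visibly holomorphic in
    \<open>z\<close>.\<close>
  define g where "g j z = \<gamma> z ^ j * (deriv ^^ j) H (\<gamma> z * b) / fact j" for j z
  have inner_hol: "(\<lambda>w. H (\<gamma> z * w)) holomorphic_on (\<lambda>w. \<gamma> z * w) -` S" for z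
    by (rule holomorphic_on_compose_gen[OF _ H(1), unfolded comp_def]) (auto intro!: holomorphic_intros)
  have g_eq: "g j z = (deriv ^^ j) (\<lambda>w. H (\<gamma> z * w)) b / fact j" if "z \<in> cball a s" for j z
    unfolding g_def
    by (subst higher_deriv_compose_linear[OF H(1) _ H(2), of "(\<lambda>w. \<gamma> z * w) -` S"])
       (use inS[OF that, of b] s(1) H(2) in \<open>auto intro!: open_vimage continuous_intros\<close>)
  have g_bd: "cmod (g j z) \<le> C / s ^ j" if z: "z \<in> cball a s" for j z
  proof -
    have sub: "cball b s \<subseteq> (\<lambda>w. \<gamma> z * w) -` S" using inS[OF z] by auto
    have "cmod ((deriv ^^ j) (\<lambda>w. H (\<gamma> z * w)) b) \<le> fact j * C / s ^ j"
    proof (rule Cauchy_inequality[OF _ _ s(1)])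
      show "(\<lambda>w. H (\<gamma> z * w)) holomorphic_on ball b s"
        using sub by (intro holomorphic_on_subset[OF inner_hol]) auto
      show "continuous_on (cball b s) (\<lambda>w. H (\<gamma> z * w))"
        using sub by (intro holomorphic_on_imp_continuous_on holomorphic_on_subset[OF inner_hol]) auto
      show "cmod (H (\<gamma> z * x)) \<le> C" if "cmod (b - x) = s" for x
        using that by (intro C z) (auto simp: dist_norm)
    qed
    then show ?thesis unfolding g_eq[OF z] by (simp add: norm_divide field_simps)
  qed
  have g_sums: "(\<lambda>j. g j z * (w - b) ^ j) sums H (\<gamma> z * w)" if z: "z \<in> ball a s" and w: "w \<in> ball b s" for z w
  proof -
    have z': "z \<in> cball a s" using z by auto
    have "(\<lambda>w. H (\<gamma> z * w)) holomorphic_on ball b s"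
      using inS[OF z'] by (intro holomorphic_on_subset[OF inner_hol]) auto
    from holomorphic_power_series[OF this w] show ?thesis by (simp add: g_eq[OF z'])
  qed
  define V where "V = U \<inter> (\<lambda>z. \<gamma> z * b) -` S"
  have "open V"
    unfolding V_def using \<gamma> H(2) by (intro continuous_open_preimage continuous_intros holomorphic_on_imp_continuous_on) auto
  have subV: "cball a s \<subseteq> V" using inS[of _ b] s(1) by (auto simp: V_def)
  have g_hol: "g j holomorphic_on V" for j
  proof -
    have "(\<lambda>z. (deriv ^^ j) H (\<gamma> z * b)) holomorphic_on V"
      by (rule holomorphic_on_compose_gen[OF _ holomorphic_higher_deriv[OF H], unfolded comp_def])
         (auto simp: V_def intro!: holomorphic_intros holomorphic_on_subset[OF \<gamma>(1)])
    then show ?thesis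
      unfolding g_def[abs_def] by (intro holomorphic_intros holomorphic_on_subset[OF \<gamma>(1)]) (auto simp: V_def)
  qed
  define c where "c i j = (deriv ^^ i) (g j) a / fact i" for i j
  have c_bd: "cmod (c i j) \<le> C / s ^ j / s ^ i" for i j
  proof -
    have "cmod ((deriv ^^ i) (g j) a) \<le> fact i * (C / s ^ j) / s ^ i"
    proof (rule Cauchy_inequality[OF _ _ s(1)])
      show "g j holomorphic_on ball a s" using subV by (intro holomorphic_on_subset[OF g_hol]) auto
      show "continuous_on (cball a s) (g j)" using subV by (intro holomorphic_on_imp_continuous_on holomorphic_on_subset[OF g_hol])
      show "cmod (g j x) \<le> C / s ^ j" if "cmod (a - x) = s" for x using that by (intro g_bd) (auto simp: dist_norm)
    qed
    then show ?thesis unfolding c_def by (simp add: norm_divide field_simps)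
  qed
  have c_sums: "(\<lambda>i. c i j * (z - a) ^ i) sums g j z" if "z \<in> ball a s" for j z
    unfolding c_def using subV by (intro holomorphic_power_series[OF _ that] holomorphic_on_subset[OF g_hol]) auto
  show ?thesis
  proof (intro exI[of _ s] conjI s(1) exI[of _ c] allI impI, elim conjE)
    fix z w assume zw: "cmod (z - a) < s" "cmod (w - b) < s"
    define x y where "x = cmod (z - a) / s" and "y = cmod (w - b) / s"
    have xy: "0 \<le> x" "x < 1" "0 \<le> y" "y < 1" using zw s(1) by (auto simp: x_def y_def)
    have z: "z \<in> ball a s" and w: "w \<in> ball b s" using zw by (auto simp: dist_norm norm_minus_commute)
    have C0: "C \<ge> 0" using C[of a b] s(1) by (auto intro: order.trans[OF norm_ge_zero])
    define t where "t i j = c i j * (z - a) ^ i * (w - b) ^ j" for i j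
    have t_bd: "cmod (t i j) \<le> C * x ^ i * y ^ j" for i j
    proof -
      have "cmod (t i j) \<le> (C / s ^ j / s ^ i) * cmod (z - a) ^ i * cmod (w - b) ^ j"
        unfolding t_def norm_mult norm_power by (intro mult_right_mono c_bd) auto
      also have "\<dots> = C * x ^ i * y ^ j" by (simp add: x_def y_def power_divide)
      finally show ?thesis .
    qed
    have sx: "summable (\<lambda>i. K * x ^ i)" and sy: "summable (\<lambda>i. K * y ^ i)" for K
      using xy by (auto intro!: summable_mult summable_geometric)
    have so: "((\<lambda>j. K * y ^ j) has_sum (K * (1 / (1 - y)))) UNIV" for K
    proof (rule norm_summable_imp_has_sum)
      show "summable (\<lambda>n. norm (K * y ^ n))"
        using xy sy[of "\<bar>K\<bar>"] by (simp add: abs_mult)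
      show "(\<lambda>j. K * y ^ j) sums (K * (1 / (1 - y)))"
        using xy by (intro sums_mult geometric_sums) auto
    qed
    \<comment> \<open>A product of two geometric series, absolutely summable over pairs; it
      dominates \<open>t\<close> and licenses the exchange of the two summations.\<close>
    have "(\<lambda>ij. norm (case ij of (i, j) \<Rightarrow> C * x ^ i * y ^ j)) summable_on UNIV \<times> UNIV"
      unfolding Infinite_Sum.abs_summable_on_Sigma_iff
    proof (intro conjI ballI)
      fix i
      have "(\<lambda>j. C * x ^ i * y ^ j) summable_on UNIV" using so has_sum_imp_summable by blast
      then show "(\<lambda>j. norm (case (i, j) of (i, j) \<Rightarrow> C * x ^ i * y ^ j)) summable_on UNIV"
        using C0 xy by (simp add: abs_mult)
    next
      have "infsum (\<lambda>j. norm (case (i, j) of (i, j) \<Rightarrow> C * x ^ i * y ^ j)) UNIV = C * (1 / (1 - y)) * x ^ i" for i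
        using infsumI[OF so[of "C * x ^ i"]] C0 xy by (simp add: abs_mult mult_ac)
      moreover have "(\<lambda>i. norm (C * (1 / (1 - y)) * x ^ i)) summable_on UNIV"
        using sx[of "C * (1 / (1 - y))"] C0 xy by (subst summable_on_UNIV_nonneg_real_iff) (auto simp: abs_mult)
      ultimately show "(\<lambda>i. norm (infsum (\<lambda>j. norm (case (i, j) of (i, j) \<Rightarrow> C * x ^ i * y ^ j)) UNIV)) summable_on UNIV"
        by presburger
    qed
    then have "(\<lambda>ij. norm (case ij of (i, j) \<Rightarrow> t i j)) summable_on UNIV \<times> UNIV"
    proof (rule Infinite_Sum.abs_summable_on_comparison_test)
      fix ij :: "nat \<times> nat"
      show "norm (case ij of (i, j) \<Rightarrow> t i j) \<le> norm (case ij of (i, j) \<Rightarrow> C * x ^ i * y ^ j)"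
        using t_bd[of "fst ij" "snd ij"] by (auto simp: case_prod_unfold)
    qed
    then have ts: "(\<lambda>(i, j). t i j) summable_on UNIV \<times> UNIV" by (rule Infinite_Sum.abs_summable_summable)
    have inner: "infsum (\<lambda>i. t i j) UNIV = g j z * (w - b) ^ j" for j
    proof (rule infsumI, rule norm_summable_imp_has_sum)
      show "summable (\<lambda>i. norm (t i j))"
        by (rule summable_comparison_test[OF _ sx[of "C * y ^ j"]]) (use t_bd in \<open>auto simp: mult_ac\<close>)
      show "(\<lambda>i. t i j) sums (g j z * (w - b) ^ j)"
        unfolding t_def by (intro sums_mult2 c_sums z)
    qed
    have outer: "infsum (\<lambda>j. g j z * (w - b) ^ j) UNIV = H (\<gamma> z * w)"
    proof (rule infsumI, rule norm_summable_imp_has_sum)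
      have "norm (g j z * (w - b) ^ j) \<le> C * y ^ j" for j
      proof -
        have "norm (g j z * (w - b) ^ j) \<le> (C / s ^ j) * cmod (w - b) ^ j"
          unfolding norm_mult norm_power using z by (intro mult_right_mono g_bd) auto
        then show ?thesis by (simp add: y_def power_divide)
      qed
      then show "summable (\<lambda>j. norm (g j z * (w - b) ^ j))"
        by (intro summable_comparison_test[OF _ sy[of C]]) auto
      show "(\<lambda>j. g j z * (w - b) ^ j) sums H (\<gamma> z * w)" by (rule g_sums[OF z w])
    qed
    have "infsum (\<lambda>(i, j). t i j) (UNIV \<times> UNIV) = infsum (\<lambda>i. infsum (\<lambda>j. t i j) UNIV) UNIV"
      by (rule infsum_Sigma'_banach[symmetric]) (rule ts)
    also have "\<dots> = infsum (\<lambda>j. infsum (\<lambda>i. t i j) UNIV) UNIV"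
      by (rule infsum_swap_banach[OF ts])
    also have "\<dots> = H (\<gamma> z * w)" unfolding inner outer ..
    finally show "((\<lambda>(i, j). c i j * (z - a) ^ i * (w - b) ^ j) has_sum H (\<gamma> z * w)) UNIV"
      using ts has_sum_infsum unfolding t_def by force
  qed
qed

section \<open>The domain and the branch of the logarithm\<close>

lemma connected_real_half_plane:
  "connected ((\<lambda>(b, l). (complex_of_real b, complex_of_real l)) ` ({0<..} \<times> UNIV))"
  by (intro connected_continuous_image connected_Times) (auto simp: case_prod_unfold intro!: continuous_intros)

text \<open>Connectedness of \<open>D\<close> and reality of \<open>F\<close> at the real points
  determine the branch: two such functions differ by a constant integer multiple of
  \<open>2 * pi * \<i>\<close>, which has to be real. Integrability is asserted because the integral
  of a non-integrable function would be 0 by convention.\<close>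

theorem mainTheorem4:
  fixes L m p k :: real
  assumes "L > 0" and "m > 0" and "2 < p" and "p < 6" and "k > 0"
  shows "\<exists>(D :: (complex \<times> complex) set) (\<delta> :: real \<Rightarrow> real \<Rightarrow> real) (F :: complex \<times> complex \<Rightarrow> complex).
      open D \<and> connected D \<and>
      (\<forall>(\<beta>, lam) \<in> D. Re \<beta> > 0) \<and>
      (\<forall>b l. b > 0 \<longrightarrow> \<delta> b l > 0) \<and>
      {(\<beta>, lam). Re \<beta> > 0 \<and> \<bar>Im \<beta>\<bar> < \<delta> (Re \<beta>) (Re lam) \<and> \<bar>Im lam\<bar> < \<delta> (Re \<beta>) (Re lam)} \<subseteq> D \<and>
      analytic2_on F D \<and>
      (\<forall>(\<beta>, lam) \<in> D.
         integrable (conditioned_measure L m k 1) (boltzmann_weight L p \<beta> lam) \<and>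
         exp (F (\<beta>, lam)) = partition_function L m p k \<beta> lam) \<and>
      (\<forall>b l :: real. b > 0 \<longrightarrow> F (complex_of_real b, complex_of_real l) \<in> \<real>)"
proof -
  interpret circle_field L m using assms by unfold_locales
  let ?\<nu> = "conditioned_measure L m k 1"
  have prob: "prob_space ?\<nu>" and sets\<nu>: "sets ?\<nu> = sets (borel_Omega L)"
    using assms by (simp_all add: conditioned_measure_eq prob_space_shell_measure)
  interpret \<nu>: prob_space ?\<nu> by (rule prob)
  have Am: "power_integral L p \<in> borel_measurable ?\<nu>"
    unfolding measurable_cong_sets[OF sets\<nu> refl] using assms by (intro borel_measurable_power_integral) auto
  have Aint: "integrable ?\<nu> (\<lambda>\<psi>. exp (a * power_integral L p \<psi>))" if "a \<ge> 0" for a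
    using assms that by (intro integrable_exp_power_integral)
  note mgf = holomorphic_mgf[OF prob Am power_integral_nonneg Aint]
  \<comment> \<open>The partition function depends on \<open>(\<beta>, lam)\<close> through the
    single number \<open>\<beta> powr (1 - p / 2) * lam / p\<close>, and as a function of that
    number it is entire.\<close>
  define Z where "Z c = complex_of_real (exp (m\<^sup>2 * k / 2)) * (\<integral>\<psi>. exp (c * complex_of_real (power_integral L p \<psi>)) \<partial>?\<nu>)" for c
  have Z_hol: "Z holomorphic_on UNIV" unfolding Z_def[abs_def] by (intro holomorphic_intros mgf(2))
  have Z_real: "\<exists>r>0. Z (complex_of_real c) = complex_of_real r" for c
  proof -
    have "(\<integral>\<psi>. exp (complex_of_real c * complex_of_real (power_integral L p \<psi>)) \<partial>?\<nu>) = complex_of_real (\<integral>\<psi>. exp (c * power_integral L p \<psi>) \<partial>?\<nu>)"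
      by (simp add: exp_of_real flip: of_real_mult)
    moreover have "0 < (\<integral>\<psi>. exp (c * power_integral L p \<psi>) \<partial>?\<nu>)"
    proof -
      have "integrable ?\<nu> (\<lambda>\<psi>. exp (c * power_integral L p \<psi>))"
        using integrable_Re[OF mgf(1)[of "complex_of_real c"]] by (simp add: exp_of_real flip: of_real_mult)
      then show ?thesis
        using \<nu>.integral_less_AE_space[of "\<lambda>_. 0" "\<lambda>\<psi>. exp (c * power_integral L p \<psi>)"] \<nu>.emeasure_space_1 by simp
    qed
    ultimately show ?thesis unfolding Z_def
      by (intro exI[of _ "exp (m\<^sup>2 * k / 2) * (\<integral>\<psi>. exp (c * power_integral L p \<psi>) \<partial>?\<nu>)"]) simp
  qed
  define \<gamma> where "\<gamma> \<beta> = \<beta> powr complex_of_real (1 - p / 2) / complex_of_real p" for \<beta> :: complex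
  have \<gamma>_hol: "\<gamma> holomorphic_on {\<beta>. Re \<beta> > 0}"
    unfolding \<gamma>_def[abs_def] using assms by (intro holomorphic_intros) (auto simp: complex_nonpos_Reals_iff)
  have \<gamma>_real: "\<gamma> (complex_of_real b) = complex_of_real (b powr (1 - p / 2) / p)" if "b > 0" for b
    using that by (simp add: \<gamma>_def powr_of_real flip: of_real_diff)
  have weight: "boltzmann_weight L p \<beta> lam = (\<lambda>\<psi>. exp (\<gamma> \<beta> * lam * complex_of_real (power_integral L p \<psi>)))" for \<beta> lam
    using assms by (auto simp: boltzmann_weight_def \<gamma>_def circle_norm_powr fun_eq_iff)
  have part: "partition_function L m p k \<beta> lam = Z (\<gamma> \<beta> * lam)" for \<beta> lam
    by (simp add: partition_function_def weight Z_def)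
  \<comment> \<open>Here the principal logarithm of the partition function is holomorphic. The real
    points with positive first entry belong to this set, as the partition function is positive
    there.\<close>
  define G where "G = {x. Re (fst x) > 0 \<and> Re (Z (\<gamma> (fst x) * snd x)) > 0}"
  have "open G"
  proof -
    have cont: "continuous_on ({\<beta>. Re \<beta> > 0} \<times> UNIV) (\<lambda>x. Re (Z (\<gamma> (fst x) * snd x)))"
      by (intro continuous_intros continuous_on_compose2[OF holomorphic_on_imp_continuous_on[OF Z_hol]]
          continuous_on_compose2[OF holomorphic_on_imp_continuous_on[OF \<gamma>_hol]]) auto
    have "G = ({\<beta>. Re \<beta> > 0} \<times> UNIV) \<inter> (\<lambda>x. Re (Z (\<gamma> (fst x) * snd x))) -` {0<..}"
      by (auto simp: G_def)
    then show ?thesis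
      using continuous_open_preimage[OF cont _ open_greaterThan] by (simp add: open_Times open_halfspace_Re_gt)
  qed
  have G_real: "(complex_of_real b, complex_of_real l) \<in> G" if b: "b > 0" for b l
  proof -
    obtain r where "r > 0" "Z (complex_of_real (b powr (1 - p / 2) / p * l)) = complex_of_real r" using Z_real by blast
    then show ?thesis using b by (simp add: G_def \<gamma>_real)
  qed
  \<comment> \<open>Passing to a component secures connectedness. Since the real half-plane is
    connected and lies in \<open>G\<close>, the component of the one real point
    \<open>(1, 0)\<close> contains all of it.\<close>
  define D where "D = connected_component_set G (1, 0)"
  have D: "open D" "connected D" "D \<subseteq> G"
    unfolding D_def
    by (rule open_connected_component[OF \<open>open G\<close>], rule connected_connected_component, rule connected_component_subset)
  have D_real: "(complex_of_real b, complex_of_real l) \<in> D" if "b > 0" for b l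
  proof -
    have "(\<lambda>(b, l). (complex_of_real b, complex_of_real l)) ` ({0<..} \<times> UNIV) \<subseteq> D"
      unfolding D_def
      by (rule connected_component_maximal[OF _ connected_real_half_plane]) (use G_real in \<open>auto intro!: image_eqI[of _ _ "(1, 0)"]\<close>)
    then show ?thesis using that by auto
  qed
  have "\<exists>d. b > 0 \<longrightarrow> d > 0 \<and> ball (complex_of_real b, complex_of_real l) d \<subseteq> D" for b l
    using D(1) D_real[of b l] open_contains_ball by blast
  then obtain d where d: "\<And>b l. b > 0 \<Longrightarrow> d b l > 0" "\<And>b l. b > 0 \<Longrightarrow> ball (complex_of_real b, complex_of_real l) (d b l) \<subseteq> D"
    by metis
  define F where "F x = Ln (Z (\<gamma> (fst x) * snd x))" for x
  define S where "S = {c. Re (Z c) > 0}"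
  have "open S"
    unfolding S_def by (intro open_Collect_less continuous_intros holomorphic_on_imp_continuous_on Z_hol)
  have H: "(\<lambda>c. Ln (Z c)) holomorphic_on S"
    by (intro holomorphic_intros holomorphic_on_subset[OF Z_hol]) (auto simp: S_def complex_nonpos_Reals_iff)
  have "analytic2_on F D"
    unfolding analytic2_on_def
  proof (clarify)
    fix a b assume "(a, b) \<in> D"
    then have "a \<in> {\<beta>. Re \<beta> > 0}" "\<gamma> a * b \<in> S" using D(3) by (auto simp: G_def S_def)
    then show "\<exists>r>0. \<exists>c. \<forall>z w. cmod (z - a) < r \<and> cmod (w - b) < r \<longrightarrow>
       ((\<lambda>(i, j). c i j * (z - a) ^ i * (w - b) ^ j) has_sum F (z, w)) UNIV"
      using double_power_series_compose_mult[OF H \<open>open S\<close> \<gamma>_hol open_halfspace_Re_gt] by (simp add: F_def)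
  qed
  \<comment> \<open>Half the radius of the ball, because the product distance to the real point is
    at most \<open>\<bar>Im \<beta>\<bar> + \<bar>Im lam\<bar>\<close>.\<close>
  moreover have "{(\<beta>, lam). Re \<beta> > 0 \<and> \<bar>Im \<beta>\<bar> < d (Re \<beta>) (Re lam) / 2 \<and> \<bar>Im lam\<bar> < d (Re \<beta>) (Re lam) / 2} \<subseteq> D"
  proof clarify
    fix \<beta> lam :: complex
    assume *: "Re \<beta> > 0" "\<bar>Im \<beta>\<bar> < d (Re \<beta>) (Re lam) / 2" "\<bar>Im lam\<bar> < d (Re \<beta>) (Re lam) / 2"
    have "dist z (complex_of_real (Re z)) = \<bar>Im z\<bar>" for z by (simp add: dist_norm cmod_def)
    then have "dist (\<beta>, lam) (complex_of_real (Re \<beta>), complex_of_real (Re lam)) \<le> \<bar>Im \<beta>\<bar> + \<bar>Im lam\<bar>"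
      using sqrt_sum_squares_le_sum_abs[of "\<bar>Im \<beta>\<bar>" "\<bar>Im lam\<bar>"] by (simp add: dist_Pair_Pair)
    also have "\<dots> < d (Re \<beta>) (Re lam)" using * by linarith
    finally show "(\<beta>, lam) \<in> D" using d(2)[OF *(1), of "Re lam"] by (auto simp: dist_commute)
  qed
  moreover have "F (complex_of_real b, complex_of_real l) \<in> \<real>" if b: "b > 0" for b l
  proof -
    obtain r where r: "r > 0" "Z (complex_of_real (b powr (1 - p / 2) / p * l)) = complex_of_real r" using Z_real by blast
    then have "F (complex_of_real b, complex_of_real l) = complex_of_real (ln r)"
      using b by (simp add: F_def \<gamma>_real Ln_of_real)
    then show ?thesis by simp
  qed
  moreover have "integrable ?\<nu> (boltzmann_weight L p \<beta> lam)" "exp (F (\<beta>, lam)) = partition_function L m p k \<beta> lam"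
    if "(\<beta>, lam) \<in> D" for \<beta> lam
  proof -
    show "integrable ?\<nu> (boltzmann_weight L p \<beta> lam)" unfolding weight by (rule mgf(1))
    have "Z (\<gamma> \<beta> * lam) \<noteq> 0" using that D(3) by (auto simp: G_def)
    then show "exp (F (\<beta>, lam)) = partition_function L m p k \<beta> lam" by (simp add: F_def part)
  qed
  ultimately show ?thesis
    using D d(1) by (intro exI[of _ D] exI[of _ "\<lambda>b l. d b l / 2"] exI[of _ F] conjI) (auto simp: G_def)
qed

end
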